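(* Let $u\in\mathrm{BMOA}_{\mathrm{simp}}(\mathbb T)$ be such that the linear Hankel operator $\Gamma_u$ is self-adjoint. Then the polar decompositions of $\Gamma_u$ and $\widetilde\Gamma_u=\Gamma_uS$ can be written as $$\Gamma_u=\Psi_u(|\Gamma_u|)\,|\Gamma_u|,\qquad \widetilde\Gamma_u=\widetilde\Psi_u(|\widetilde\Gamma_u|)\,|\widetilde\Gamma_u|,$$ where one sets $\Psi_u(0)=\widetilde\Psi_u(0)=0$ in case of non-trivial kernels.
   Context: For a bounded operator $T$ on a Hilbert space, $|T|=\sqrt{T^*T}$, and the polar decomposition is $T=\Phi|T|$ with the unique partial isometry $\Phi$ with initial subspace $\overline{\mathrm{Ran}}\,T^*$ and final subspace $\overline{\mathrm{Ran}}\,T$ (closures of ranges). $H^2=H^2(\mathbb T)$ is the Hardy space on the unit circle, $P:L^2(\mathbb T)\to H^2$ is the orthogonal projection, $S$ is the shift $Sf(z)=zf(z)$ on $H^2$. For $u\in\mathrm{BMOA}(\mathbb T)$, $\Gamma_u$ is the bounded linear Hankel operator on $H^2$ whose matrix in the basis $\{z^k\}_{k\ge0}$ is $\{\widehat u_{j+k}\}_{j,k\ge0}$, where $\widehat u_k$ are the Fourier coefficients of $u$; $\widetilde\Gamma_u=\Gamma_uS=S^*\Gamma_u=\Gamma_{S^*u}$. The anti-linear Hankel operator is $H_uf=P(u\overline f)=\Gamma_u\mathbf C f$, where $\mathbf Cf(z)=\overline{f(\overline z)}$; and $\widetilde H_u:=S^*H_u=H_uS=H_{S^*u}$. The operators $H_u^2,\widetilde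 H_u^2$ are linear and positive semi-definite; $|H_u|:=(H_u^2)^{1/2}$, $|\widetilde H_u|:=(\widetilde H_u^2)^{1/2}$. The subspace $\overline{\mathrm{Ran}}\,H_u$ is invariant under $H_u$ and $\widetilde H_u$; $H_u^{\mathrm e}$, $\widetilde H_u^{\mathrm e}$ are the restrictions of $H_u$, $\widetilde H_u$ to $\overline{\mathrm{Ran}}\,H_u$. $\mathrm{BMOA}_{\mathrm{simp}}(\mathbb T)$ is the set of $u\in\mathrm{BMOA}(\mathbb T)$ such that both $(H_u^{\mathrm e})^2$ and $(\widetilde H_u^{\mathrm e})^2$ have simple spectra (i.e. possess a cyclic vector). For $u\in\mathrm{BMOA}_{\mathrm{simp}}(\mathbb T)$ the vector $u$ lies in $\overline{\mathrm{Ran}}\,H_u$ and is cyclic for both $|H_u^{\mathrm e}|$ and $|\widetilde H_u^{\mathrm e}|$. Let $\rho$, $\widetilde\rho$ be the spectral measures: $\int f\,d\rho=\langle f(|H_u|)u,u\rangle$, $\int f\,d\widetilde\rho=\langle f(|\widetilde H_u|)u,u\rangle$ for continuous $f$; $\rho$ is carried by $(0,\infty)$, $\widetilde\rho$ by $[0,\infty)$, and $\widetilde\rho_0=\widetilde\rho|_{(0,\infty)}$. There exist unimodular functions $\Psi_u$, unique in $L^\infty(\rho)$, and $\widetilde\Psi_u$, unique in $L^\infty(\widetilde\rho_0)$, such that $$H_u^{\mathrm e}f(|H_u^{\mathrm e}|)u=|H_u^{\mathrm e}|\,\overline{\Psi_u}(|H_u^{\mathrm e}|)\,\overline f(|H_u^{\mathrm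 e}|)u,\quad f\in L^2(\rho),$$ $$\widetilde H_u^{\mathrm e}f(|\widetilde H_u^{\mathrm e}|)u=|\widetilde H_u^{\mathrm e}|\,\widetilde\Psi_u(|\widetilde H_u^{\mathrm e}|)\,\overline f(|\widetilde H_u^{\mathrm e}|)u,\quad f\in L^2(\widetilde\rho).$$ *)

theory Defs
  imports "HOL-Analysis.Analysis"
begin

section \<open>Complex inner product spaces\<close>

text \<open>The inner product is linear in the first argument; its real part is the library's \<open>inner\<close>,
  so norm, topology and completeness are those of the type class \<open>real_inner\<close>.\<close>

class complex_inner = real_inner +
  fixes scaleC :: "complex \<Rightarrow> 'a \<Rightarrow> 'a"
    and cinner :: "'a \<Rightarrow> 'a \<Rightarrow> complex"
  assumes scaleC_add_right: "scaleC c (x + y) = scaleC c x + scaleC c y"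
    and scaleC_add_left: "scaleC (c + d) x = scaleC c x + scaleC d x"
    and scaleC_scaleC: "scaleC c (scaleC d x) = scaleC (c * d) x"
    and scaleC_of_real: "scaleC (complex_of_real r) x = r *\<^sub>R x"
    and cinner_commute: "cinner x y = cnj (cinner y x)"
    and cinner_add_left: "cinner (x + y) z = cinner x z + cinner y z"
    and cinner_scaleC_left: "cinner (scaleC c x) y = c * cinner x y"
    and Re_cinner: "Re (cinner x y) = inner x y"


section \<open>Bounded operators on a closed subspace\<close>

text \<open>Operators on a closed subspace \<open>V\<close> are functions on the ambient type of which only the
  restriction to \<open>V\<close> matters.\<close>

definition bounded_op :: "'a::complex_inner set \<Rightarrow> ('a \<Rightarrow> 'a) \<Rightarrow> bool" where
  "bounded_op V T \<longleftrightarrow>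
     T ` V \<subseteq> V \<and>
     (\<forall>x\<in>V. \<forall>y\<in>V. T (x + y) = T x + T y) \<and>
     (\<forall>c. \<forall>x\<in>V. T (scaleC c x) = scaleC c (T x)) \<and>
     (\<exists>K. \<forall>x\<in>V. norm (T x) \<le> K * norm x)"

definition self_adjoint_op :: "'a::complex_inner set \<Rightarrow> ('a \<Rightarrow> 'a) \<Rightarrow> bool" where
  "self_adjoint_op V T \<longleftrightarrow>
     bounded_op V T \<and> (\<forall>x\<in>V. \<forall>y\<in>V. cinner (T x) y = cinner x (T y))"

definition positive_op :: "'a::complex_inner set \<Rightarrow> ('a \<Rightarrow> 'a) \<Rightarrow> bool" where
  "positive_op V T \<longleftrightarrow>
     self_adjoint_op V T \<and> (\<forall>x\<in>V. 0 \<le> Re (cinner (T x) x))"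

definition adj_op :: "'a::complex_inner set \<Rightarrow> ('a \<Rightarrow> 'a) \<Rightarrow> 'a \<Rightarrow> 'a" where
  "adj_op V T x = (THE y. y \<in> V \<and> (\<forall>z\<in>V. cinner (T z) x = cinner z y))"

text \<open>The positive square root of a positive operator is unique on \<open>V\<close>; the choice operator only
  fixes the irrelevant values outside \<open>V\<close>.\<close>

definition sqrt_op :: "'a::complex_inner set \<Rightarrow> ('a \<Rightarrow> 'a) \<Rightarrow> 'a \<Rightarrow> 'a" where
  "sqrt_op V A = (SOME B. positive_op V B \<and> (\<forall>x\<in>V. B (B x) = A x))"

definition abs_op :: "'a::complex_inner set \<Rightarrow> ('a \<Rightarrow> 'a) \<Rightarrow> 'a \<Rightarrow> 'a" where
  "abs_op V T = sqrt_op V (adj_op V T \<circ> T)"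

definition partial_isometry ::
    "'a::complex_inner set \<Rightarrow> ('a \<Rightarrow> 'a) \<Rightarrow> 'a set \<Rightarrow> 'a set \<Rightarrow> bool" where
  "partial_isometry V \<Phi> M N \<longleftrightarrow>
     bounded_op V \<Phi> \<and>
     (\<forall>x\<in>M. norm (\<Phi> x) = norm x) \<and>
     (\<forall>x\<in>V. (\<forall>y\<in>M. cinner x y = 0) \<longrightarrow> \<Phi> x = 0) \<and>
     \<Phi> ` M = N"

definition polar_decomposition ::
    "'a::complex_inner set \<Rightarrow> ('a \<Rightarrow> 'a) \<Rightarrow> ('a \<Rightarrow> 'a) \<Rightarrow> bool" where
  "polar_decomposition V T \<Phi> \<longleftrightarrow>
     partial_isometry V \<Phi> (closure (adj_op V T ` V)) (closure (T ` V)) \<and>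
     (\<forall>x\<in>V. T x = \<Phi> (abs_op V T x))"

definition cyclic_vector :: "'a::complex_inner set \<Rightarrow> ('a \<Rightarrow> 'a) \<Rightarrow> 'a \<Rightarrow> bool" where
  "cyclic_vector V A v \<longleftrightarrow>
     v \<in> V \<and> closure {\<Sum>n<N. scaleC (c n) ((A ^^ n) v) | (N::nat) (c::nat \<Rightarrow> complex). True} = V"

definition simple_spectrum :: "'a::complex_inner set \<Rightarrow> ('a \<Rightarrow> 'a) \<Rightarrow> bool" where
  "simple_spectrum V A \<longleftrightarrow> (\<exists>v. cyclic_vector V A v)"


section \<open>Spectral measures and Borel functional calculus\<close>

definition projection_measure ::
    "'a::complex_inner set \<Rightarrow> (real set \<Rightarrow> 'a \<Rightarrow> 'a) \<Rightarrow> bool" where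
  "projection_measure V E \<longleftrightarrow>
     (\<forall>B\<in>sets borel. self_adjoint_op V (E B) \<and> (\<forall>x\<in>V. E B (E B x) = E B x)) \<and>
     (\<forall>x\<in>V. E UNIV x = x) \<and>
     (\<forall>B :: nat \<Rightarrow> real set. range B \<subseteq> sets borel \<longrightarrow> disjoint_family B \<longrightarrow>
        (\<forall>x\<in>V. (\<lambda>i. E (B i) x) sums E (\<Union>i. B i) x))"

definition scalar_measure ::
    "(real set \<Rightarrow> 'a::complex_inner \<Rightarrow> 'a) \<Rightarrow> 'a \<Rightarrow> real measure" where
  "scalar_measure E x = measure_of UNIV (sets borel) (\<lambda>B. ennreal (Re (cinner (E B x) x)))"

text \<open>\<open>A = \<integral> t dE(t)\<close>; on a complex space the quadratic form determines the operator.\<close>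

definition spectral_resolution ::
    "'a::complex_inner set \<Rightarrow> ('a \<Rightarrow> 'a) \<Rightarrow> (real set \<Rightarrow> 'a \<Rightarrow> 'a) \<Rightarrow> bool" where
  "spectral_resolution V A E \<longleftrightarrow>
     projection_measure V E \<and>
     (\<forall>x\<in>V. integrable (scalar_measure E x) (\<lambda>t. t) \<and>
            cinner (A x) x = complex_of_real (\<integral>t. t \<partial>scalar_measure E x))"

text \<open>By the spectral theorem a bounded self-adjoint \<open>A\<close> has exactly one spectral resolution, up to
  values at non-Borel sets and outside \<open>V\<close>.\<close>

definition spectral_family ::
    "'a::complex_inner set \<Rightarrow> ('a \<Rightarrow> 'a) \<Rightarrow> real set \<Rightarrow> 'a \<Rightarrow> 'a" where
  "spectral_family V A = (SOME E. spectral_resolution V A E)"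

definition spectral_measure ::
    "'a::complex_inner set \<Rightarrow> ('a \<Rightarrow> 'a) \<Rightarrow> 'a \<Rightarrow> real measure" where
  "spectral_measure V A x = scalar_measure (spectral_family V A) x"

definition bounded_calculus ::
    "'a::complex_inner set \<Rightarrow> ('a \<Rightarrow> 'a) \<Rightarrow> (real \<Rightarrow> complex) \<Rightarrow> 'a \<Rightarrow> 'a" where
  "bounded_calculus V A f =
     (SOME T. bounded_op V T \<and> (\<forall>x\<in>V. cinner (T x) x = (\<integral>t. f t \<partial>spectral_measure V A x)))"

text \<open>\<open>f(A) x\<close> for a Borel function \<open>f\<close>, possibly unbounded, and a vector \<open>x\<close> whose spectral measure
  \<open>\<mu>\<close> satisfies \<open>f \<in> L\<^sup>2(\<mu>)\<close>: the limit along the truncations of \<open>f\<close>.\<close>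

definition borel_calculus ::
    "'a::complex_inner set \<Rightarrow> ('a \<Rightarrow> 'a) \<Rightarrow> (real \<Rightarrow> complex) \<Rightarrow> 'a \<Rightarrow> 'a" where
  "borel_calculus V A f x =
     lim (\<lambda>n::nat. bounded_calculus V A (\<lambda>t. if norm (f t) \<le> real n then f t else 0) x)"


section \<open>The space \<open>L\<^sup>2\<close> of the unit circle\<close>

definition circle_measure :: "complex measure" where
  "circle_measure = distr (uniform_measure lborel {0..2*pi}) borel cis"

definition square_integrable :: "(complex \<Rightarrow> complex) \<Rightarrow> bool" where
  "square_integrable f \<longleftrightarrow>
     f \<in> borel_measurable borel \<and> integrable circle_measure (\<lambda>z. (norm (f z))\<^sup>2)"

definition L2_rel :: "(complex \<Rightarrow> complex) \<Rightarrow> (complex \<Rightarrow> complex) \<Rightarrow> bool" where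
  "L2_rel f g \<longleftrightarrow>
     square_integrable f \<and> square_integrable g \<and> (AE z in circle_measure. f z = g z)"

lemma sets_circle_measure [simp, measurable_cong]: "sets circle_measure = sets borel"
  by (simp add: circle_measure_def)

lemma space_circle_measure [simp]: "space circle_measure = UNIV"
  by (simp add: circle_measure_def)

lemma emeasure_circle_measure_UNIV: "emeasure circle_measure UNIV = 1"
proof -
  have [measurable]: "cis \<in> borel_measurable borel"
    by (intro borel_measurable_continuous_onI continuous_intros)
  have "emeasure circle_measure UNIV = emeasure (uniform_measure lborel {0..2*pi}) UNIV"
    unfolding circle_measure_def by (subst emeasure_distr) auto
  also have "\<dots> = 1"
    by (subst emeasure_uniform_measure) (auto simp: ennreal_divide_self)
  finally show ?thesis .
qed

interpretation circle_measure: finite_measure circle_measure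
  by standard (simp add: emeasure_circle_measure_UNIV)

lemma AE_circle_norm_1: "AE z in circle_measure. norm z = 1"
proof -
  have [measurable]: "cis \<in> borel_measurable borel"
    by (intro borel_measurable_continuous_onI continuous_intros)
  show ?thesis
    unfolding circle_measure_def by (subst AE_distr_iff) auto
qed

quotient_type L2_circle = "complex \<Rightarrow> complex" / partial: L2_rel
proof (rule part_equivpI)
  have "square_integrable (\<lambda>_. 0)" by (simp add: square_integrable_def)
  then show "\<exists>f. L2_rel f f" unfolding L2_rel_def by (intro exI[of _ "\<lambda>_. 0"]) simp
  show "symp L2_rel" unfolding L2_rel_def by (rule sympI) auto
  show "transp L2_rel" unfolding L2_rel_def by (rule transpI) (auto elim: AE_mp)
qed

lemma square_integrable_add:
  assumes "square_integrable f" "square_integrable g"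
  shows "square_integrable (\<lambda>z. f z + g z)"
proof -
  have [measurable]: "f \<in> borel_measurable borel" "g \<in> borel_measurable borel"
    using assms by (auto simp: square_integrable_def)
  have "integrable circle_measure (\<lambda>z. (norm (f z + g z))\<^sup>2)"
  proof (rule Bochner_Integration.integrable_bound)
    show "integrable circle_measure (\<lambda>z. 2 * (norm (f z))\<^sup>2 + 2 * (norm (g z))\<^sup>2)"
      using assms by (auto simp: square_integrable_def)
    have "(norm (a + b))\<^sup>2 \<le> 2 * (norm a)\<^sup>2 + 2 * (norm b)\<^sup>2" for a b :: complex
    proof -
      have "(norm (a + b))\<^sup>2 \<le> (norm a + norm b)\<^sup>2"
        by (intro power_mono norm_triangle_ineq) auto
      also have "\<dots> \<le> 2 * (norm a)\<^sup>2 + 2 * (norm b)\<^sup>2"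
        using sum_squares_bound[of "norm a" "norm b"] by (simp add: power2_sum)
      finally show ?thesis .
    qed
    then show "AE z in circle_measure. norm ((norm (f z + g z))\<^sup>2)
        \<le> norm (2 * (norm (f z))\<^sup>2 + 2 * (norm (g z))\<^sup>2)"
      by (intro AE_I2) (simp del: norm_power)
  qed simp
  then show ?thesis by (simp add: square_integrable_def)
qed

lemma square_integrable_mult_bounded:
  assumes "square_integrable f" and [measurable]: "h \<in> borel_measurable borel"
    and "AE z in circle_measure. norm (h z) \<le> K"
  shows "square_integrable (\<lambda>z. h z * f z)"
proof -
  have [measurable]: "f \<in> borel_measurable borel"
    using assms by (auto simp: square_integrable_def)
  have "integrable circle_measure (\<lambda>z. (norm (h z * f z))\<^sup>2)"
  proof (rule Bochner_Integration.integrable_bound)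
    show "integrable circle_measure (\<lambda>z. K\<^sup>2 * (norm (f z))\<^sup>2)"
      using assms by (auto simp: square_integrable_def)
    show "AE z in circle_measure. norm ((norm (h z * f z))\<^sup>2) \<le> norm (K\<^sup>2 * (norm (f z))\<^sup>2)"
      using assms(3)
    proof eventually_elim
      case (elim z)
      then have "(norm (h z))\<^sup>2 \<le> K\<^sup>2" by (intro power_mono) auto
      then have "(norm (h z))\<^sup>2 * (norm (f z))\<^sup>2 \<le> K\<^sup>2 * (norm (f z))\<^sup>2"
        by (intro mult_right_mono) auto
      then show ?case by (simp add: norm_mult power_mult_distrib)
    qed
  qed simp
  then show ?thesis using assms by (simp add: square_integrable_def)
qed

lemma square_integrable_scale:
  "square_integrable f \<Longrightarrow> square_integrable (\<lambda>z. c * f z)"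
  by (rule square_integrable_mult_bounded[where K = "norm c"]) auto

lemma integrable_mult_cnj:
  assumes "square_integrable f" "square_integrable g"
  shows "integrable circle_measure (\<lambda>z. f z * cnj (g z))"
proof (rule Bochner_Integration.integrable_bound)
  have [measurable]: "f \<in> borel_measurable borel" "g \<in> borel_measurable borel"
    using assms by (auto simp: square_integrable_def)
  show "integrable circle_measure (\<lambda>z. (norm (f z))\<^sup>2 + (norm (g z))\<^sup>2)"
    using assms by (auto simp: square_integrable_def)
  have [measurable]: "cnj \<in> borel_measurable borel"
    by (intro borel_measurable_continuous_onI continuous_intros)
  show "(\<lambda>z. f z * cnj (g z)) \<in> borel_measurable circle_measure" by measurable
  have "norm a * norm b \<le> (norm a)\<^sup>2 + (norm b)\<^sup>2" for a b :: complex
  proof -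
    have "2 * norm a * norm b \<le> (norm a)\<^sup>2 + (norm b)\<^sup>2" by (rule sum_squares_bound)
    moreover have "0 \<le> norm a * norm b" by simp
    ultimately show ?thesis by linarith
  qed
  then show "AE z in circle_measure. norm (f z * cnj (g z)) \<le> norm ((norm (f z))\<^sup>2 + (norm (g z))\<^sup>2)"
    by (intro AE_I2) (simp add: norm_mult)
qed

instantiation L2_circle :: complex_inner
begin

lift_definition zero_L2_circle :: L2_circle is "\<lambda>_. 0"
  by (simp add: L2_rel_def square_integrable_def)

lift_definition plus_L2_circle :: "L2_circle \<Rightarrow> L2_circle \<Rightarrow> L2_circle" is "\<lambda>f g z. f z + g z"
  by (auto simp: L2_rel_def intro: square_integrable_add)

lift_definition scaleC_L2_circle :: "complex \<Rightarrow> L2_circle \<Rightarrow> L2_circle" is "\<lambda>c f z. c * f z"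
  by (auto simp: L2_rel_def intro: square_integrable_scale)

lift_definition cinner_L2_circle :: "L2_circle \<Rightarrow> L2_circle \<Rightarrow> complex"
  is "\<lambda>f g. \<integral>z. f z * cnj (g z) \<partial>circle_measure"
proof -
  fix f f' g g' assume *: "L2_rel f f'" "L2_rel g g'"
  have "square_integrable f" "square_integrable g" "square_integrable f'" "square_integrable g'"
    using * by (auto simp: L2_rel_def)
  note ints = integrable_mult_cnj[OF this(1,2)] integrable_mult_cnj[OF this(3,4)]
  show "(\<integral>z. f z * cnj (g z) \<partial>circle_measure) = (\<integral>z. f' z * cnj (g' z) \<partial>circle_measure)"
    using * ints by (intro integral_cong_AE) (auto simp: L2_rel_def elim: AE_mp)
qed

definition scaleR_L2_circle :: "real \<Rightarrow> L2_circle \<Rightarrow> L2_circle" where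
  "scaleR_L2_circle r f = scaleC (complex_of_real r) f"
definition uminus_L2_circle :: "L2_circle \<Rightarrow> L2_circle" where
  "uminus_L2_circle f = scaleC (- 1) f"
definition minus_L2_circle :: "L2_circle \<Rightarrow> L2_circle \<Rightarrow> L2_circle" where
  "minus_L2_circle f g = f + (- g)"
definition inner_L2_circle :: "L2_circle \<Rightarrow> L2_circle \<Rightarrow> real" where
  "inner_L2_circle f g = Re (cinner f g)"
definition norm_L2_circle :: "L2_circle \<Rightarrow> real" where
  "norm_L2_circle f = sqrt (inner f f)"
definition sgn_L2_circle :: "L2_circle \<Rightarrow> L2_circle" where
  "sgn_L2_circle f = inverse (norm f) *\<^sub>R f"
definition dist_L2_circle :: "L2_circle \<Rightarrow> L2_circle \<Rightarrow> real" where
  "dist_L2_circle f g = norm (f - g)"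
definition uniformity_L2_circle :: "(L2_circle \<times> L2_circle) filter" where
  "uniformity_L2_circle = (INF e\<in>{0<..}. principal {(x, y). dist x y < e})"
definition open_L2_circle :: "L2_circle set \<Rightarrow> bool" where
  "open_L2_circle U \<longleftrightarrow> (\<forall>x\<in>U. eventually (\<lambda>(x', y). x' = x \<longrightarrow> y \<in> U) uniformity)"

instance
proof
  fix x y z :: L2_circle and c d :: complex and r s :: real
  show assoc: "x + y + z = x + (y + z)"
    by transfer (auto simp: L2_rel_def add.assoc intro!: square_integrable_add)
  show comm: "x + y = y + x"
    by transfer (auto simp: L2_rel_def add.commute intro!: square_integrable_add)
  show "0 + x = x"
    by transfer (auto simp: L2_rel_def)
  have C0: "scaleC 0 w = 0" for w :: L2_circle
    by transfer (auto simp: L2_rel_def square_integrable_def)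
  have C1: "scaleC 1 w = w" for w :: L2_circle
    by transfer (auto simp: L2_rel_def)
  have Cr: "scaleC c (v + w) = scaleC c v + scaleC c w" for c and v w :: L2_circle
    by transfer
      (auto simp: L2_rel_def algebra_simps intro!: square_integrable_add square_integrable_scale)
  have Cl: "scaleC (c + d) w = scaleC c w + scaleC d w" for c d and w :: L2_circle
    by transfer
      (auto simp: L2_rel_def algebra_simps intro!: square_integrable_add square_integrable_scale)
  have CC: "scaleC c (scaleC d w) = scaleC (c * d) w" for c d and w :: L2_circle
    by transfer (auto simp: L2_rel_def mult.assoc intro!: square_integrable_scale)
  show "- x + x = 0"
    using Cl[of "-1" 1 x] by (simp add: uminus_L2_circle_def C0 C1)
  show "x - y = x + - y" by (simp add: minus_L2_circle_def)
  show "scaleC c (x + y) = scaleC c x + scaleC c y" by (rule Cr)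
  show "scaleC (c + d) x = scaleC c x + scaleC d x" by (rule Cl)
  show "scaleC c (scaleC d x) = scaleC (c * d) x" by (rule CC)
  show "scaleC (complex_of_real r) x = r *\<^sub>R x" by (simp add: scaleR_L2_circle_def)
  show "r *\<^sub>R (x + y) = r *\<^sub>R x + r *\<^sub>R y" by (simp add: scaleR_L2_circle_def Cr)
  show "(r + s) *\<^sub>R x = r *\<^sub>R x + s *\<^sub>R x" by (simp add: scaleR_L2_circle_def Cl)
  show "r *\<^sub>R s *\<^sub>R x = (r * s) *\<^sub>R x" by (simp add: scaleR_L2_circle_def CC)
  show "1 *\<^sub>R x = x" by (simp add: scaleR_L2_circle_def C1)
  show "sgn x = inverse (norm x) *\<^sub>R x" by (rule sgn_L2_circle_def)
  show "dist x y = norm (x - y)" by (rule dist_L2_circle_def)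
  show "(uniformity :: (L2_circle \<times> L2_circle) filter) =
      (INF e\<in>{0<..}. principal {(x, y). dist x y < e})"
    by (rule uniformity_L2_circle_def)
  show "open U \<longleftrightarrow> (\<forall>x\<in>U. eventually (\<lambda>(x', y). x' = x \<longrightarrow> y \<in> U) uniformity)"
    for U :: "L2_circle set"
    by (rule open_L2_circle_def)
  have icomm: "cinner v w = cnj (cinner w v)" for v w :: L2_circle
    by transfer (simp add: Bochner_Integration.integral_cnj[symmetric] mult.commute del: Bochner_Integration.integral_cnj)
  have iadd: "cinner (u + v) w = cinner u w + cinner v w" for u v w :: L2_circle
    by transfer (auto simp: L2_rel_def distrib_right integrable_mult_cnj)
  have iscale: "cinner (scaleC c v) w = c * cinner v w" for c and v w :: L2_circle
    by transfer (auto simp: L2_rel_def mult.assoc)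
  show "cinner x y = cnj (cinner y x)" by (rule icomm)
  show "cinner (x + y) z = cinner x z + cinner y z" by (rule iadd)
  show "cinner (scaleC c x) y = c * cinner x y" by (rule iscale)
  show "Re (cinner x y) = inner x y" by (simp add: inner_L2_circle_def)
  show "inner x y = inner y x" using icomm[of x y] by (simp add: inner_L2_circle_def)
  show "inner (x + y) z = inner x z + inner y z" by (simp add: inner_L2_circle_def iadd)
  show "inner (r *\<^sub>R x) y = r * inner x y"
    by (simp add: inner_L2_circle_def scaleR_L2_circle_def iscale)
  have self: "(\<integral>z. f z * cnj (f z) \<partial>circle_measure)
      = complex_of_real (\<integral>z. (norm (f z))\<^sup>2 \<partial>circle_measure)" for f
    unfolding complex_norm_square[symmetric] by (rule integral_complex_of_real)
  show "0 \<le> inner x x"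
    unfolding inner_L2_circle_def by transfer (simp add: self)
  show "inner x x = 0 \<longleftrightarrow> x = 0"
    unfolding inner_L2_circle_def
  proof transfer
    fix f assume f: "L2_rel f f"
    then have "integrable circle_measure (\<lambda>z. (norm (f z))\<^sup>2)" "square_integrable f"
      by (auto simp: L2_rel_def square_integrable_def)
    then have "(\<integral>z. (norm (f z))\<^sup>2 \<partial>circle_measure) = 0 \<longleftrightarrow> (AE z in circle_measure. f z = 0)"
      by (subst integral_nonneg_eq_0_iff_AE) auto
    then show "Re (\<integral>z. f z * cnj (f z) \<partial>circle_measure) = 0 \<longleftrightarrow> L2_rel f (\<lambda>_. 0)"
      using f by (auto simp: self L2_rel_def square_integrable_def)
  qed
  show "norm x = sqrt (inner x x)" by (rule norm_L2_circle_def)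
qed

end


section \<open>Hardy space, Hankel operators and BMOA\<close>

definition fourier_coeff :: "(complex \<Rightarrow> complex) \<Rightarrow> int \<Rightarrow> complex" where
  "fourier_coeff f k = (\<integral>z. f z * z powi (- k) \<partial>circle_measure)"

text \<open>\<open>rep_L2_circle\<close> picks a square-integrable function representing a class modulo null sets.\<close>

definition H2 :: "L2_circle set" where
  "H2 = {f. \<forall>k<0. fourier_coeff (rep_L2_circle f) k = 0}"

text \<open>The projection \<open>P\<close>, in the form that makes sense on integrable functions: it deletes the
  negative Fourier coefficients. On \<open>L\<^sup>2\<close> it is the orthogonal projection onto \<open>H\<^sup>2\<close>.\<close>

definition szego_projection :: "(complex \<Rightarrow> complex) \<Rightarrow> L2_circle" where
  "szego_projection g =
     (THE h. h \<in> H2 \<and> (\<forall>k\<ge>0. fourier_coeff (rep_L2_circle h) k = fourier_coeff g k))"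

lemma square_integrable_shift: "square_integrable f \<Longrightarrow> square_integrable (\<lambda>z. z * f z)"
  by (rule square_integrable_mult_bounded[where K = 1])
    (use AE_circle_norm_1 in \<open>auto elim: AE_mp\<close>)

lift_definition shift :: "L2_circle \<Rightarrow> L2_circle" is "\<lambda>f z. z * f z"
  by (auto simp: L2_rel_def intro: square_integrable_shift)

text \<open>In the basis of monomials the matrix has the Fourier coefficient of \<open>u\<close> at \<open>j + k\<close> as its entry \<open>(j, k)\<close>.\<close>

definition Gamma_op :: "L2_circle \<Rightarrow> L2_circle \<Rightarrow> L2_circle" where
  "Gamma_op u f =
     (THE h. h \<in> H2 \<and>
        (\<forall>j::nat. (\<lambda>k::nat. fourier_coeff (rep_L2_circle u) (int (j + k)) *
                             fourier_coeff (rep_L2_circle f) (int k))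
                  sums fourier_coeff (rep_L2_circle h) (int j)))"

definition Gamma_tilde :: "L2_circle \<Rightarrow> L2_circle \<Rightarrow> L2_circle" where
  "Gamma_tilde u = Gamma_op u \<circ> shift"

definition H_op :: "L2_circle \<Rightarrow> L2_circle \<Rightarrow> L2_circle" where
  "H_op u f = szego_projection (\<lambda>z. rep_L2_circle u z * cnj (rep_L2_circle f z))"

definition H_tilde :: "L2_circle \<Rightarrow> L2_circle \<Rightarrow> L2_circle" where
  "H_tilde u = H_op u \<circ> shift"

definition ran_H :: "L2_circle \<Rightarrow> L2_circle set" where
  "ran_H u = closure (H_op u ` H2)"

definition bounded_mean_oscillation :: "(complex \<Rightarrow> complex) \<Rightarrow> bool" where
  "bounded_mean_oscillation f \<longleftrightarrow>
     (\<exists>K. \<forall>a h. 0 < h \<and> h \<le> 2 * pi \<longrightarrow>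
        (let I = cis ` {a..a + h};
             m = measure circle_measure I;
             f\<^sub>I = (LINT z:I|circle_measure. f z) / complex_of_real m
         in (LINT z:I|circle_measure. norm (f z - f\<^sub>I)) / m \<le> K))"

definition BMOA :: "L2_circle set" where
  "BMOA = {u \<in> H2. bounded_mean_oscillation (rep_L2_circle u)}"

definition BMOA_simp :: "L2_circle set" where
  "BMOA_simp = {u \<in> BMOA. simple_spectrum (ran_H u) (H_op u \<circ> H_op u) \<and>
                          simple_spectrum (ran_H u) (H_tilde u \<circ> H_tilde u)}"

text \<open>The square of an anti-linear \<open>H\<close> is linear, so the modulus is its positive square root; \<open>V\<close> is
  \<open>H2\<close>, or the closure \<open>ran_H u\<close> of the range for the restricted operators.\<close>

definition abs_H :: "L2_circle set \<Rightarrow> L2_circle \<Rightarrow> L2_circle \<Rightarrow> L2_circle" where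
  "abs_H V u = sqrt_op V (H_op u \<circ> H_op u)"

definition abs_H_tilde :: "L2_circle set \<Rightarrow> L2_circle \<Rightarrow> L2_circle \<Rightarrow> L2_circle" where
  "abs_H_tilde V u = sqrt_op V (H_tilde u \<circ> H_tilde u)"

definition rho :: "L2_circle \<Rightarrow> real measure" where
  "rho u = spectral_measure H2 (abs_H H2 u) u"

definition rho_tilde :: "L2_circle \<Rightarrow> real measure" where
  "rho_tilde u = spectral_measure H2 (abs_H_tilde H2 u) u"

text \<open>The functions are determined only almost everywhere; the two predicates single out their
  Borel representatives. The second one leaves the value at 0 free.\<close>

definition is_Psi :: "L2_circle \<Rightarrow> (real \<Rightarrow> complex) \<Rightarrow> bool" where
  "is_Psi u \<Psi> \<longleftrightarrow>
     \<Psi> \<in> borel_measurable borel \<and>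
     (AE t in rho u. norm (\<Psi> t) = 1) \<and>
     (\<forall>f \<in> borel_measurable borel. integrable (rho u) (\<lambda>t. (norm (f t))\<^sup>2) \<longrightarrow>
        (let V = ran_H u; A = abs_H V u in
           H_op u (borel_calculus V A f u) =
           A (borel_calculus V A (\<lambda>t. cnj (\<Psi> t)) (borel_calculus V A (\<lambda>t. cnj (f t)) u))))"

definition is_Psi_tilde :: "L2_circle \<Rightarrow> (real \<Rightarrow> complex) \<Rightarrow> bool" where
  "is_Psi_tilde u \<Psi> \<longleftrightarrow>
     \<Psi> \<in> borel_measurable borel \<and>
     (AE t in restrict_space (rho_tilde u) {0<..}. norm (\<Psi> t) = 1) \<and>
     (\<forall>f \<in> borel_measurable borel. integrable (rho_tilde u) (\<lambda>t. (norm (f t))\<^sup>2) \<longrightarrow>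
        (let V = ran_H u; A = abs_H_tilde V u in
           H_tilde u (borel_calculus V A f u) =
           A (borel_calculus V A \<Psi> (borel_calculus V A (\<lambda>t. cnj (f t)) u))))"

text \<open>The convention that the value at 0 is 0 in case of a non-trivial kernel of \<open>T\<close> in \<open>H2\<close>.\<close>

definition zero_at_kernel ::
    "(L2_circle \<Rightarrow> L2_circle) \<Rightarrow> (real \<Rightarrow> complex) \<Rightarrow> real \<Rightarrow> complex" where
  "zero_at_kernel T \<Psi> t = (if t = 0 \<and> (\<exists>x\<in>H2. x \<noteq> 0 \<and> T x = 0) then 0 else \<Psi> t)"

end

theory Submission
  imports Defs "HOL-Probability.Distribution_Functions"
begin

text \<open>Self-adjointness of \<open>\<Gamma>\<close> makes the symbol \<open>u\<close> have real Fourier coefficients, so coefficientwise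
  conjugation \<open>C\<close> fixes \<open>u\<close> and commutes with \<open>\<Gamma>\<close>. Hence \<open>H = \<Gamma> C\<close> has the same modulus as \<open>\<Gamma>\<close>, and
  the defining relation of \<open>\<Psi>\<close>, read on the \<open>C\<close>-invariant vectors \<open>\<bar>\<Gamma>\<bar>\<^sup>2\<^sup>n u\<close>, says
  \<open>\<Gamma> = \<bar>\<Gamma>\<bar> cnj \<Psi>(\<bar>\<Gamma>\<bar>)\<close> on the closed span of these vectors; taking adjoints gives the claim there.
  The span is dense in the closed range of \<open>\<Gamma>\<close>: on its complement \<open>N\<close> in the range, simplicity of the two
  spectra makes \<open>\<Gamma>\<close> and \<open>\<Gamma>'\<close> leave \<open>N\<close> invariant, \<open>\<Gamma> = S \<Gamma>'\<close> holds there, and so \<open>N \<subseteq> S N\<close>,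
  which forces \<open>N = 0\<close>. The operator \<open>\<Gamma>' = \<Gamma> S\<close> is treated in the same way.\<close>

section \<open>Complex inner product spaces and closed subspaces\<close>

text \<open>Square roots, spectral families and the functional calculus are specified by choice
  operators, so they mean nothing until something is shown to satisfy the specification. Hence
  operator square roots, the spectral theorem, the Borel calculus and completeness of
  \<open>L2_circle\<close> are established here, the operator theory relative to a closed subspace
  \<open>V\<close>. The relation for \<open>\<Psi>\<close> is stated on \<open>ran_H u\<close> but
  the conclusion on \<open>H2\<close>. The calculi on the two spaces are unrelated choices; equality
  of moments identifies their spectral measures. Both assumptions of simple spectrum enter through
  one fact: self-adjoint operators commuting with a self-adjoint operator that has a cyclic vector
  commute with each other. It is applied to the projection onto \<open>N\<close> together with
  \<open>\<Gamma>\<close> (over the square of \<open>\<Gamma>\<close>), and together with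
  \<open>\<Gamma>'\<close> (over its square). The relation for \<open>\<Psi>\<close> carries a
  conjugation and that for \<open>\<Psi>'\<close> does not, so only the first case passes to
  adjoints at the end. The factor in front of the phase annihilates the point 0, so the relations
  say nothing about the values there; the convention at 0 makes the phase vanish on the kernel, as a
  partial isometry must.\<close>

lemma cinner_add_right: "cinner x (y + z) = cinner x y + cinner x z"
  by (metis cinner_commute cinner_add_left complex_cnj_add)

lemma cinner_scaleC_right: "cinner x (scaleC c y) = cnj c * cinner x y"
  by (metis cinner_commute cinner_scaleC_left complex_cnj_mult)

lemma scaleC_zero_left [simp]: "scaleC 0 x = 0"
  using scaleC_of_real[of 0 x] by simp

lemma scaleC_one [simp]: "scaleC 1 x = x"
  using scaleC_of_real[of 1 x] by simp

lemma scaleC_zero_right [simp]: "scaleC c 0 = 0"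
  using scaleC_scaleC[of c 0 0] by simp

lemma minus_eq_scaleC: "- x = scaleC (- 1) x"
  using scaleC_of_real[of "- 1" x] by simp

lemma diff_eq_scaleC: "x - y = x + scaleC (- 1) y"
  by (simp flip: minus_eq_scaleC)

lemma scaleR_eq_scaleC: "r *\<^sub>R x = scaleC (complex_of_real r) x"
  by (simp add: scaleC_of_real)

lemma scaleC_minus_right: "scaleC c (- x) = - scaleC c x"
  by (simp add: minus_eq_scaleC scaleC_scaleC mult.commute)

lemma scaleC_diff_right: "scaleC c (x - y) = scaleC c x - scaleC c y"
  by (simp add: diff_conv_add_uminus scaleC_add_right scaleC_minus_right del: add_uminus_conv_diff)

lemma scaleC_minus_left: "scaleC (- c) x = - scaleC c x"
  by (simp add: minus_eq_scaleC scaleC_scaleC)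

lemma scaleC_diff_left: "scaleC (c - d) x = scaleC c x - scaleC d x"
  by (simp add: diff_conv_add_uminus scaleC_add_left scaleC_minus_left del: add_uminus_conv_diff)

lemma scaleC_sum_right: "scaleC c (\<Sum>i\<in>I. f i) = (\<Sum>i\<in>I. scaleC c (f i))"
  by (induction I rule: infinite_finite_induct) (auto simp: scaleC_add_right)

lemma cinner_minus_left: "cinner (- x) y = - cinner x y"
  by (simp add: minus_eq_scaleC cinner_scaleC_left)

lemma cinner_minus_right: "cinner x (- y) = - cinner x y"
  by (simp add: minus_eq_scaleC cinner_scaleC_right)

lemma cinner_diff_left: "cinner (x - y) z = cinner x z - cinner y z"
  by (simp add: diff_eq_scaleC cinner_add_left cinner_scaleC_left)

lemma cinner_diff_right: "cinner x (y - z) = cinner x y - cinner x z"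
  by (simp add: diff_eq_scaleC cinner_add_right cinner_scaleC_right)

lemma cinner_zero_left [simp]: "cinner 0 y = 0"
  using cinner_scaleC_left[of 0 0 y] by simp

lemma cinner_zero_right [simp]: "cinner x 0 = 0"
  using cinner_scaleC_right[of x 0 0] by simp

lemma cinner_sum_left: "cinner (\<Sum>i\<in>I. f i) y = (\<Sum>i\<in>I. cinner (f i) y)"
  by (induction I rule: infinite_finite_induct) (auto simp: cinner_add_left)

lemma cinner_sum_right: "cinner x (\<Sum>i\<in>I. f i) = (\<Sum>i\<in>I. cinner x (f i))"
  by (induction I rule: infinite_finite_induct) (auto simp: cinner_add_right)

lemmas cinner_simps =
  cinner_add_left cinner_add_right cinner_diff_left cinner_diff_right cinner_scaleC_left
  cinner_scaleC_right cinner_minus_left cinner_minus_right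

lemma cinner_self: "cinner x x = complex_of_real ((norm x)\<^sup>2)"
proof (rule complex_eqI)
  show "Re (cinner x x) = Re (complex_of_real ((norm x)\<^sup>2))"
    by (simp add: Re_cinner power2_norm_eq_inner)
  have "Im (cinner x x) = - Im (cinner x x)"
    by (metis cinner_commute cnj.simps(2))
  then show "Im (cinner x x) = Im (complex_of_real ((norm x)\<^sup>2))"
    by simp
qed

lemma cinner_self_eq_0 [simp]: "cinner x x = 0 \<longleftrightarrow> x = 0"
  by (simp add: cinner_self)

lemma Im_cinner: "Im (cinner x y) = inner x (scaleC \<i> y)"
  by (simp flip: Re_cinner add: cinner_scaleC_right)

lemma norm_scaleC [simp]: "norm (scaleC c x) = norm c * norm x"
proof -
  have "cinner (scaleC c x) (scaleC c x) = c * cnj c * cinner x x"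
    by (simp add: cinner_scaleC_left cinner_scaleC_right)
  then have "complex_of_real ((norm (scaleC c x))\<^sup>2) = complex_of_real ((norm c * norm x)\<^sup>2)"
    by (simp only: cinner_self power_mult_distrib of_real_mult complex_norm_square[of c])
  then have "(norm (scaleC c x))\<^sup>2 = (norm c * norm x)\<^sup>2"
    using of_real_eq_iff by blast
  then show ?thesis
    by (simp add: power2_eq_iff_nonneg)
qed

text \<open>The library's Cauchy-Schwarz inequality concerns the real inner product. Rotating
  \<open>x\<close> by the unimodular \<open>c\<close> makes \<open>cinner x y\<close> equal to its
  modulus, so passing to real parts loses nothing.\<close>

lemma norm_cinner_le: "norm (cinner x y) \<le> norm x * norm y"
proof (cases "cinner x y = 0")
  case False
  define c where "c = cnj (sgn (cinner x y))"
  have nc: "norm c = 1"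
    using False by (simp add: c_def norm_sgn)
  have "cnj (sgn z) * z = complex_of_real (norm z)" for z :: complex
    by (cases "z = 0") (simp_all add: sgn_eq mult.commute[of _ z] flip: complex_norm_square,
        simp add: power2_eq_square)
  then have "cnj (sgn (cinner x y)) * cinner x y = complex_of_real (norm (cinner x y))"
    by blast
  then have "cinner (scaleC c x) y = complex_of_real (norm (cinner x y))"
    by (simp add: cinner_scaleC_left c_def)
  then have "norm (cinner x y) = inner (scaleC c x) y"
    by (simp flip: Re_cinner)
  also have "\<dots> \<le> norm (scaleC c x) * norm y"
    by (rule norm_cauchy_schwarz)
  finally show ?thesis
    by (simp add: nc)
qed simp

lemma bounded_linear_scaleC: "bounded_linear (scaleC c)"
  by (rule bounded_linear_intro[where K = "norm c"])
    (auto simp: scaleC_add_right scaleR_eq_scaleC scaleC_scaleC mult.commute)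

lemma bounded_linear_cinner_left: "bounded_linear (\<lambda>x. cinner x y)"
  by (rule bounded_linear_intro[where K = "norm y"])
    (auto simp: cinner_simps scaleR_eq_scaleC norm_cinner_le scaleR_conv_of_real)

lemma bounded_linear_cinner_right: "bounded_linear (\<lambda>y. cinner x y)"
  by (rule bounded_linear_intro[where K = "norm x"])
    (auto simp: cinner_simps scaleR_eq_scaleC norm_cinner_le scaleR_conv_of_real mult.commute
      intro: norm_cinner_le order_trans)

lemma tendsto_scaleC [tendsto_intros]:
  "(f \<longlongrightarrow> x) F \<Longrightarrow> ((\<lambda>i. scaleC c (f i)) \<longlongrightarrow> scaleC c x) F"
  by (rule bounded_linear.tendsto[OF bounded_linear_scaleC])

text \<open>Real and imaginary part are the real inner products of \<open>x\<close> with
  \<open>y\<close> and with \<open>scaleC \<i> y\<close>, so continuity of \<open>inner\<close>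
  suffices.\<close>

lemma tendsto_cinner [tendsto_intros]:
  fixes x y :: "'b::complex_inner"
  assumes "(f \<longlongrightarrow> x) F" "(g \<longlongrightarrow> y) F"
  shows "((\<lambda>i. cinner (f i) (g i)) \<longlongrightarrow> cinner x y) F"
proof -
  have "((\<lambda>i. complex_of_real (inner (f i) (g i)) + \<i> * complex_of_real (inner (f i) (scaleC \<i> (g i))))
      \<longlongrightarrow> complex_of_real (inner x y) + \<i> * complex_of_real (inner x (scaleC \<i> y))) F"
    by (intro tendsto_intros assms)
  moreover have "complex_of_real (inner x y) + \<i> * complex_of_real (inner x (scaleC \<i> y)) = cinner x y"
    for x y :: 'b
    by (simp add: complex_eq_iff Re_cinner Im_cinner)
  ultimately show ?thesis by simp
qed

lemma norm_sq_add: "(norm (x + y))\<^sup>2 = (norm x)\<^sup>2 + (norm y)\<^sup>2 + 2 * Re (cinner x y)" for x y :: "'a::complex_inner"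
  by (simp add: power2_norm_eq_inner Re_cinner inner_add_left inner_add_right inner_commute)

lemma norm_sq_diff: "(norm (x - y))\<^sup>2 = (norm x)\<^sup>2 + (norm y)\<^sup>2 - 2 * Re (cinner x y)" for x y :: "'a::complex_inner"
  by (simp add: power2_norm_eq_inner Re_cinner inner_diff_left inner_diff_right inner_commute)

lemma norm_sq_eq_Re_cinner: "(norm x)\<^sup>2 = Re (cinner x x)"
  by (simp add: cinner_self)

text \<open>Completeness is a property of \<open>V\<close> because the class
  \<open>complex_inner\<close> does not contain it. All limits below are taken inside
  \<open>V\<close>, so the theory applies to \<open>H2\<close>, to \<open>ran_H u\<close> and to
  every other closed subspace that turns up.\<close>

locale hilbert_subspace =
  fixes V :: "'a::complex_inner set"
  assumes zero_mem [simp]: "0 \<in> V"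
    and add_mem [simp]: "x \<in> V \<Longrightarrow> y \<in> V \<Longrightarrow> x + y \<in> V"
    and scaleC_mem [simp]: "x \<in> V \<Longrightarrow> scaleC c x \<in> V"
    and complete: "complete V"
begin

lemma minus_mem [simp]: "x \<in> V \<Longrightarrow> - x \<in> V"
  by (simp add: minus_eq_scaleC)

lemma diff_mem [simp]: "x \<in> V \<Longrightarrow> y \<in> V \<Longrightarrow> x - y \<in> V"
  using add_mem[OF _ minus_mem, of x y] by simp

lemma scaleR_mem [simp]: "x \<in> V \<Longrightarrow> r *\<^sub>R x \<in> V"
  by (simp add: scaleR_eq_scaleC)

lemma sum_mem [simp]: "(\<And>i. i \<in> I \<Longrightarrow> f i \<in> V) \<Longrightarrow> (\<Sum>i\<in>I. f i) \<in> V"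
  by (induction I rule: infinite_finite_induct) auto

lemma closed: "closed V"
  by (rule complete_imp_closed[OF complete])

lemma lim_mem: "(\<And>n. X n \<in> V) \<Longrightarrow> X \<longlonglongrightarrow> x \<Longrightarrow> x \<in> V"
  using closed closed_sequentially by blast

lemma Cauchy_lim: "(\<And>n. X n \<in> V) \<Longrightarrow> Cauchy X \<Longrightarrow> \<exists>x\<in>V. X \<longlonglongrightarrow> x"
  using complete unfolding complete_def by auto

lemma orthogonal_all_0: "x \<in> V \<Longrightarrow> (\<And>z. z \<in> V \<Longrightarrow> cinner x z = 0) \<Longrightarrow> x = 0"
  using cinner_self_eq_0 by blast

lemma cinner_eqI: "x \<in> V \<Longrightarrow> y \<in> V \<Longrightarrow> (\<And>z. z \<in> V \<Longrightarrow> cinner x z = cinner y z) \<Longrightarrow> x = y"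
  using orthogonal_all_0[of "x - y"] by (simp add: cinner_diff_left)

text \<open>By the parallelogram law a minimizing sequence is Cauchy: the midpoint of two members
  lies in \<open>V\<close> and is therefore no closer to \<open>x\<close> than
  \<open>d\<close>.\<close>

lemma nearest_point: "\<exists>y\<in>V. \<forall>z\<in>V. norm (x - y) \<le> norm (x - z)"
proof -
  define d where "d = infdist x V"
  have d_le: "d \<le> norm (x - z)" if "z \<in> V" for z
    unfolding d_def using infdist_le[OF that, of x] by (simp add: dist_norm)
  have d0: "0 \<le> d"
    by (simp add: d_def infdist_nonneg)
  have "\<exists>y\<in>V. norm (x - y) < d + 1 / real (Suc n)" for n
  proof (rule ccontr)
    assume "\<not> ?thesis"
    then have "d + 1 / real (Suc n) \<le> dist x y" if "y \<in> V" for y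
      using that by (force simp: dist_norm)
    then have "d + 1 / real (Suc n) \<le> infdist x V"
      unfolding infdist_def using zero_mem by (auto intro!: cINF_greatest simp del: zero_mem)
    then show False
      by (simp add: d_def)
  qed
  then obtain Y where YV: "\<And>n. Y n \<in> V" and Y: "\<And>n. norm (x - Y n) < d + 1 / real (Suc n)"
    by metis
  have lim: "(\<lambda>n. norm (x - Y n)) \<longlonglongrightarrow> d"
  proof (rule tendsto_sandwich[of "\<lambda>_. d" _ _ "\<lambda>n. d + 1 / real (Suc n)"])
    show "(\<lambda>n. d + 1 / real (Suc n)) \<longlonglongrightarrow> d"
      using tendsto_add[OF tendsto_const LIMSEQ_inverse_real_of_nat, of d]
      by (simp add: inverse_eq_divide)
  qed (use Y d_le YV in \<open>auto intro!: always_eventually less_imp_le\<close>)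
  have "Cauchy Y"
  proof (rule metric_CauchyI)
    fix e :: real assume e: "0 < e"
    have "(\<lambda>n. (norm (x - Y n))\<^sup>2) \<longlonglongrightarrow> d\<^sup>2"
      by (intro tendsto_intros lim)
    then have "eventually (\<lambda>n. (norm (x - Y n))\<^sup>2 < d\<^sup>2 + e\<^sup>2 / 4) sequentially"
      by (rule order_tendstoD) (use e in simp)
    then obtain N where N: "\<And>n. n \<ge> N \<Longrightarrow> (norm (x - Y n))\<^sup>2 < d\<^sup>2 + e\<^sup>2 / 4"
      by (auto simp: eventually_sequentially)
    have "dist (Y m) (Y n) < e" if mn: "m \<ge> N" "n \<ge> N" for m n
    proof -
      define a b where "a = x - Y m" and "b = x - Y n"
      have "(norm (a - b))\<^sup>2 + (norm (a + b))\<^sup>2 = 2 * (norm a)\<^sup>2 + 2 * (norm b)\<^sup>2"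
        by (simp add: norm_sq_add norm_sq_diff)
      moreover have "(2 * d)\<^sup>2 \<le> (norm (a + b))\<^sup>2"
      proof -
        have "a + b = 2 *\<^sub>R (x - (1/2) *\<^sub>R (Y m + Y n))"
          by (simp add: a_def b_def algebra_simps scaleR_2)
        then have "norm (a + b) = 2 * norm (x - (1/2) *\<^sub>R (Y m + Y n))"
          by simp
        also have "\<dots> \<ge> 2 * d"
          using d_le[of "(1/2) *\<^sub>R (Y m + Y n)"] YV by simp
        finally show ?thesis
          using d0 by (intro power_mono) auto
      qed
      moreover have "(norm a)\<^sup>2 < d\<^sup>2 + e\<^sup>2 / 4" "(norm b)\<^sup>2 < d\<^sup>2 + e\<^sup>2 / 4"
        using N mn by (auto simp: a_def b_def)
      ultimately have "(norm (a - b))\<^sup>2 < e\<^sup>2"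
        by (simp add: power2_eq_square algebra_simps)
      then have "norm (a - b) < e"
        using e power_less_imp_less_base by (metis less_eq_real_def)
      moreover have "a - b = - (Y m - Y n)"
        by (simp add: a_def b_def)
      ultimately show ?thesis
        by (metis dist_norm norm_minus_cancel)
    qed
    then show "\<exists>M. \<forall>m\<ge>M. \<forall>n\<ge>M. dist (Y m) (Y n) < e" by blast
  qed
  then obtain y where y: "y \<in> V" "Y \<longlonglongrightarrow> y"
    using Cauchy_lim YV by blast
  then have "(\<lambda>n. norm (x - Y n)) \<longlonglongrightarrow> norm (x - y)"
    by (intro tendsto_intros)
  then have "norm (x - y) = d"
    using lim LIMSEQ_unique by blast
  then show ?thesis
    using y d_le by auto
qed

text \<open>The nearest point works. A first variation kills the real inner product with every
  \<open>z\<close>; using this for \<open>z\<close> and for \<open>scaleC \<i> z\<close> gives both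
  parts of the complex one.\<close>

lemma orthogonal_decomposition_ex: "\<exists>y\<in>V. \<forall>z\<in>V. cinner (x - y) z = 0"
proof -
  obtain y where y: "y \<in> V" and min: "\<And>z. z \<in> V \<Longrightarrow> norm (x - y) \<le> norm (x - z)"
    using nearest_point by blast
  have inner0: "inner (x - y) z = 0" if z: "z \<in> V" for z
  proof (cases "z = 0")
    case False
    \<comment> \<open>This \<open>t\<close> minimizes \<open>norm (x - y - t *\<^sub>R z)\<close>
      over the reals; any gain would contradict that \<open>y\<close> is nearest.\<close>
    define t where "t = inner (x - y) z / (norm z)\<^sup>2"
    have "norm (x - y) \<le> norm (x - (y + t *\<^sub>R z))"
      using y z by (intro min) auto
    then have "(norm (x - y))\<^sup>2 \<le> (norm ((x - y) - t *\<^sub>R z))\<^sup>2"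
      by (intro power_mono) (auto simp: algebra_simps)
    also have "\<dots> = (norm (x - y))\<^sup>2 + t\<^sup>2 * (norm z)\<^sup>2 - 2 * t * inner (x - y) z"
      unfolding norm_sq_diff Re_cinner by (simp add: power_mult_distrib)
    finally have "2 * t * inner (x - y) z \<le> t * (t * (norm z)\<^sup>2)"
      by (simp add: power2_eq_square)
    also have "t * (norm z)\<^sup>2 = inner (x - y) z"
      using False by (simp add: t_def)
    finally have "t * inner (x - y) z \<le> 0"
      by simp
    then have "(inner (x - y) z)\<^sup>2 \<le> 0"
      using False by (simp add: t_def power2_eq_square divide_le_0_iff mult_le_0_iff)
    then show ?thesis by simp
  qed simp
  have "cinner (x - y) z = 0" if "z \<in> V" for z
    using inner0[OF that] inner0[OF scaleC_mem[OF that], of \<i>]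
    by (simp add: complex_eq_iff Re_cinner Im_cinner)
  then show ?thesis
    using y by blast
qed

definition proj :: "'a \<Rightarrow> 'a" where
  "proj x = (SOME y. y \<in> V \<and> (\<forall>z\<in>V. cinner (x - y) z = 0))"

lemma proj_mem [simp]: "proj x \<in> V"
  and cinner_diff_proj: "z \<in> V \<Longrightarrow> cinner (x - proj x) z = 0"
proof -
  have "\<exists>y. y \<in> V \<and> (\<forall>z\<in>V. cinner (x - y) z = 0)"
    using orthogonal_decomposition_ex by blast
  from someI_ex[OF this] show "proj x \<in> V" "z \<in> V \<Longrightarrow> cinner (x - proj x) z = 0"
    by (auto simp: proj_def)
qed

lemma cinner_proj_left: "z \<in> V \<Longrightarrow> cinner (proj x) z = cinner x z"
  using cinner_diff_proj[of z x] by (simp add: cinner_diff_left)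

lemma cinner_proj_right: "z \<in> V \<Longrightarrow> cinner z (proj x) = cinner z x"
  by (metis cinner_commute cinner_proj_left)

lemma proj_eqI: "y \<in> V \<Longrightarrow> (\<And>z. z \<in> V \<Longrightarrow> cinner y z = cinner x z) \<Longrightarrow> proj x = y"
  by (rule cinner_eqI) (auto simp: cinner_proj_left)

lemma proj_ident [simp]: "x \<in> V \<Longrightarrow> proj x = x"
  by (rule proj_eqI) auto

lemma proj_add: "proj (x + y) = proj x + proj y"
  by (rule proj_eqI) (auto simp: cinner_add_left cinner_proj_left)

lemma proj_scaleC: "proj (scaleC c x) = scaleC c (proj x)"
  by (rule proj_eqI) (auto simp: cinner_scaleC_left cinner_proj_left)

lemma cinner_proj: "cinner (proj x) y = cinner x (proj y)"
  by (metis cinner_proj_left cinner_proj_right proj_mem)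

lemma proj_eq_0_iff: "proj x = 0 \<longleftrightarrow> (\<forall>z\<in>V. cinner x z = 0)"
  by (metis cinner_proj_left cinner_zero_left proj_eqI zero_mem)

lemma norm_proj_le: "norm (proj x) \<le> norm x"
proof -
  have "(norm x)\<^sup>2 = (norm (proj x + (x - proj x)))\<^sup>2" by simp
  also have "\<dots> = (norm (proj x))\<^sup>2 + (norm (x - proj x))\<^sup>2"
    unfolding norm_sq_add using cinner_diff_proj[of "proj x" x] cinner_commute[of "proj x" "x - proj x"]
    by simp
  finally have "(norm (proj x))\<^sup>2 \<le> (norm x)\<^sup>2" by simp
  then show ?thesis by (rule power2_le_imp_le) simp
qed

end

lemma hilbert_subspace_closed_subset:
  assumes "hilbert_subspace V" "W \<subseteq> V" "closed W" "0 \<in> W"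
    "\<And>x y. x \<in> W \<Longrightarrow> y \<in> W \<Longrightarrow> x + y \<in> W" "\<And>c x. x \<in> W \<Longrightarrow> scaleC c x \<in> W"
  shows "hilbert_subspace W"
proof
  show "complete W"
    using complete_Int_closed[OF hilbert_subspace.complete[OF assms(1)] assms(3)] assms(2)
    by (simp add: inf.absorb2)
qed (use assms in auto)

lemma hilbert_subspace_closure:
  assumes "hilbert_subspace V" "W \<subseteq> V" "0 \<in> W"
    "\<And>x y. x \<in> W \<Longrightarrow> y \<in> W \<Longrightarrow> x + y \<in> W" "\<And>c x. x \<in> W \<Longrightarrow> scaleC c x \<in> W"
  shows "hilbert_subspace (closure W)"
proof (rule hilbert_subspace_closed_subset[OF assms(1)])
  show "closure W \<subseteq> V"
    using assms(1,2) hilbert_subspace.closed closure_minimal by blast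
  show "0 \<in> closure W"
    using assms(3) closure_subset by blast
  show "x + y \<in> closure W" if xy: "x \<in> closure W" "y \<in> closure W" for x y
  proof -
    obtain X Y where "\<And>n. X n \<in> W" "X \<longlonglongrightarrow> x" "\<And>n. Y n \<in> W" "Y \<longlonglongrightarrow> y"
      using xy unfolding closure_sequential by blast
    then have "(\<lambda>n. X n + Y n) \<longlonglongrightarrow> x + y" "\<And>n. X n + Y n \<in> W"
      using assms(4) by (auto intro: tendsto_add)
    then show ?thesis
      unfolding closure_sequential by (intro exI[of _ "\<lambda>n. X n + Y n"]) auto
  qed
  show "scaleC c x \<in> closure W" if x: "x \<in> closure W" for c x
  proof -
    obtain X where "\<And>n. X n \<in> W" "X \<longlonglongrightarrow> x"
      using x unfolding closure_sequential by blast
    then have "(\<lambda>n. scaleC c (X n)) \<longlonglongrightarrow> scaleC c x" "\<And>n. scaleC c (X n) \<in> W"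
      using assms(5) by (auto intro: tendsto_scaleC)
    then show ?thesis
      unfolding closure_sequential by (intro exI[of _ "\<lambda>n. scaleC c (X n)"]) auto
  qed
qed simp

section \<open>Bounded operators\<close>

lemma bounded_opD:
  assumes "bounded_op V T"
  shows "x \<in> V \<Longrightarrow> T x \<in> V" "x \<in> V \<Longrightarrow> y \<in> V \<Longrightarrow> T (x + y) = T x + T y"
    "x \<in> V \<Longrightarrow> T (scaleC c x) = scaleC c (T x)"
  using assms by (auto simp: bounded_op_def)

lemma bounded_op_bound:
  assumes "bounded_op V T"
  obtains K where "K > 0" "\<And>x. x \<in> V \<Longrightarrow> norm (T x) \<le> K * norm x"
proof -
  obtain K where K: "\<And>x. x \<in> V \<Longrightarrow> norm (T x) \<le> K * norm x"
    using assms unfolding bounded_op_def by blast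
  show thesis
  proof (rule that[of "max K 1"])
    fix x assume "x \<in> V"
    then have "norm (T x) \<le> K * norm x" by (rule K)
    also have "\<dots> \<le> max K 1 * norm x" by (intro mult_right_mono) auto
    finally show "norm (T x) \<le> max K 1 * norm x" .
  qed simp
qed

lemma bounded_opI:
  assumes "\<And>x. x \<in> V \<Longrightarrow> T x \<in> V"
    "\<And>x y. x \<in> V \<Longrightarrow> y \<in> V \<Longrightarrow> T (x + y) = T x + T y"
    "\<And>c x. x \<in> V \<Longrightarrow> T (scaleC c x) = scaleC c (T x)"
    "\<And>x. x \<in> V \<Longrightarrow> norm (T x) \<le> K * norm x"
  shows "bounded_op V T"
  using assms unfolding bounded_op_def by blast

lemma bounded_op_cong:
  assumes "\<And>x. x \<in> V \<Longrightarrow> S x = T x" "hilbert_subspace V"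
  shows "bounded_op V S \<longleftrightarrow> bounded_op V T"
proof -
  interpret hilbert_subspace V by fact
  show ?thesis
    unfolding bounded_op_def using assms(1) by (simp add: image_subset_iff cong: ball_cong)
qed

lemma self_adjoint_opD:
  assumes "self_adjoint_op V T"
  shows "bounded_op V T" "x \<in> V \<Longrightarrow> y \<in> V \<Longrightarrow> cinner (T x) y = cinner x (T y)"
  using assms by (auto simp: self_adjoint_op_def)

lemma positive_opD:
  assumes "positive_op V T"
  shows "self_adjoint_op V T" "bounded_op V T" "x \<in> V \<Longrightarrow> 0 \<le> Re (cinner (T x) x)"
  using assms by (auto simp: positive_op_def self_adjoint_op_def)

section \<open>Algebra of bounded, self-adjoint and positive operators\<close>

context hilbert_subspace
begin

lemma bounded_op_diff: "bounded_op V T \<Longrightarrow> x \<in> V \<Longrightarrow> y \<in> V \<Longrightarrow> T (x - y) = T x - T y"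
  by (simp add: diff_eq_scaleC bounded_opD)

lemma bounded_op_0: "bounded_op V T \<Longrightarrow> T 0 = 0"
  using bounded_op_diff[of T 0 0] by simp

lemma bounded_op_sum:
  "bounded_op V T \<Longrightarrow> (\<And>i. i \<in> I \<Longrightarrow> f i \<in> V) \<Longrightarrow> T (\<Sum>i\<in>I. f i) = (\<Sum>i\<in>I. T (f i))"
  by (induction I rule: infinite_finite_induct) (auto simp: bounded_op_0 bounded_opD)

lemma bounded_op_tendsto:
  assumes "bounded_op V T" "\<And>n. X n \<in> V" "x \<in> V" "X \<longlonglongrightarrow> x"
  shows "(\<lambda>n. T (X n)) \<longlonglongrightarrow> T x"
proof -
  obtain K where K: "K > 0" "\<And>x. x \<in> V \<Longrightarrow> norm (T x) \<le> K * norm x"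
    using bounded_op_bound[OF assms(1)] by blast
  have "(\<lambda>n. T (X n) - T x) \<longlonglongrightarrow> 0"
  proof (rule Lim_null_comparison)
    show "eventually (\<lambda>n. norm (T (X n) - T x) \<le> K * norm (X n - x)) sequentially"
      using assms K(2) by (auto simp flip: bounded_op_diff)
    have "(\<lambda>n. K * norm (X n - x)) \<longlonglongrightarrow> K * norm (x - x)"
      by (intro tendsto_intros assms)
    then show "(\<lambda>n. K * norm (X n - x)) \<longlonglongrightarrow> 0" by simp
  qed
  then show ?thesis by (rule LIM_zero_cancel)
qed

lemma bounded_op_id: "bounded_op V (\<lambda>x. x)"
  by (rule bounded_opI[where K = 1]) auto

lemma bounded_op_zero: "bounded_op V (\<lambda>x. 0)"
  by (rule bounded_opI[where K = 1]) auto

lemma bounded_op_add: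
  assumes "bounded_op V S" "bounded_op V T"
  shows "bounded_op V (\<lambda>x. S x + T x)"
proof -
  obtain K where K: "\<And>x. x \<in> V \<Longrightarrow> norm (S x) \<le> K * norm x"
    using bounded_op_bound[OF assms(1)] by blast
  obtain L where L: "\<And>x. x \<in> V \<Longrightarrow> norm (T x) \<le> L * norm x"
    using bounded_op_bound[OF assms(2)] by blast
  show ?thesis
    by (rule bounded_opI[where K = "K + L"])
      (use assms K L in \<open>auto simp: bounded_opD scaleC_add_right distrib_right
        intro!: norm_triangle_le add_mono\<close>)
qed

lemma bounded_op_scaleC:
  assumes "bounded_op V T"
  shows "bounded_op V (\<lambda>x. scaleC c (T x))"
proof -
  obtain K where K: "\<And>x. x \<in> V \<Longrightarrow> norm (T x) \<le> K * norm x"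
    using bounded_op_bound[OF assms(1)] by blast
  show ?thesis
    by (rule bounded_opI[where K = "norm c * K"])
      (use assms K in \<open>auto simp: bounded_opD scaleC_add_right scaleC_scaleC mult.commute[of c] mult.assoc
        intro!: mult_left_mono\<close>)
qed

lemma bounded_op_diff_op:
  assumes "bounded_op V S" "bounded_op V T"
  shows "bounded_op V (\<lambda>x. S x - T x)"
  using bounded_op_add[OF assms(1) bounded_op_scaleC[OF assms(2), of "-1"]]
  by (simp add: diff_eq_scaleC)

lemma bounded_op_sum_op:
  "(\<And>i. i \<in> I \<Longrightarrow> bounded_op V (T i)) \<Longrightarrow> bounded_op V (\<lambda>x. \<Sum>i\<in>I. T i x)"
  by (induction I rule: infinite_finite_induct) (auto simp: bounded_op_zero intro: bounded_op_add)

lemma bounded_op_compose: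
  assumes "bounded_op V S" "bounded_op V T"
  shows "bounded_op V (\<lambda>x. S (T x))"
proof -
  obtain K where K: "K > 0" "\<And>x. x \<in> V \<Longrightarrow> norm (S x) \<le> K * norm x"
    using bounded_op_bound[OF assms(1)] by blast
  obtain L where L: "\<And>x. x \<in> V \<Longrightarrow> norm (T x) \<le> L * norm x"
    using bounded_op_bound[OF assms(2)] by blast
  have "norm (S (T x)) \<le> K * L * norm x" if "x \<in> V" for x
  proof -
    have "norm (S (T x)) \<le> K * norm (T x)"
      using K that assms by (simp add: bounded_opD)
    also have "\<dots> \<le> K * (L * norm x)"
      using K L that by (intro mult_left_mono) auto
    finally show ?thesis by (simp add: mult.assoc)
  qed
  then show ?thesis
    by (intro bounded_opI[where K = "K * L"]) (use assms in \<open>auto simp: bounded_opD\<close>)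
qed

lemma bounded_op_funpow: "bounded_op V T \<Longrightarrow> bounded_op V (T ^^ n)"
  by (induction n) (auto simp: bounded_op_id id_def comp_def intro: bounded_op_compose)

lemma self_adjoint_op_id: "self_adjoint_op V (\<lambda>x. x)"
  by (simp add: self_adjoint_op_def bounded_op_id)

lemma self_adjoint_op_add:
  "self_adjoint_op V S \<Longrightarrow> self_adjoint_op V T \<Longrightarrow> self_adjoint_op V (\<lambda>x. S x + T x)"
  by (simp add: self_adjoint_op_def bounded_op_add cinner_simps)

lemma self_adjoint_op_diff:
  "self_adjoint_op V S \<Longrightarrow> self_adjoint_op V T \<Longrightarrow> self_adjoint_op V (\<lambda>x. S x - T x)"
  by (simp add: self_adjoint_op_def bounded_op_diff_op cinner_simps)

lemma self_adjoint_op_scaleR: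
  "self_adjoint_op V T \<Longrightarrow> self_adjoint_op V (\<lambda>x. r *\<^sub>R T x)"
  by (simp add: self_adjoint_op_def bounded_op_scaleC cinner_simps scaleR_eq_scaleC)

lemma self_adjoint_op_compose:
  assumes "self_adjoint_op V S" "self_adjoint_op V T" "\<And>x. x \<in> V \<Longrightarrow> S (T x) = T (S x)"
  shows "self_adjoint_op V (\<lambda>x. S (T x))"
  using assms by (simp add: self_adjoint_op_def bounded_op_compose bounded_opD)

lemma self_adjoint_op_funpow: "self_adjoint_op V T \<Longrightarrow> self_adjoint_op V (T ^^ n)"
proof (induction n)
  case 0
  then show ?case by (simp add: id_def self_adjoint_op_id)
next
  case (Suc n)
  then show ?case
    using self_adjoint_op_compose[of T "T ^^ n"] by (simp add: comp_def funpow_swap1)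
qed

lemma self_adjoint_quadratic_real:
  assumes "self_adjoint_op V T" "x \<in> V"
  shows "cinner (T x) x = complex_of_real (Re (cinner (T x) x))"
proof -
  have "cnj (cinner (T x) x) = cinner (T x) x"
    using assms by (metis cinner_commute self_adjoint_opD(2))
  then have "cinner (T x) x \<in> \<real>"
    by (simp add: Reals_cnj_iff)
  then show ?thesis
    by (simp add: of_real_Re)
qed

lemma polarization:
  assumes "bounded_op V T" "x \<in> V" "y \<in> V"
  shows "4 * cinner (T x) y =
    cinner (T (x + y)) (x + y) - cinner (T (x - y)) (x - y)
    + \<i> * cinner (T (x + scaleC \<i> y)) (x + scaleC \<i> y)
    - \<i> * cinner (T (x - scaleC \<i> y)) (x - scaleC \<i> y)"
  using assms
  by (simp add: bounded_opD bounded_op_diff cinner_simps) (simp add: algebra_simps)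

text \<open>Polarization over the complex field. Spectral projections and the functional calculus
  are specified by quadratic forms alone, and their uniqueness rests on this.\<close>

lemma quadratic_form_eqI:
  assumes S: "bounded_op V S" and T: "bounded_op V T"
    and eq: "\<And>x. x \<in> V \<Longrightarrow> cinner (S x) x = cinner (T x) x"
    and x: "x \<in> V"
  shows "S x = T x"
proof (rule cinner_eqI)
  show "S x \<in> V" "T x \<in> V" using S T x by (auto simp: bounded_opD)
  fix z assume z: "z \<in> V"
  have "4 * cinner (S x) z = 4 * cinner (T x) z"
    unfolding polarization[OF S x z] polarization[OF T x z] using x z by (simp add: eq)
  then show "cinner (S x) z = cinner (T x) z" by simp
qed

text \<open>Positivity tested on \<open>x - (1/K) *\<^sub>R A x\<close>; the step \<open>1/K\<close>
  is the one that balances the linear term against the bound \<open>K\<close> on the quadratic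
  term.\<close>

lemma positive_norm_sq_le:
  assumes A: "positive_op V A" and K: "K > 0" "\<And>x. x \<in> V \<Longrightarrow> norm (A x) \<le> K * norm x"
    and x: "x \<in> V"
  shows "(norm (A x))\<^sup>2 \<le> K * Re (cinner (A x) x)"
proof -
  note sa = positive_opD(1)[OF A] and b = positive_opD(2)[OF A]
  define y where "y = A x"
  have y: "y \<in> V" using x b by (simp add: y_def bounded_opD)
  have "0 \<le> Re (cinner (A (x - (1/K) *\<^sub>R y)) (x - (1/K) *\<^sub>R y))"
    using x y by (intro positive_opD[OF A]) auto
  also have "\<dots> = Re (cinner (A x) x) - 2 / K * (norm y)\<^sup>2 + (1/K)\<^sup>2 * Re (cinner (A y) y)"
  proof -
    have *: "cinner (A y) x = cinner y y" "cinner (A x) y = cinner y y"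
      using self_adjoint_opD(2)[OF sa y x] by (auto simp: y_def)
    show ?thesis
      using x y b
      by (simp add: bounded_op_diff scaleR_eq_scaleC bounded_opD cinner_simps * cinner_self
          power2_eq_square algebra_simps)
  qed
  also have "\<dots> \<le> Re (cinner (A x) x) - 2 / K * (norm y)\<^sup>2 + (1/K)\<^sup>2 * (K * (norm y)\<^sup>2)"
  proof -
    have "Re (cinner (A y) y) \<le> norm (A y) * norm y"
      using norm_cinner_le[of "A y" y] complex_Re_le_cmod order_trans by blast
    also have "\<dots> \<le> K * norm y * norm y"
      using K(2)[OF y] by (intro mult_right_mono) auto
    finally show ?thesis
      by (intro add_mono mult_left_mono) (auto simp: power2_eq_square mult.assoc)
  qed
  also have "\<dots> = Re (cinner (A x) x) - (norm y)\<^sup>2 / K"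
    using K by (simp add: power2_eq_square field_simps)
  finally show ?thesis
    using K by (simp add: y_def field_simps)
qed

lemma positive_quadratic_0:
  assumes A: "positive_op V A" and x: "x \<in> V" and 0: "Re (cinner (A x) x) = 0"
  shows "A x = 0"
proof -
  obtain K where K: "K > 0" "\<And>x. x \<in> V \<Longrightarrow> norm (A x) \<le> K * norm x"
    using bounded_op_bound[OF positive_opD(2)[OF A]] by blast
  show ?thesis
    using positive_norm_sq_le[OF A K x] 0 by simp
qed

end

section \<open>Square roots of positive operators\<close>

text \<open>For \<open>T\<close> of norm at most 1, \<open>I - sqrt (I - T)\<close> is the least fixed point of
  \<open>Y = (T + Y\<^sup>2) / 2\<close>; the scalar iteration with \<open>T = 1\<close> dominates the operator iteration.\<close>

fun sqrt_iter :: "('a::real_vector \<Rightarrow> 'a) \<Rightarrow> nat \<Rightarrow> 'a \<Rightarrow> 'a" where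
  "sqrt_iter T 0 x = 0"
| "sqrt_iter T (Suc n) x = (1/2) *\<^sub>R (T x + sqrt_iter T n (sqrt_iter T n x))"

fun sqrt_bound :: "nat \<Rightarrow> real" where
  "sqrt_bound 0 = 0"
| "sqrt_bound (Suc n) = (1 + (sqrt_bound n)\<^sup>2) / 2"

lemma sqrt_bound_nonneg: "0 \<le> sqrt_bound n"
  by (induction n) auto

lemma sqrt_bound_le_1: "sqrt_bound n \<le> 1"
proof (induction n)
  case (Suc n)
  have "(sqrt_bound n)\<^sup>2 \<le> 1"
    using Suc sqrt_bound_nonneg[of n] by (simp add: power_le_one)
  then show ?case by simp
qed simp

lemma incseq_sqrt_bound: "incseq sqrt_bound"
proof (rule incseq_SucI)
  fix n show "sqrt_bound n \<le> sqrt_bound (Suc n)"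
    using sum_squares_bound[of 1 "sqrt_bound n"] by simp
qed

lemma convergent_sqrt_bound: "convergent sqrt_bound"
  using incseq_convergent[OF incseq_sqrt_bound] sqrt_bound_le_1 by (metis convergentI)

context hilbert_subspace
begin

lemma sqrt_iter_self_adjoint:
  assumes "self_adjoint_op V T"
  shows "self_adjoint_op V (sqrt_iter T n)"
proof (induction n)
  case 0
  show ?case by (simp add: self_adjoint_op_def bounded_op_zero)
next
  case (Suc n)
  show ?case
    unfolding sqrt_iter.simps
    by (rule self_adjoint_op_scaleR[OF self_adjoint_op_add[OF assms
          self_adjoint_op_compose[OF Suc Suc refl]]])
qed

lemma sqrt_iter_commute:
  assumes T: "self_adjoint_op V T" and S: "bounded_op V S" and ST: "\<And>x. x \<in> V \<Longrightarrow> S (T x) = T (S x)"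
    and x: "x \<in> V"
  shows "S (sqrt_iter T n x) = sqrt_iter T n (S x)"
  using x
proof (induction n arbitrary: x)
  case 0
  show ?case using S by (simp add: bounded_op_0)
next
  case (Suc n)
  note b = self_adjoint_opD(1)[OF T] self_adjoint_opD(1)[OF sqrt_iter_self_adjoint[OF T]]
  show ?case
    using Suc S b by (simp add: scaleR_eq_scaleC bounded_opD ST)
qed

lemma sqrt_iter_norm:
  assumes T: "self_adjoint_op V T" "\<And>x. x \<in> V \<Longrightarrow> norm (T x) \<le> norm x"
    and x: "x \<in> V"
  shows "norm (sqrt_iter T n x) \<le> sqrt_bound n * norm x"
  using x
proof (induction n arbitrary: x)
  case (Suc n)
  note b = self_adjoint_opD(1)[OF sqrt_iter_self_adjoint[OF T(1)]]
  have "norm (sqrt_iter T n (sqrt_iter T n x)) \<le> sqrt_bound n * norm (sqrt_iter T n x)"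
    using Suc b by (simp add: bounded_opD)
  also have "\<dots> \<le> sqrt_bound n * (sqrt_bound n * norm x)"
    using Suc sqrt_bound_nonneg by (intro mult_left_mono) auto
  finally have "norm (T x + sqrt_iter T n (sqrt_iter T n x)) \<le> norm x + sqrt_bound n * (sqrt_bound n * norm x)"
    using T(2)[OF Suc.prems] by (intro norm_triangle_le add_mono)
  then have "norm (T x + sqrt_iter T n (sqrt_iter T n x)) / 2 \<le> (1 + (sqrt_bound n)\<^sup>2) / 2 * norm x"
    by (simp add: power2_eq_square distrib_right mult.assoc)
  then show ?case
    by (simp del: scaleR_add_right)
qed simp

text \<open>The iterates commute, so a difference of squares factors into sum times difference,
  exactly as in the scalar recursion. Increments are thereby dominated by those of
  \<open>sqrt_bound\<close>, which telescope.\<close>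

lemma sqrt_iter_step:
  assumes T: "self_adjoint_op V T" "\<And>x. x \<in> V \<Longrightarrow> norm (T x) \<le> norm x"
    and x: "x \<in> V"
  shows "norm (sqrt_iter T (Suc n) x - sqrt_iter T n x) \<le> (sqrt_bound (Suc n) - sqrt_bound n) * norm x"
  using x
proof (induction n arbitrary: x)
  case 0
  then show ?case using T(2) by simp
next
  case (Suc n)
  let ?Y = "sqrt_iter T"
  note b = self_adjoint_opD(1)[OF sqrt_iter_self_adjoint[OF T(1)]]
  have TY: "?Y m (T y) = T (?Y m y)" if "y \<in> V" for m y
    using sqrt_iter_commute[OF T(1) self_adjoint_opD(1)[OF T(1)]] that by simp
  have YY: "?Y m (?Y k y) = ?Y k (?Y m y)" if "y \<in> V" for m k y
    by (rule sqrt_iter_commute[OF T(1) b _ that]) (rule TY)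
  have Vm: "?Y m y \<in> V" if "y \<in> V" for m y
    using that b by (simp add: bounded_opD)
  define w where "w = ?Y (Suc n) x - ?Y n x"
  have w: "w \<in> V" using Suc.prems Vm by (simp add: w_def del: sqrt_iter.simps)
  have "?Y (Suc (Suc n)) x - ?Y (Suc n) x =
      (1/2) *\<^sub>R (?Y (Suc n) (?Y (Suc n) x) - ?Y n (?Y n x))"
  proof -
    have "?Y (Suc (Suc n)) x - ?Y (Suc n) x =
        (1/2) *\<^sub>R (T x + ?Y (Suc n) (?Y (Suc n) x)) - (1/2) *\<^sub>R (T x + ?Y n (?Y n x))"
      by (simp only: sqrt_iter.simps(2))
    then show ?thesis
      by (simp only: scaleR_diff_right[symmetric] add_diff_cancel_left)
  qed
  also have "?Y (Suc n) (?Y (Suc n) x) - ?Y n (?Y n x) = ?Y (Suc n) w + ?Y n w"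
    using Suc.prems Vm YY[of x n "Suc n"]
    by (simp add: w_def bounded_op_diff[OF b] del: sqrt_iter.simps)
  finally have "norm (?Y (Suc (Suc n)) x - ?Y (Suc n) x) = norm (?Y (Suc n) w + ?Y n w) / 2"
    by simp
  also have "\<dots> \<le> (sqrt_bound (Suc n) * norm w + sqrt_bound n * norm w) / 2"
    by (intro divide_right_mono norm_triangle_le add_mono sqrt_iter_norm[OF T w]) simp_all
  also have "\<dots> = (sqrt_bound (Suc n) + sqrt_bound n) / 2 * norm w"
    by (simp add: field_simps del: sqrt_bound.simps)
  also have "\<dots> \<le> (sqrt_bound (Suc n) + sqrt_bound n) / 2 * ((sqrt_bound (Suc n) - sqrt_bound n) * norm x)"
    using Suc sqrt_bound_nonneg[of n] sqrt_bound_nonneg[of "Suc n"]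
    by (intro mult_left_mono) (auto simp: w_def simp del: sqrt_bound.simps sqrt_iter.simps)
  also have "\<dots> = ((1 + (sqrt_bound (Suc n))\<^sup>2) / 2 - (1 + (sqrt_bound n)\<^sup>2) / 2) * norm x"
    by (simp add: power2_eq_square field_simps del: sqrt_bound.simps)
  also have "\<dots> = (sqrt_bound (Suc (Suc n)) - sqrt_bound (Suc n)) * norm x"
    by (simp only: sqrt_bound.simps)
  finally show ?case .
qed

lemma sqrt_iter_diff:
  assumes T: "self_adjoint_op V T" "\<And>x. x \<in> V \<Longrightarrow> norm (T x) \<le> norm x"
    and x: "x \<in> V"
  shows "norm (sqrt_iter T (n + k) x - sqrt_iter T n x) \<le> (sqrt_bound (n + k) - sqrt_bound n) * norm x"
proof (induction k)
  case (Suc k)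
  have "sqrt_iter T (n + Suc k) x - sqrt_iter T n x =
      (sqrt_iter T (Suc (n + k)) x - sqrt_iter T (n + k) x) + (sqrt_iter T (n + k) x - sqrt_iter T n x)"
    by (simp del: sqrt_iter.simps)
  then have "norm (sqrt_iter T (n + Suc k) x - sqrt_iter T n x) \<le>
      (sqrt_bound (Suc (n + k)) - sqrt_bound (n + k)) * norm x + (sqrt_bound (n + k) - sqrt_bound n) * norm x"
    using norm_triangle_mono[OF sqrt_iter_step[OF T x] Suc] by (simp only:)
  then show ?case
    by (simp add: algebra_simps del: sqrt_bound.simps sqrt_iter.simps)
qed simp

lemma sqrt_iter_convergent:
  assumes T: "self_adjoint_op V T" "\<And>x. x \<in> V \<Longrightarrow> norm (T x) \<le> norm x"
    and x: "x \<in> V"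
  shows "\<exists>y\<in>V. (\<lambda>n. sqrt_iter T n x) \<longlonglongrightarrow> y"
proof (rule Cauchy_lim)
  show "sqrt_iter T n x \<in> V" for n
    using x self_adjoint_opD(1)[OF sqrt_iter_self_adjoint[OF T(1)]] by (simp add: bounded_opD)
  have "Cauchy (\<lambda>n. sqrt_bound n * norm x)"
    by (intro convergent_Cauchy convergent_mult convergent_sqrt_bound convergent_const)
  show "Cauchy (\<lambda>n. sqrt_iter T n x)"
  proof (rule metric_CauchyI)
    fix e :: real assume "0 < e"
    then obtain M where M: "\<And>m n. m \<ge> M \<Longrightarrow> n \<ge> M \<Longrightarrow> norm (sqrt_bound m * norm x - sqrt_bound n * norm x) < e"
      using \<open>Cauchy (\<lambda>n. sqrt_bound n * norm x)\<close> unfolding Cauchy_iff by blast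
    have *: "dist (sqrt_iter T m x) (sqrt_iter T n x) < e" if "M \<le> n" "n \<le> m" for m n
    proof -
      have "norm (sqrt_iter T m x - sqrt_iter T n x) \<le> sqrt_bound m * norm x - sqrt_bound n * norm x"
        using sqrt_iter_diff[OF T x, of n "m - n"] that by (simp add: left_diff_distrib)
      also have "\<dots> < e"
        using M[of m n] that by simp
      finally show ?thesis by (simp add: dist_norm)
    qed
    show "\<exists>M. \<forall>m\<ge>M. \<forall>n\<ge>M. dist (sqrt_iter T m x) (sqrt_iter T n x) < e"
    proof (intro exI allI impI)
      fix m n assume "M \<le> m" "M \<le> n"
      then show "dist (sqrt_iter T m x) (sqrt_iter T n x) < e"
        using *[of n m] *[of m n] by (cases "n \<le> m") (auto simp: dist_commute)
    qed
  qed
qed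

text \<open>\<open>Y\<close> is the strong limit of the iterates. The last clause holds for each
  iterate and survives the limit; uniqueness of the root and the commutation of spectral projections
  both depend on it.\<close>

lemma sqrt_fixed_point:
  assumes T: "self_adjoint_op V T" "\<And>x. x \<in> V \<Longrightarrow> norm (T x) \<le> norm x"
  obtains Y where "self_adjoint_op V Y" "\<And>x. x \<in> V \<Longrightarrow> norm (Y x) \<le> norm x"
    "\<And>x. x \<in> V \<Longrightarrow> 2 *\<^sub>R Y x = T x + Y (Y x)"
    "\<And>S x. bounded_op V S \<Longrightarrow> (\<And>x. x \<in> V \<Longrightarrow> S (T x) = T (S x)) \<Longrightarrow> x \<in> V \<Longrightarrow> S (Y x) = Y (S x)"
proof -
  let ?Y = "sqrt_iter T"
  note sa = sqrt_iter_self_adjoint[OF T(1)]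
  note b = self_adjoint_opD(1)[OF sa]
  obtain Y where YV: "\<And>x. x \<in> V \<Longrightarrow> Y x \<in> V" and Y: "\<And>x. x \<in> V \<Longrightarrow> (\<lambda>n. ?Y n x) \<longlonglongrightarrow> Y x"
    using sqrt_iter_convergent[OF T] by metis
  have n1: "norm (?Y n x) \<le> norm x" if "x \<in> V" for n x
  proof -
    have "norm (?Y n x) \<le> sqrt_bound n * norm x" by (rule sqrt_iter_norm[OF T that])
    also have "\<dots> \<le> 1 * norm x" by (intro mult_right_mono sqrt_bound_le_1) auto
    finally show ?thesis by simp
  qed
  have norm: "norm (Y x) \<le> norm x" if "x \<in> V" for x
    by (rule LIMSEQ_le_const2[OF tendsto_norm[OF Y[OF that]]]) (use n1[OF that] in auto)
  have bY: "bounded_op V Y"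
  proof (rule bounded_opI[where K = 1])
    fix x y c assume x: "x \<in> V"
    show "Y x \<in> V" "norm (Y x) \<le> 1 * norm x" using YV norm x by auto
    have "(\<lambda>n. ?Y n (scaleC c x)) \<longlonglongrightarrow> scaleC c (Y x)"
      unfolding bounded_opD(3)[OF b x] by (intro tendsto_intros Y x)
    then show "Y (scaleC c x) = scaleC c (Y x)"
      using Y[OF scaleC_mem[OF x]] LIMSEQ_unique by blast
    assume y: "y \<in> V"
    have "(\<lambda>n. ?Y n (x + y)) \<longlonglongrightarrow> Y x + Y y"
      unfolding bounded_opD(2)[OF b x y] by (intro tendsto_intros Y x y)
    then show "Y (x + y) = Y x + Y y"
      using Y[OF add_mem[OF x y]] LIMSEQ_unique by blast
  qed
  have saY: "self_adjoint_op V Y"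
    unfolding self_adjoint_op_def
  proof (intro conjI ballI bY)
    fix x y assume xy: "x \<in> V" "y \<in> V"
    have "(\<lambda>n. cinner (?Y n x) y) \<longlonglongrightarrow> cinner (Y x) y"
      by (intro tendsto_intros Y xy)
    moreover have "(\<lambda>n. cinner (?Y n x) y) \<longlonglongrightarrow> cinner x (Y y)"
      unfolding self_adjoint_opD(2)[OF sa xy] by (intro tendsto_intros Y xy)
    ultimately show "cinner (Y x) y = cinner x (Y y)" by (rule LIMSEQ_unique)
  qed
  have comm: "S (Y x) = Y (S x)"
    if S: "bounded_op V S" and ST: "\<And>x. x \<in> V \<Longrightarrow> S (T x) = T (S x)" and x: "x \<in> V" for S x
  proof -
    have "(\<lambda>n. S (?Y n x)) \<longlonglongrightarrow> S (Y x)"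
      using x b YV by (intro bounded_op_tendsto[OF S] Y) (auto simp: bounded_opD)
    moreover have "(\<lambda>n. S (?Y n x)) \<longlonglongrightarrow> Y (S x)"
    proof -
      have "S (?Y n x) = ?Y n (S x)" for n
        by (rule sqrt_iter_commute[OF T(1) S ST x])
      then show ?thesis
        using Y[of "S x"] x S by (simp add: bounded_opD)
    qed
    ultimately show ?thesis by (rule LIMSEQ_unique)
  qed
  have fp: "2 *\<^sub>R Y x = T x + Y (Y x)" if x: "x \<in> V" for x
  proof -
    \<comment> \<open>Strong limits may be multiplied here because all iterates are
      contractions.\<close>
    have "(\<lambda>n. ?Y n (?Y n x - Y x)) \<longlonglongrightarrow> 0"
    proof (rule Lim_null_comparison)
      show "eventually (\<lambda>n. norm (?Y n (?Y n x - Y x)) \<le> norm (?Y n x - Y x)) sequentially"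
        using x b YV by (auto intro!: always_eventually n1 simp: bounded_opD)
      show "(\<lambda>n. norm (?Y n x - Y x)) \<longlonglongrightarrow> 0"
        using Y[OF x] by (simp add: LIM_zero tendsto_norm_zero)
    qed
    from tendsto_add[OF this Y[OF YV[OF x]]]
    have YY: "(\<lambda>n. ?Y n (?Y n x)) \<longlonglongrightarrow> Y (Y x)"
      using x b YV by (simp add: bounded_op_diff bounded_opD)
    have "(\<lambda>n. 2 *\<^sub>R ?Y (Suc n) x) \<longlonglongrightarrow> 2 *\<^sub>R Y x"
      by (intro tendsto_intros LIMSEQ_Suc Y x)
    moreover have "(\<lambda>n. 2 *\<^sub>R ?Y (Suc n) x) \<longlonglongrightarrow> T x + Y (Y x)"
      using tendsto_add[OF tendsto_const YY] by simp
    ultimately show ?thesis by (rule LIMSEQ_unique)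
  qed
  show thesis
    by (rule that[OF saY norm fp comm])
qed

lemma positive_sqrt_ex:
  assumes A: "positive_op V A"
  obtains B where "positive_op V B" "\<And>x. x \<in> V \<Longrightarrow> B (B x) = A x"
    "\<And>S x. bounded_op V S \<Longrightarrow> (\<And>x. x \<in> V \<Longrightarrow> S (A x) = A (S x)) \<Longrightarrow> x \<in> V \<Longrightarrow> S (B x) = B (S x)"
proof -
  note sA = positive_opD(1)[OF A] and bA = positive_opD(2)[OF A]
  obtain K where K: "K > 0" "\<And>x. x \<in> V \<Longrightarrow> norm (A x) \<le> K * norm x"
    using bounded_op_bound[OF bA] by blast
  \<comment> \<open>Scaling by \<open>K\<close> makes \<open>T\<close> a contraction. If
    \<open>Y\<close> solves the fixed point equation for \<open>T\<close>, the square of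
    \<open>1 - Y\<close> is \<open>1 - T\<close>, that is, \<open>A\<close> divided by
    \<open>K\<close>; so the root of \<open>A\<close> is \<open>sqrt K\<close> times
    \<open>1 - Y\<close>.\<close>
  define T where "T x = x - (1/K) *\<^sub>R A x" for x
  have sT: "self_adjoint_op V T"
    unfolding T_def by (intro self_adjoint_op_diff self_adjoint_op_id self_adjoint_op_scaleR sA)
  have nT: "norm (T x) \<le> norm x" if x: "x \<in> V" for x
  proof -
    have "(norm (T x))\<^sup>2 = (norm x)\<^sup>2 + (norm (A x))\<^sup>2 / K\<^sup>2 - 2 / K * Re (cinner (A x) x)"
      using cinner_commute[of x "A x"]
      by (simp add: T_def norm_sq_diff scaleR_eq_scaleC cinner_simps power_mult_distrib power_divide norm_divide)
    also have "\<dots> \<le> (norm x)\<^sup>2 + (K * Re (cinner (A x) x)) / K\<^sup>2 - 2 / K * Re (cinner (A x) x)"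
      using positive_norm_sq_le[OF A K x] K by (intro diff_right_mono add_left_mono divide_right_mono) auto
    also have "\<dots> = (norm x)\<^sup>2 - Re (cinner (A x) x) / K"
      using K by (simp add: power2_eq_square field_simps)
    also have "\<dots> \<le> (norm x)\<^sup>2"
      using positive_opD(3)[OF A x] K by simp
    finally show ?thesis by (rule power2_le_imp_le) simp
  qed
  obtain Y where Y: "self_adjoint_op V Y" "\<And>x. x \<in> V \<Longrightarrow> norm (Y x) \<le> norm x"
    "\<And>x. x \<in> V \<Longrightarrow> 2 *\<^sub>R Y x = T x + Y (Y x)"
    "\<And>S x. bounded_op V S \<Longrightarrow> (\<And>x. x \<in> V \<Longrightarrow> S (T x) = T (S x)) \<Longrightarrow> x \<in> V \<Longrightarrow> S (Y x) = Y (S x)"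
    using sqrt_fixed_point[OF sT nT] by blast
  note bY = self_adjoint_opD(1)[OF Y(1)]
  define B where "B x = sqrt K *\<^sub>R (x - Y x)" for x
  have sB: "self_adjoint_op V B"
    unfolding B_def by (intro self_adjoint_op_diff self_adjoint_op_id self_adjoint_op_scaleR Y)
  have "0 \<le> Re (cinner (B x) x)" if x: "x \<in> V" for x
  proof -
    have "Re (cinner (Y x) x) \<le> norm (Y x) * norm x"
      using norm_cinner_le[of "Y x" x] complex_Re_le_cmod order_trans by blast
    also have "\<dots> \<le> norm x * norm x"
      using Y(2)[OF x] by (intro mult_right_mono) auto
    finally show ?thesis
      using K by (simp add: B_def scaleR_eq_scaleC cinner_simps cinner_self power2_eq_square)
  qed
  then have pB: "positive_op V B"
    using sB by (simp add: positive_op_def)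
  have BB: "B (B x) = A x" if x: "x \<in> V" for x
  proof -
    have "B (B x) = K *\<^sub>R (x - Y x - (Y x - Y (Y x)))"
      using x K bY by (simp add: B_def scaleR_eq_scaleC bounded_opD bounded_op_diff scaleC_diff_right
          scaleC_scaleC flip: of_real_mult)
    also have "x - Y x - (Y x - Y (Y x)) = x - T x"
      using Y(3)[OF x] by (simp add: scaleR_2 algebra_simps)
    finally show ?thesis
      using K by (simp add: T_def)
  qed
  have "S (B x) = B (S x)"
    if S: "bounded_op V S" and SA: "\<And>x. x \<in> V \<Longrightarrow> S (A x) = A (S x)" and x: "x \<in> V" for S x
  proof -
    have "S (T x) = T (S x)" if "x \<in> V" for x
      using that S bA by (simp add: T_def bounded_op_diff bounded_opD scaleR_eq_scaleC SA)
    then have "S (Y x) = Y (S x)"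
      using Y(4) S x by blast
    then show ?thesis
      using x S bY by (simp add: B_def scaleR_eq_scaleC bounded_opD bounded_op_diff)
  qed
  then show thesis
    using that pB BB by blast
qed

text \<open>Any root \<open>E\<close> commutes with \<open>A = E E\<close>, hence with the
  constructed root \<open>D\<close>, which commutes with the whole commutant of \<open>A\<close>.
  For \<open>y = E x - D x\<close> this gives \<open>E y + D y = 0\<close>, and by positivity both
  summands vanish; then \<open>y\<close> is orthogonal to itself.\<close>

lemma positive_sqrt_unique:
  assumes B: "positive_op V B" and C: "positive_op V C"
    and BC: "\<And>x. x \<in> V \<Longrightarrow> B (B x) = C (C x)" and x: "x \<in> V"
  shows "B x = C x"
proof -
  have bB: "bounded_op V B" and bC: "bounded_op V C"
    using positive_opD(2)[OF B] positive_opD(2)[OF C] by auto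
  define A where "A x = B (B x)" for x
  have "self_adjoint_op V A"
    unfolding A_def by (rule self_adjoint_op_compose[OF positive_opD(1)[OF B] positive_opD(1)[OF B] refl])
  moreover have "0 \<le> Re (cinner (A x) x)" if "x \<in> V" for x
    using that self_adjoint_opD(2)[OF positive_opD(1)[OF B], of "B x" x] bB
    by (simp add: A_def bounded_opD cinner_self)
  ultimately have A: "positive_op V A"
    by (simp add: positive_op_def)
  obtain D where D: "positive_op V D" "\<And>x. x \<in> V \<Longrightarrow> D (D x) = A x"
    "\<And>S x. bounded_op V S \<Longrightarrow> (\<And>x. x \<in> V \<Longrightarrow> S (A x) = A (S x)) \<Longrightarrow> x \<in> V \<Longrightarrow> S (D x) = D (S x)"
    using positive_sqrt_ex[OF A] by blast
  have bD: "bounded_op V D" by (rule positive_opD(2)[OF D(1)])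
  have "E x = D x"
    if E: "positive_op V E" and EE: "\<And>x. x \<in> V \<Longrightarrow> E (E x) = A x" and x: "x \<in> V" for E x
  proof -
    have bE: "bounded_op V E" and sE: "self_adjoint_op V E"
      using positive_opD(1,2)[OF E] by auto
    have "E (A x) = A (E x)" if "x \<in> V" for x
      using that bE by (simp add: bounded_opD flip: EE)
    then have ED: "E (D x) = D (E x)" if "x \<in> V" for x
      using D(3)[OF bE _ that] by simp
    define y where "y = E x - D x"
    have y: "y \<in> V" using x bE bD by (simp add: y_def bounded_opD)
    have "E y + D y = 0"
      using x bE bD by (simp add: y_def bounded_op_diff bounded_opD EE D(2) ED)
    then have "Re (cinner (E y) y) + Re (cinner (D y) y) = 0"
      by (metis cinner_add_left cinner_zero_left plus_complex.simps(1) zero_complex.simps(1))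
    then have "Re (cinner (E y) y) = 0" "Re (cinner (D y) y) = 0"
      using positive_opD(3)[OF E y] positive_opD(3)[OF D(1) y] by linarith+
    then have "E y = 0" "D y = 0"
      using positive_quadratic_0 E D(1) y by blast+
    then have "cinner y y = 0"
      using self_adjoint_opD(2)[OF sE x y] self_adjoint_opD(2)[OF positive_opD(1)[OF D(1)] x y]
      by (subst y_def) (simp add: cinner_diff_left)
    then show ?thesis by (simp add: y_def)
  qed
  from this[OF B _ x] this[OF C _ x] show ?thesis
    using BC by (simp add: A_def)
qed

lemma sqrt_op_spec:
  assumes "positive_op V A"
  shows "positive_op V (sqrt_op V A)" "x \<in> V \<Longrightarrow> sqrt_op V A (sqrt_op V A x) = A x"
proof -
  have "\<exists>B. positive_op V B \<and> (\<forall>x\<in>V. B (B x) = A x)"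
    by (rule positive_sqrt_ex[OF assms]) blast
  from someI_ex[OF this] show "positive_op V (sqrt_op V A)" "x \<in> V \<Longrightarrow> sqrt_op V A (sqrt_op V A x) = A x"
    by (auto simp: sqrt_op_def)
qed

lemma sqrt_op_commute:
  assumes A: "positive_op V A" and S: "bounded_op V S" "\<And>x. x \<in> V \<Longrightarrow> S (A x) = A (S x)" and x: "x \<in> V"
  shows "S (sqrt_op V A x) = sqrt_op V A (S x)"
proof -
  obtain B where B: "positive_op V B" "\<And>x. x \<in> V \<Longrightarrow> B (B x) = A x"
    "\<And>S x. bounded_op V S \<Longrightarrow> (\<And>x. x \<in> V \<Longrightarrow> S (A x) = A (S x)) \<Longrightarrow> x \<in> V \<Longrightarrow> S (B x) = B (S x)"
    using positive_sqrt_ex[OF A] by blast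
  have "sqrt_op V A y = B y" if "y \<in> V" for y
    using positive_sqrt_unique[OF sqrt_op_spec(1)[OF A] B(1) _ that] sqrt_op_spec(2)[OF A] B(2) by simp
  then show ?thesis
    using B(3)[OF S x] S(1) x by (simp add: bounded_opD)
qed

text \<open>Both choices are made from the same predicate, so the results agree as functions,
  including the arbitrary values outside \<open>V\<close>.\<close>

lemma sqrt_op_cong:
  assumes "\<And>x. x \<in> V \<Longrightarrow> A x = A' x"
  shows "sqrt_op V A = sqrt_op V A'"
  unfolding sqrt_op_def using assms by (simp cong: ball_cong)

lemma positive_op_square:
  assumes "self_adjoint_op V T"
  shows "positive_op V (\<lambda>x. T (T x))"
  unfolding positive_op_def
proof (intro conjI ballI)
  show "self_adjoint_op V (\<lambda>x. T (T x))"
    by (rule self_adjoint_op_compose[OF assms assms refl])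
  show "0 \<le> Re (cinner (T (T x)) x)" if "x \<in> V" for x
    using that self_adjoint_opD(2)[OF assms, of "T x" x] self_adjoint_opD(1)[OF assms]
    by (simp add: bounded_opD cinner_self)
qed

lemma adj_op_self_adjoint:
  assumes "self_adjoint_op V T" "x \<in> V"
  shows "adj_op V T x = T x"
  unfolding adj_op_def
proof (rule the_equality)
  show "T x \<in> V \<and> (\<forall>z\<in>V. cinner (T z) x = cinner z (T x))"
    using assms by (simp add: self_adjoint_op_def bounded_opD)
  fix y assume y: "y \<in> V \<and> (\<forall>z\<in>V. cinner (T z) x = cinner z y)"
  show "y = T x"
  proof (rule cinner_eqI)
    show "y \<in> V" "T x \<in> V" using y assms by (auto simp: self_adjoint_op_def bounded_opD)
    fix z assume "z \<in> V"
    then have "cinner z y = cinner z (T x)"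
      using y assms by (metis self_adjoint_opD(2))
    then show "cinner y z = cinner (T x) z"
      by (metis cinner_commute)
  qed
qed

lemma abs_op_eq_sqrt_op:
  assumes "self_adjoint_op V T"
  shows "abs_op V T = sqrt_op V (\<lambda>x. T (T x))"
  unfolding abs_op_def
  by (rule sqrt_op_cong) (use assms in \<open>simp add: adj_op_self_adjoint self_adjoint_opD bounded_opD\<close>)

end

section \<open>The spectral theorem\<close>

lemma norm_orthogonal_sum:
  fixes f :: "'i \<Rightarrow> 'a::complex_inner"
  assumes "finite I" "\<And>i j. i \<noteq> j \<Longrightarrow> cinner (f i) (f j) = 0"
  shows "(norm (\<Sum>i\<in>I. f i))\<^sup>2 = (\<Sum>i\<in>I. (norm (f i))\<^sup>2)"
  using assms(1)
proof (induction I rule: finite_induct)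
  case (insert i I)
  have "cinner (f i) (sum f I) = 0"
    using insert.hyps assms(2) unfolding cinner_sum_right by (metis (no_types, lifting) sum.neutral)
  then show ?case
    using insert by (simp add: norm_sq_add)
qed simp

lemma (in hilbert_subspace) orthogonal_series:
  assumes V: "\<And>i. f i \<in> V" and orth: "\<And>i j. i \<noteq> j \<Longrightarrow> cinner (f i) (f j) = 0"
    and summable: "summable (\<lambda>i::nat. (norm (f i))\<^sup>2)"
  shows "\<exists>s\<in>V. f sums s"
proof -
  have "Cauchy (\<lambda>n. \<Sum>i<n. f i)"
  proof (rule metric_CauchyI)
    fix e :: real assume e: "0 < e"
    then obtain M where M: "\<And>m n. m \<ge> M \<Longrightarrow> norm (\<Sum>i\<in>{m..<n}. (norm (f i))\<^sup>2) < e\<^sup>2"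
      using summable unfolding summable_Cauchy by (meson zero_less_power)
    have *: "dist (\<Sum>i<n. f i) (\<Sum>i<m. f i) < e" if "M \<le> m" "m \<le> n" for m n
    proof -
      have "(\<Sum>i<n. f i) - (\<Sum>i<m. f i) = (\<Sum>i\<in>{m..<n}. f i)"
        using that sum_diff_nat_ivl[of 0 m n f] by (simp add: lessThan_atLeast0)
      then have "(dist (\<Sum>i<n. f i) (\<Sum>i<m. f i))\<^sup>2 = (\<Sum>i\<in>{m..<n}. (norm (f i))\<^sup>2)"
        using norm_orthogonal_sum[of "{m..<n}" f] orth by (simp add: dist_norm)
      also have "\<dots> < e\<^sup>2"
        using M[of m n] that by (simp add: sum_nonneg)
      finally show ?thesis
        using e by (meson less_eq_real_def power_less_imp_less_base)
    qed
    show "\<exists>M. \<forall>m\<ge>M. \<forall>n\<ge>M. dist (\<Sum>i<m. f i) (\<Sum>i<n. f i) < e"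
    proof (intro exI allI impI)
      fix m n assume "M \<le> m" "M \<le> n"
      then show "dist (\<Sum>i<m. f i) (\<Sum>i<n. f i) < e"
        using *[of n m] *[of m n] by (cases "n \<le> m") (auto simp: dist_commute)
    qed
  qed
  then show ?thesis
    unfolding sums_def using Cauchy_lim[of "\<lambda>n. \<Sum>i<n. f i"] V by auto
qed

text \<open>Over \<open>n\<close> equal subintervals the bounds add up to
  \<open>(b - a) * (F b - F a) / n\<close>, which tends to 0. This replaces Riemann-Stieltjes sums
  when an operator is compared with the integral over its spectral projections.\<close>

lemma eq_if_increment_bound:
  fixes D F :: "real \<Rightarrow> real"
  assumes bound: "\<And>s t. a \<le> s \<Longrightarrow> s \<le> t \<Longrightarrow> t \<le> b \<Longrightarrow> \<bar>D t - D s\<bar> \<le> (t - s) * (F t - F s)"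
    and "a \<le> b"
  shows "D b = D a"
proof -
  have le: "\<bar>D b - D a\<bar> \<le> (b - a) * (F b - F a) / real (Suc n)" for n
  proof -
    let ?N = "Suc n"
    define d where "d = (b - a) / real ?N"
    define s where "s i = a + d * real i" for i
    have d: "0 \<le> d" "d * real ?N = b - a"
      using \<open>a \<le> b\<close> by (auto simp: d_def)
    have s0: "s 0 = a" "s ?N = b" using d(2) by (auto simp: s_def)
    have si: "a \<le> s i" "s i \<le> s (Suc i)" "s (Suc i) - s i = (b - a) / real ?N" for i
      using d(1) by (auto simp: s_def distrib_left) (simp add: d_def)
    have sb: "s i \<le> b" if "i \<le> ?N" for i
    proof -
      have "d * real i \<le> d * real ?N"
        using that d(1) by (intro mult_left_mono) auto
      then show ?thesis using d(2) by (simp add: s_def)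
    qed
    have "D b - D a = (\<Sum>i<?N. D (s (Suc i)) - D (s i))"
      by (simp add: sum_lessThan_telescope[of "\<lambda>i. D (s i)"] s0 del: sum.lessThan_Suc)
    also have "\<bar>\<dots>\<bar> \<le> (\<Sum>i<?N. (b - a) / real ?N * (F (s (Suc i)) - F (s i)))"
    proof (intro order_trans[OF sum_abs] sum_mono)
      fix i assume "i \<in> {..<?N}"
      then show "\<bar>D (s (Suc i)) - D (s i)\<bar> \<le> (b - a) / real ?N * (F (s (Suc i)) - F (s i))"
        using bound[OF si(1,2)[of i] sb[of "Suc i"]] si(3)[of i] by simp
    qed
    also have "\<dots> = (b - a) / real ?N * (F b - F a)"
      unfolding sum_distrib_left[symmetric]
      by (simp add: sum_lessThan_telescope[of "\<lambda>i. F (s i)"] s0 del: sum.lessThan_Suc)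
    finally show ?thesis by simp
  qed
  have "(\<lambda>n. (b - a) * (F b - F a) / real (Suc n)) \<longlonglongrightarrow> 0"
    using LIMSEQ_Suc[OF lim_const_over_n[of "(b - a) * (F b - F a)"]] by simp
  then have "\<bar>D b - D a\<bar> \<le> 0"
    by (rule LIMSEQ_le_const) (use le in auto)
  then show ?thesis by simp
qed

section \<open>Spectral projections of half-lines\<close>

context hilbert_subspace
begin

lemma kernel_hilbert_subspace:
  assumes C: "bounded_op V C"
  shows "hilbert_subspace {x\<in>V. C x = 0}"
proof (rule hilbert_subspace_closed_subset[OF hilbert_subspace_axioms])
  show "closed {x\<in>V. C x = 0}"
    unfolding closed_sequential_limits
  proof (intro allI impI, elim conjE)
    fix X x assume X: "\<forall>n. X n \<in> {x\<in>V. C x = 0}" "X \<longlonglongrightarrow> x"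
    then have x: "x \<in> V" using lim_mem[of X] by auto
    have "(\<lambda>n. C (X n)) \<longlonglongrightarrow> C x"
      using X x by (intro bounded_op_tendsto[OF C]) auto
    moreover have "(\<lambda>n. C (X n)) = (\<lambda>n. 0)" using X by auto
    ultimately have "C x = 0" by (simp add: LIMSEQ_const_iff)
    then show "x \<in> {x\<in>V. C x = 0}" using x by simp
  qed
qed (use C in \<open>auto simp: bounded_op_0 bounded_opD\<close>)

definition projection_op :: "('a \<Rightarrow> 'a) \<Rightarrow> bool" where
  "projection_op P \<longleftrightarrow> self_adjoint_op V P \<and> (\<forall>x\<in>V. P (P x) = P x)"

lemma projection_opD:
  assumes "projection_op P"
  shows "self_adjoint_op V P" "bounded_op V P" "x \<in> V \<Longrightarrow> P x \<in> V" "x \<in> V \<Longrightarrow> P (P x) = P x"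
    "x \<in> V \<Longrightarrow> y \<in> V \<Longrightarrow> cinner (P x) y = cinner x (P y)"
    "x \<in> V \<Longrightarrow> cinner (P x) x = complex_of_real ((norm (P x))\<^sup>2)"
    "x \<in> V \<Longrightarrow> Re (cinner (P x) x) = (norm (P x))\<^sup>2"
proof -
  show P: "self_adjoint_op V P" "bounded_op V P" "x \<in> V \<Longrightarrow> P x \<in> V" "x \<in> V \<Longrightarrow> P (P x) = P x"
    "x \<in> V \<Longrightarrow> y \<in> V \<Longrightarrow> cinner (P x) y = cinner x (P y)" for x y
    using assms by (auto simp: projection_op_def self_adjoint_op_def bounded_opD)
  show *: "cinner (P x) x = complex_of_real ((norm (P x))\<^sup>2)" if "x \<in> V" for x
    using P(4)[OF that] P(5)[OF P(3)[OF that] that] by (simp add: cinner_self del: of_real_power)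
  show "Re (cinner (P x) x) = (norm (P x))\<^sup>2" if "x \<in> V" for x
    using *[OF that] by simp
qed

lemma projection_proj:
  assumes "hilbert_subspace W" "W \<subseteq> V"
  shows "projection_op (hilbert_subspace.proj W)"
proof -
  interpret W: hilbert_subspace W by fact
  have "bounded_op V W.proj"
    by (rule bounded_opI[where K = 1])
      (use assms W.proj_mem W.norm_proj_le in \<open>auto simp: W.proj_add W.proj_scaleC\<close>)
  then show ?thesis
    by (simp add: projection_op_def self_adjoint_op_def W.cinner_proj)
qed

lemma projection_complement:
  assumes "projection_op P"
  shows "projection_op (\<lambda>x. x - P x)"
  unfolding projection_op_def
  using self_adjoint_op_diff[OF self_adjoint_op_id projection_opD(1)[OF assms]]
  by (simp add: bounded_op_diff[OF projection_opD(2)[OF assms]] projection_opD(3,4)[OF assms])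

text \<open>\<open>E\<close> projects onto the kernel of the positive part of \<open>A - l\<close>,
  the spectral subspace of the half-line up to \<open>l\<close>. The strictness in the last clause
  (equality forces \<open>x = 0\<close>) is what later yields right continuity in
  \<open>l\<close>.\<close>

lemma spectral_projection_ex:
  assumes A: "self_adjoint_op V A"
  shows "\<exists>E. projection_op E \<and>
    (\<forall>S. self_adjoint_op V S \<longrightarrow> (\<forall>x\<in>V. S (A x) = A (S x)) \<longrightarrow> (\<forall>x\<in>V. S (E x) = E (S x))) \<and>
    (\<forall>x\<in>V. E x = x \<longrightarrow> Re (cinner (A x) x) \<le> l * (norm x)\<^sup>2) \<and>
    (\<forall>x\<in>V. E x = 0 \<longrightarrow> l * (norm x)\<^sup>2 \<le> Re (cinner (A x) x) \<and>
       (Re (cinner (A x) x) = l * (norm x)\<^sup>2 \<longrightarrow> x = 0))"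
proof -
  define B where "B x = A x - l *\<^sub>R x" for x
  have B: "self_adjoint_op V B"
    unfolding B_def by (intro self_adjoint_op_diff self_adjoint_op_id self_adjoint_op_scaleR A)
  note bA = self_adjoint_opD(1)[OF A] and bB = self_adjoint_opD(1)[OF B]
  define D where "D = sqrt_op V (\<lambda>x. B (B x))"
  note BB = positive_op_square[OF B]
  have D: "positive_op V D" and DD: "\<And>x. x \<in> V \<Longrightarrow> D (D x) = B (B x)"
    using sqrt_op_spec[OF BB] by (auto simp: D_def)
  note bD = positive_opD(2)[OF D] and sD = positive_opD(1)[OF D]
  have DS: "S (D x) = D (S x)" if "bounded_op V S" "\<And>x. x \<in> V \<Longrightarrow> S (B x) = B (S x)" "x \<in> V" for S x
    unfolding D_def by (rule sqrt_op_commute[OF BB]) (use that bB in \<open>auto simp: bounded_opD\<close>)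
  have BD: "B (D x) = D (B x)" if "x \<in> V" for x
    by (rule DS[OF bB refl that])
  \<comment> \<open>Since \<open>D\<close> is the modulus of \<open>B\<close>, this is twice the
    positive part of \<open>B\<close>.\<close>
  define C where "C x = D x + B x" for x
  have C: "self_adjoint_op V C"
    unfolding C_def by (rule self_adjoint_op_add[OF sD B])
  note bC = self_adjoint_opD(1)[OF C]
  define N where "N = {x\<in>V. C x = 0}"
  have hN: "hilbert_subspace N"
    unfolding N_def by (rule kernel_hilbert_subspace[OF bC])
  interpret N: hilbert_subspace N by fact
  have NV: "x \<in> V" if "x \<in> N" for x using that by (simp add: N_def)
  have quad: "Re (cinner (A x) x) = Re (cinner (B x) x) + l * (norm x)\<^sup>2" for x
    by (simp add: B_def cinner_diff_left scaleR_eq_scaleC cinner_scaleC_left cinner_self)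
  have comm: "S (N.proj x) = N.proj (S x)"
    if S: "self_adjoint_op V S" and SA: "\<forall>x\<in>V. S (A x) = A (S x)" and x: "x \<in> V" for S x
  proof -
    note bS = self_adjoint_opD(1)[OF S]
    have SB: "S (B y) = B (S y)" if "y \<in> V" for y
      using SA that bS bA by (simp add: B_def bounded_op_diff bounded_opD scaleR_eq_scaleC)
    have SN: "S y \<in> N" if "y \<in> N" for y
    proof -
      have y: "y \<in> V" "D y + B y = 0" using that by (auto simp: N_def C_def)
      have "C (S y) = S (D y + B y)"
        using y(1) bS bD bB DS[OF bS SB y(1)] by (simp add: C_def bounded_opD SB)
      then show ?thesis using y bS by (simp add: N_def bounded_opD bounded_op_0)
    qed
    have "N.proj (S x) = S (N.proj x)"
    proof (rule N.proj_eqI)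
      show "S (N.proj x) \<in> N" by (simp add: SN)
      fix z assume z: "z \<in> N"
      have "cinner (S (N.proj x)) z = cinner (N.proj x) (S z)"
        using self_adjoint_opD(2)[OF S] NV N.proj_mem z by blast
      also have "\<dots> = cinner x (S z)"
        using N.cinner_proj_left[OF SN[OF z]] .
      also have "\<dots> = cinner (S x) z"
        using self_adjoint_opD(2)[OF S x NV[OF z]] by simp
      finally show "cinner (S (N.proj x)) z = cinner (S x) z" .
    qed
    then show ?thesis by simp
  qed
  have low: "Re (cinner (A x) x) \<le> l * (norm x)\<^sup>2" if x: "x \<in> V" and Ex: "N.proj x = x" for x
  proof -
    have "C x = 0" using Ex N.proj_mem[of x] by (simp add: N_def)
    then have "B x = - D x" unfolding C_def by (metis add_eq_0_iff)
    then have "Re (cinner (B x) x) \<le> 0"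
      using positive_opD(3)[OF D x] by (simp add: cinner_minus_left)
    then show ?thesis by (simp add: quad)
  qed
  have high: "l * (norm x)\<^sup>2 \<le> Re (cinner (A x) x)" "Re (cinner (A x) x) = l * (norm x)\<^sup>2 \<Longrightarrow> x = 0"
    if x: "x \<in> V" and Ex: "N.proj x = 0" for x
  proof -
    \<comment> \<open>\<open>(D + B) (D - B) = 0\<close> because \<open>D\<close> and
      \<open>B\<close> commute and have equal squares, so \<open>D - B\<close> maps into
      \<open>N\<close>. As \<open>x\<close> is orthogonal to \<open>N\<close>, the vector
      \<open>(D - B) x\<close> must vanish, and \<open>B\<close> acts on \<open>x\<close> as the
      positive \<open>D\<close>.\<close>
    define y where "y = D x - B x"
    have y: "y \<in> V" using x bD bB by (simp add: y_def bounded_opD)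
    have y2: "D y - B y \<in> N"
    proof -
      have "C (D y - B y) = 0"
        using y bC bB bD by (simp add: C_def bounded_op_diff bounded_opD BD DD)
      then show ?thesis using y bD bB by (simp add: N_def bounded_opD)
    qed
    have "cinner y y = cinner x (D y - B y)"
      using self_adjoint_opD(2)[OF sD x y] self_adjoint_opD(2)[OF B x y]
      by (subst y_def) (simp add: cinner_simps)
    also have "\<dots> = 0"
      using y2 Ex N.proj_eq_0_iff by blast
    finally have DB: "B x = D x" by (simp add: y_def)
    then show "l * (norm x)\<^sup>2 \<le> Re (cinner (A x) x)"
      using positive_opD(3)[OF D x] by (simp add: quad)
    assume "Re (cinner (A x) x) = l * (norm x)\<^sup>2"
    then have "Re (cinner (D x) x) = 0" using DB by (simp add: quad)
    then have "D x = 0" by (rule positive_quadratic_0[OF D x])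
    then have "x \<in> N" using x DB by (simp add: N_def C_def)
    then show "x = 0" using Ex by simp
  qed
  have "N \<subseteq> V" by (auto simp: N_def)
  show ?thesis
    by (intro exI[of _ N.proj] conjI projection_proj[OF hN \<open>N \<subseteq> V\<close>])
      (use comm low high in blast)+
qed

text \<open>A spectral family in the sense of Stieltjes. Each projection commutes with
  \<open>A\<close>, hence with all the others, and the two form estimates then order them.\<close>

lemma spectral_projections_ex:
  assumes A: "self_adjoint_op V A"
  obtains E K where "\<And>l. projection_op (E l)"
    "\<And>l m x. l \<le> m \<Longrightarrow> x \<in> V \<Longrightarrow> E m (E l x) = E l x"
    "\<And>l m x. l \<le> m \<Longrightarrow> x \<in> V \<Longrightarrow> E l (E m x) = E l x"
    "\<And>l x. x \<in> V \<Longrightarrow> E l x = x \<Longrightarrow> Re (cinner (A x) x) \<le> l * (norm x)\<^sup>2"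
    "\<And>l x. x \<in> V \<Longrightarrow> E l x = 0 \<Longrightarrow> l * (norm x)\<^sup>2 \<le> Re (cinner (A x) x)"
    "\<And>l x. x \<in> V \<Longrightarrow> A (E l x) = E l (A x)"
    "K > 0" "\<And>l x. x \<in> V \<Longrightarrow> l \<le> - K \<Longrightarrow> E l x = 0" "\<And>l x. x \<in> V \<Longrightarrow> K \<le> l \<Longrightarrow> E l x = x"
    "\<And>l x. x \<in> V \<Longrightarrow> (\<lambda>n. E (l + 1 / real (Suc n)) x) \<longlonglongrightarrow> E l x"
proof -
  note bA = self_adjoint_opD(1)[OF A]
  define Q where "Q l E \<longleftrightarrow> projection_op E \<and>
    (\<forall>S. self_adjoint_op V S \<longrightarrow> (\<forall>x\<in>V. S (A x) = A (S x)) \<longrightarrow> (\<forall>x\<in>V. S (E x) = E (S x))) \<and>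
    (\<forall>x\<in>V. E x = x \<longrightarrow> Re (cinner (A x) x) \<le> l * (norm x)\<^sup>2) \<and>
    (\<forall>x\<in>V. E x = 0 \<longrightarrow> l * (norm x)\<^sup>2 \<le> Re (cinner (A x) x) \<and>
       (Re (cinner (A x) x) = l * (norm x)\<^sup>2 \<longrightarrow> x = 0))" for l E
  have "\<exists>E. Q l E" for l
    unfolding Q_def by (rule spectral_projection_ex[OF A])
  then obtain E where QE: "\<And>l. Q l (E l)" by metis
  have E: "\<And>l. projection_op (E l)"
    and comm: "\<And>S x l. self_adjoint_op V S \<Longrightarrow> (\<And>x. x \<in> V \<Longrightarrow> S (A x) = A (S x)) \<Longrightarrow> x \<in> V \<Longrightarrow> S (E l x) = E l (S x)"
    and low: "\<And>l x. x \<in> V \<Longrightarrow> E l x = x \<Longrightarrow> Re (cinner (A x) x) \<le> l * (norm x)\<^sup>2"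
    and high: "\<And>l x. x \<in> V \<Longrightarrow> E l x = 0 \<Longrightarrow> l * (norm x)\<^sup>2 \<le> Re (cinner (A x) x)"
    and high_eq: "\<And>l x. x \<in> V \<Longrightarrow> E l x = 0 \<Longrightarrow> Re (cinner (A x) x) = l * (norm x)\<^sup>2 \<Longrightarrow> x = 0"
    using QE unfolding Q_def by simp_all
  note EV = projection_opD(3)[OF E] and EE = projection_opD(4)[OF E] and bE = projection_opD(2)[OF E]
  have EA: "A (E l x) = E l (A x)" if "x \<in> V" for l x
    using comm[OF A _ that] by simp
  have Ecomm: "E l (E m x) = E m (E l x)" if "x \<in> V" for l m x
    by (rule comm[OF projection_opD(1)[OF E] _ that]) (simp add: EA)
  \<comment> \<open>A vector below level \<open>l\<close> and above level \<open>m > l\<close> at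
    once has a quadratic form obeying incompatible bounds.\<close>
  have E0: "y = 0" if y: "y \<in> V" "E l y = y" "E m y = 0" and lm: "l < m" for y l m
  proof -
    have "m * (norm y)\<^sup>2 \<le> l * (norm y)\<^sup>2"
      using low[OF y(1,2)] high[OF y(1,3)] by simp
    then show ?thesis using lm by (simp add: mult_le_cancel_right)
  qed
  have mono: "E m (E l x) = E l x" if "l \<le> m" "x \<in> V" for l m x
  proof (cases "l = m")
    case False
    have "E l x - E m (E l x) = 0"
      using that False E0[of "E l x - E m (E l x)" l m]
      by (simp add: EV EE bounded_op_diff[OF bE] Ecomm)
    then show ?thesis by simp
  qed (use that EE in simp)
  have mono': "E l (E m x) = E l x" if "l \<le> m" "x \<in> V" for l m x
    using mono[OF that] Ecomm[OF that(2)] by simp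
  obtain K where K: "K > 0" "\<And>x. x \<in> V \<Longrightarrow> norm (A x) \<le> K * norm x"
    using bounded_op_bound[OF bA] by blast
  have Kq: "\<bar>Re (cinner (A x) x)\<bar> \<le> K * (norm x)\<^sup>2" if "x \<in> V" for x
  proof -
    have "\<bar>Re (cinner (A x) x)\<bar> \<le> norm (A x) * norm x"
      using norm_cinner_le[of "A x" x] abs_Re_le_cmod order_trans by blast
    also have "\<dots> \<le> K * norm x * norm x" using K(2)[OF that] by (intro mult_right_mono) auto
    finally show ?thesis by (simp add: power2_eq_square mult.assoc)
  qed
  \<comment> \<open>The margin 1 matters: at \<open>l = - K\<close> the two estimates are compatible
    with a nonzero vector. The constant handed out at the end is therefore
    \<open>K + 1\<close>.\<close>
  have Elow: "E l x = 0" if x: "x \<in> V" and l: "l \<le> - (K + 1)" for l x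
  proof -
    have "- (K * (norm (E l x))\<^sup>2) \<le> l * (norm (E l x))\<^sup>2"
      using low[OF EV[OF x] EE[OF x], of l] Kq[OF EV[OF x], of l] by linarith
    also have "\<dots> \<le> - (K + 1) * (norm (E l x))\<^sup>2"
      using l by (intro mult_right_mono) auto
    finally have "(norm (E l x))\<^sup>2 \<le> 0" by (simp add: algebra_simps)
    then show ?thesis by simp
  qed
  have Ehigh: "E l x = x" if x: "x \<in> V" and l: "K + 1 \<le> l" for l x
  proof -
    define y where "y = x - E l x"
    have y: "y \<in> V" "E l y = 0" using x EV EE by (auto simp: y_def bounded_op_diff[OF bE])
    have "(K + 1) * (norm y)\<^sup>2 \<le> l * (norm y)\<^sup>2"
      using l by (intro mult_right_mono) auto
    also have "\<dots> \<le> K * (norm y)\<^sup>2"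
      using high[OF y] Kq[OF y(1)] by linarith
    finally have "(norm y)\<^sup>2 \<le> 0" by (simp add: algebra_simps)
    then show ?thesis by (simp add: y_def)
  qed
  have right: "(\<lambda>n. E (l + 1 / real (Suc n)) x) \<longlonglongrightarrow> E l x" if x: "x \<in> V" for l x
  proof -
    define Y where "Y n = E (l + 1 / real (Suc n)) x" for n
    have step: "1 / real (Suc m) \<le> 1 / real (Suc n)" if "n \<le> m" for m n
      using that by (simp add: field_simps)
    \<comment> \<open>The \<open>Y n\<close> are projections of \<open>x\<close> onto a decreasing
      chain of subspaces, so by Pythagoras the decreasing norms control the differences.\<close>
    have norm_sq: "(norm (Y n - Y m))\<^sup>2 = (norm (Y n))\<^sup>2 - (norm (Y m))\<^sup>2" if "n \<le> m" for m n
    proof -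
      have "E (l + 1 / real (Suc n)) (Y m) = Y m"
        using mono[OF _ x] step[OF that] by (simp add: Y_def)
      then have "cinner (Y n) (Y m) = cinner (Y m) (Y m)"
        unfolding Y_def using projection_opD(5)[OF E] x EV mono'[OF _ x] step[OF that]
        by (metis add_left_mono EE)
      then show ?thesis
        by (simp add: norm_sq_diff cinner_self)
    qed
    have dec: "(norm (Y m))\<^sup>2 \<le> (norm (Y n))\<^sup>2" if "n \<le> m" for m n
      using norm_sq[OF that] zero_le_power2[of "norm (Y n - Y m)"] by linarith
    have "Bseq (\<lambda>n. (norm (Y n))\<^sup>2)"
      using dec[of 0] by (intro BseqI'[where K = "(norm (Y 0))\<^sup>2"]) auto
    then have "convergent (\<lambda>n. (norm (Y n))\<^sup>2)"
      using dec by (intro Bseq_monoseq_convergent decseq_imp_monoseq) (auto simp: decseq_def)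
    then have Cs: "Cauchy (\<lambda>n. (norm (Y n))\<^sup>2)"
      by (rule convergent_Cauchy)
    have "Cauchy Y"
    proof (rule metric_CauchyI)
      fix e :: real assume e: "0 < e"
      then obtain M where M: "\<And>m n. M \<le> m \<Longrightarrow> M \<le> n \<Longrightarrow> norm ((norm (Y m))\<^sup>2 - (norm (Y n))\<^sup>2) < e\<^sup>2"
        using Cs unfolding Cauchy_iff by (meson zero_less_power)
      have *: "dist (Y n) (Y m) < e" if "M \<le> n" "n \<le> m" for m n
      proof -
        have "(norm (Y n - Y m))\<^sup>2 < e\<^sup>2"
          using M[of n m] that norm_sq[OF that(2)] by simp
        then show ?thesis
          using e unfolding dist_norm by (meson less_eq_real_def power_less_imp_less_base)
      qed
      show "\<exists>M. \<forall>m\<ge>M. \<forall>n\<ge>M. dist (Y m) (Y n) < e"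
      proof (intro exI allI impI)
        fix m n assume "M \<le> m" "M \<le> n"
        then show "dist (Y m) (Y n) < e"
          using *[of n m] *[of m n] by (cases "n \<le> m") (auto simp: dist_commute)
      qed
    qed
    moreover have YV: "Y n \<in> V" for n using EV[OF x] by (simp add: Y_def)
    ultimately obtain y where y: "y \<in> V" "Y \<longlonglongrightarrow> y"
      using Cauchy_lim by blast
    have Ey: "E l y = E l x"
    proof (rule LIMSEQ_unique)
      show "(\<lambda>n. E l (Y n)) \<longlonglongrightarrow> E l y"
        by (intro bounded_op_tendsto[OF bE] YV y)
      show "(\<lambda>n. E l (Y n)) \<longlonglongrightarrow> E l x"
        using mono'[OF _ x] by (simp add: Y_def)
    qed
    \<comment> \<open>The limit \<open>y\<close> is fixed by every
      \<open>E (l + 1 / real (Suc n))\<close>, so the form of \<open>A\<close> at \<open>z\<close>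
      is at most \<open>l\<close> times the squared norm. Since \<open>E l z = 0\<close> it is also
      at least that, and equality forces \<open>z = 0\<close>.\<close>
    define z where "z = y - E l x"
    have z: "z \<in> V" "E l z = 0"
      using x y EV EE by (auto simp: z_def bounded_op_diff[OF bE] Ey)
    have "E (l + 1 / real (Suc n)) y = y" for n
    proof (rule LIMSEQ_unique)
      show "(\<lambda>m. E (l + 1 / real (Suc n)) (Y m)) \<longlonglongrightarrow> E (l + 1 / real (Suc n)) y"
        by (intro bounded_op_tendsto[OF bE] YV y)
      have "eventually (\<lambda>m. E (l + 1 / real (Suc n)) (Y m) = Y m) sequentially"
        using mono[OF _ x] step by (intro eventually_sequentiallyI[of n]) (simp add: Y_def)
      then show "(\<lambda>m. E (l + 1 / real (Suc n)) (Y m)) \<longlonglongrightarrow> y"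
        using y(2) by (simp cong: tendsto_cong)
    qed
    then have "E (l + 1 / real (Suc n)) z = z" for n
      using y EV[OF x] mono[OF _ x, of l "l + 1 / real (Suc n)"] by (simp add: z_def bounded_op_diff[OF bE])
    then have "Re (cinner (A z) z) \<le> (l + 1 / real (Suc n)) * (norm z)\<^sup>2" for n
      using low[OF z(1)] by blast
    moreover have "(\<lambda>n. (l + 1 / real (Suc n)) * (norm z)\<^sup>2) \<longlonglongrightarrow> (l + 0) * (norm z)\<^sup>2"
      by (intro tendsto_intros LIMSEQ_Suc lim_1_over_n)
    ultimately have "Re (cinner (A z) z) \<le> (l + 0) * (norm z)\<^sup>2"
      using LIMSEQ_le_const by blast
    then have "Re (cinner (A z) z) = l * (norm z)\<^sup>2"
      using high[OF z] by simp
    then have "z = 0" by (rule high_eq[OF z])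
    then show ?thesis using y by (simp add: z_def Y_def[abs_def])
  qed
  show thesis
    by (rule that[OF E mono mono' low high EA _ Elow Ehigh right]) (use K in auto)
qed

end

section \<open>From half-lines to a projection-valued measure\<close>

context hilbert_subspace
begin

text \<open>The scalar measures come first, as Stieltjes measures. A projection is attached to a
  Borel set by matching quadratic forms, the squared norm of \<open>P x\<close> being
  \<open>cinner (P x) x\<close>; this makes it unique on \<open>V\<close>.\<close>

definition represents :: "('a \<Rightarrow> real measure) \<Rightarrow> real set \<Rightarrow> ('a \<Rightarrow> 'a) \<Rightarrow> bool" where
  "represents \<mu> B P \<longleftrightarrow> projection_op P \<and> (\<forall>x\<in>V. measure (\<mu> x) B = (norm (P x))\<^sup>2)"

lemma represents_unique:
  assumes "represents \<mu> B P" "represents \<mu> B Q" "x \<in> V"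
  shows "P x = Q x"
proof (rule quadratic_form_eqI[OF _ _ _ assms(3)])
  have P: "projection_op P" and Q: "projection_op Q"
    using assms by (auto simp: represents_def)
  show "bounded_op V P" "bounded_op V Q"
    using projection_opD(2)[OF P] projection_opD(2)[OF Q] .
  show "cinner (P x) x = cinner (Q x) x" if "x \<in> V" for x
    using assms that
    by (simp add: projection_opD(6)[OF P that] projection_opD(6)[OF Q that] represents_def
        del: of_real_power)
qed

text \<open>Disjoint sets have orthogonal projections: for \<open>y = P j x\<close> the set
  \<open>A j\<close> already carries the total mass of \<open>\<mu> y\<close>, which leaves none for
  \<open>A i\<close>. So the \<open>P i x\<close> form an orthogonal series whose squared norms sum
  by additivity of the measure.\<close>

lemma represents_Union:
  assumes fin: "\<And>x. x \<in> V \<Longrightarrow> finite_measure (\<mu> x)" and sets: "\<And>x. sets (\<mu> x) = sets borel"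
    and total: "\<And>x. x \<in> V \<Longrightarrow> measure (\<mu> x) UNIV = (norm x)\<^sup>2"
    and A: "range A \<subseteq> sets borel" "disjoint_family A"
    and P: "\<And>i::nat. represents \<mu> (A i) (P i)"
  shows "\<exists>R. represents \<mu> (\<Union>i. A i) R \<and> (\<forall>x\<in>V. (\<lambda>i. P i x) sums R x)"
proof -
  have pP: "projection_op (P i)" for i using P by (simp add: represents_def)
  note bP = projection_opD(2)[OF pP] and PV = projection_opD(3)[OF pP] and PP = projection_opD(4)[OF pP]
  have m: "measure (\<mu> x) (A i) = (norm (P i x))\<^sup>2" if "x \<in> V" for x i
    using P that by (simp add: represents_def)
  have PP0: "P i (P j x) = 0" if ij: "i \<noteq> j" and x: "x \<in> V" for i j x
  proof -
    define y where "y = P j x"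
    have y: "y \<in> V" "P j y = y" using x PV PP by (auto simp: y_def)
    interpret finite_measure "\<mu> y" by (rule fin[OF y(1)])
    have AiAj: "A i \<in> sets (\<mu> y)" "A j \<in> sets (\<mu> y)" using A by (auto simp: sets)
    have "measure (\<mu> y) (A i) + measure (\<mu> y) (A j) = measure (\<mu> y) (A i \<union> A j)"
      using AiAj A ij by (intro finite_measure_Union[symmetric]) (auto simp: disjoint_family_on_def)
    also have "\<dots> \<le> measure (\<mu> y) UNIV"
      using AiAj by (intro finite_measure_mono) (auto simp: sets)
    finally have "(norm (P i y))\<^sup>2 \<le> 0"
      using y by (simp add: m total)
    then show ?thesis by (simp add: y_def)
  qed
  have orth: "cinner (P i x) (P j x) = 0" if "i \<noteq> j" "x \<in> V" for i j x
    using projection_opD(5)[OF pP that(2) PV[OF that(2)]] PP0[OF that] by simp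
  have msums: "(\<lambda>i. (norm (P i x))\<^sup>2) sums measure (\<mu> x) (\<Union>i. A i)" if x: "x \<in> V" for x
    using finite_measure.finite_measure_UNION[OF fin[OF x], of A] A by (simp add: sets m[OF x])
  have "\<exists>s\<in>V. (\<lambda>i. P i x) sums s" if x: "x \<in> V" for x
    by (rule orthogonal_series) (use x PV orth msums[OF x] sums_summable in auto)
  then obtain R where RV: "\<And>x. x \<in> V \<Longrightarrow> R x \<in> V" and R: "\<And>x. x \<in> V \<Longrightarrow> (\<lambda>i. P i x) sums R x"
    by metis
  have Rnorm: "(norm (R x))\<^sup>2 = measure (\<mu> x) (\<Union>i. A i)" if x: "x \<in> V" for x
  proof (rule LIMSEQ_unique)
    show "(\<lambda>n. (norm (\<Sum>i<n. P i x))\<^sup>2) \<longlonglongrightarrow> (norm (R x))\<^sup>2"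
      using R[OF x] unfolding sums_def by (intro tendsto_intros)
    show "(\<lambda>n. (norm (\<Sum>i<n. P i x))\<^sup>2) \<longlonglongrightarrow> measure (\<mu> x) (\<Union>i. A i)"
      using msums[OF x] orth[OF _ x] unfolding sums_def by (simp add: norm_orthogonal_sum)
  qed
  have bR: "bounded_op V R"
  proof (rule bounded_opI[where K = 1])
    fix x c assume x: "x \<in> V"
    show "R x \<in> V" by (rule RV[OF x])
    interpret finite_measure "\<mu> x" by (rule fin[OF x])
    have "measure (\<mu> x) (\<Union>i. A i) \<le> measure (\<mu> x) UNIV"
      by (intro finite_measure_mono) (auto simp: sets)
    then show "norm (R x) \<le> 1 * norm x"
      by (simp add: total[OF x] flip: Rnorm[OF x])
    have "(\<lambda>i. P i (scaleC c x)) sums scaleC c (R x)"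
      using bounded_linear.sums[OF bounded_linear_scaleC R[OF x]] by (simp add: bounded_opD(3)[OF bP x])
    then show "R (scaleC c x) = scaleC c (R x)"
      using R[OF scaleC_mem[OF x]] sums_unique2 by blast
    fix y assume y: "y \<in> V"
    have "(\<lambda>i. P i (x + y)) sums (R x + R y)"
      using sums_add[OF R[OF x] R[OF y]] by (simp add: bounded_opD(2)[OF bP x y])
    then show "R (x + y) = R x + R y"
      using R[OF add_mem[OF x y]] sums_unique2 by blast
  qed
  have sR: "self_adjoint_op V R"
    unfolding self_adjoint_op_def
  proof (intro conjI ballI bR)
    fix x y assume x: "x \<in> V" and y: "y \<in> V"
    have "(\<lambda>i. cinner (P i x) y) sums cinner (R x) y"
      by (rule bounded_linear.sums[OF bounded_linear_cinner_left R[OF x]])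
    moreover have "(\<lambda>i. cinner (P i x) y) sums cinner x (R y)"
      using bounded_linear.sums[OF bounded_linear_cinner_right R[OF y]]
      by (simp add: projection_opD(5)[OF pP x y])
    ultimately show "cinner (R x) y = cinner x (R y)"
      by (rule sums_unique2)
  qed
  have "R (R x) = R x" if x: "x \<in> V" for x
  proof -
    have "P i (R x) = P i x" for i
    proof (rule LIMSEQ_unique)
      show "(\<lambda>n. P i (\<Sum>j<n. P j x)) \<longlonglongrightarrow> P i (R x)"
        using R[OF x] RV[OF x] PV[OF x] unfolding sums_def
        by (intro bounded_op_tendsto[OF bP]) auto
      have "P i (\<Sum>j<n. P j x) = P i x" if "n > i" for n
      proof -
        have "P i (\<Sum>j<n. P j x) = (\<Sum>j<n. P i (P j x))"
          by (rule bounded_op_sum[OF bP]) (use PV x in auto)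
        also have "\<dots> = (\<Sum>j<n. if j = i then P i x else 0)"
          using PP0 PP x by (intro sum.cong) auto
        also have "\<dots> = P i x" using that by simp
        finally show ?thesis .
      qed
      then show "(\<lambda>n. P i (\<Sum>j<n. P j x)) \<longlonglongrightarrow> P i x"
        by (intro tendsto_eventually eventually_sequentiallyI[of "Suc i"]) auto
    qed
    then have "(\<lambda>i. P i x) sums R (R x)"
      using R[OF RV[OF x]] by simp
    then show ?thesis
      using R[OF x] sums_unique2 by blast
  qed
  then have "represents \<mu> (\<Union>i. A i) R"
    using sR Rnorm by (simp add: represents_def projection_op_def)
  then show ?thesis using R by blast
qed

text \<open>Dynkin's argument: the half-lines \<open>{..l}\<close> are stable under intersection and
  generate the Borel sets, while complements and countable disjoint unions of representable sets are
  representable.\<close>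

lemma represents_borel:
  assumes fin: "\<And>x. x \<in> V \<Longrightarrow> finite_measure (\<mu> x)" and sets: "\<And>x. sets (\<mu> x) = sets borel"
    and total: "\<And>x. x \<in> V \<Longrightarrow> measure (\<mu> x) UNIV = (norm x)\<^sup>2"
    and E: "\<And>l. represents \<mu> {..l} (E l)"
    and B: "B \<in> sets borel"
  shows "\<exists>P. represents \<mu> B P"
proof -
  have "Int_stable (range (atMost :: real \<Rightarrow> real set))"
    by (auto simp: Int_stable_def)
  moreover have "range atMost \<subseteq> Pow (UNIV :: real set)"
    by simp
  moreover have "B \<in> sigma_sets UNIV (range atMost)"
    using B by (simp add: borel_eq_atMost)
  ultimately show ?thesis
  proof (induction rule: sigma_sets_induct_disjoint)
    case (basic A)
    then show ?case using E by auto
  next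
    case empty
    have "represents \<mu> {} (\<lambda>x. 0)"
      by (simp add: represents_def projection_op_def self_adjoint_op_def bounded_op_zero)
    then show ?case by blast
  next
    case (compl A)
    then obtain P where P: "represents \<mu> A P" by blast
    then have pP: "projection_op P" by (simp add: represents_def)
    have Ab: "A \<in> sets borel" using compl by (simp add: borel_eq_atMost)
    have "represents \<mu> (UNIV - A) (\<lambda>x. x - P x)"
      unfolding represents_def
    proof (intro conjI ballI projection_complement[OF pP])
      fix x assume x: "x \<in> V"
      interpret finite_measure "\<mu> x" by (rule fin[OF x])
      have "space (\<mu> x) = UNIV" using sets_eq_imp_space_eq[OF sets] by simp
      then have "measure (\<mu> x) (UNIV - A) = (norm x)\<^sup>2 - (norm (P x))\<^sup>2"
        using finite_measure_compl[of A] P x Ab by (simp add: sets total represents_def)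
      also have "\<dots> = (norm (x - P x))\<^sup>2"
        using projection_opD(6)[OF pP x] projection_opD(5)[OF pP x x]
        by (simp add: norm_sq_diff)
      finally show "measure (\<mu> x) (UNIV - A) = (norm (x - P x))\<^sup>2" .
    qed
    then show ?case by blast
  next
    case (union A)
    then have "\<forall>i. \<exists>P. represents \<mu> (A i) P" by blast
    then obtain P where "\<And>i. represents \<mu> (A i) (P i)" by metis
    moreover have "range A \<subseteq> sets borel" using union by (auto simp: borel_eq_atMost)
    ultimately show ?case
      using represents_Union[OF fin sets total _ union(1), of P] by blast
  qed
qed

lemma projection_measure_of_represents:
  assumes fin: "\<And>x. x \<in> V \<Longrightarrow> finite_measure (\<mu> x)" and sets: "\<And>x. sets (\<mu> x) = sets borel"
    and total: "\<And>x. x \<in> V \<Longrightarrow> measure (\<mu> x) UNIV = (norm x)\<^sup>2"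
    and E: "\<And>B. B \<in> sets borel \<Longrightarrow> represents \<mu> B (E B)"
  shows "projection_measure V E"
  unfolding projection_measure_def
proof (intro conjI ballI allI impI)
  have pE: "projection_op (E B)" if "B \<in> sets borel" for B using E that by (simp add: represents_def)
  fix B :: "real set" assume "B \<in> sets borel"
  then show "self_adjoint_op V (E B)" "\<And>x. x \<in> V \<Longrightarrow> E B (E B x) = E B x"
    using projection_opD(1,4)[OF pE] by auto
next
  fix x assume "x \<in> V"
  moreover have "represents \<mu> UNIV (\<lambda>x. x)"
    by (simp add: represents_def projection_op_def self_adjoint_op_id total)
  ultimately show "E UNIV x = x"
    using represents_unique E[of UNIV] by auto
next
  fix B :: "nat \<Rightarrow> real set" and x assume B: "range B \<subseteq> sets borel" "disjoint_family B" and x: "x \<in> V"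
  obtain R where R: "represents \<mu> (\<Union>i. B i) R" "\<forall>x\<in>V. (\<lambda>i. E (B i) x) sums R x"
    using represents_Union[OF fin sets total B, of "\<lambda>i. E (B i)"] E B by (auto simp: image_subset_iff)
  have "(\<Union>i. B i) \<in> sets borel" using B by auto
  then have "E (\<Union>i. B i) x = R x"
    using represents_unique[OF E R(1) x] by blast
  then show "(\<lambda>i. E (B i) x) sums E (\<Union>i. B i) x"
    using R(2) x by simp
qed

lemma scalar_measure_of_represents:
  assumes fin: "\<And>x. x \<in> V \<Longrightarrow> finite_measure (\<mu> x)" and sets: "\<And>x. sets (\<mu> x) = sets borel"
    and E: "\<And>B. B \<in> sets borel \<Longrightarrow> represents \<mu> B (E B)" and x: "x \<in> V"
  shows "scalar_measure E x = \<mu> x"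
proof -
  interpret finite_measure "\<mu> x" by (rule fin[OF x])
  have sp: "space (\<mu> x) = UNIV" using sets_eq_imp_space_eq[OF sets] by simp
  have "scalar_measure E x = measure_of UNIV (sets borel) (emeasure (\<mu> x))"
    unfolding scalar_measure_def
  proof (rule measure_of_eq)
    show "sets borel \<subseteq> Pow (UNIV::real set)" by simp
    fix B :: "real set" assume "B \<in> sigma_sets UNIV (sets borel)"
    then have B: "B \<in> sets borel" using sets.sigma_sets_eq[of "borel :: real measure"] by simp
    then have "projection_op (E B)" using E by (simp add: represents_def)
    then show "ennreal (Re (cinner (E B x) x)) = emeasure (\<mu> x) B"
      using E[OF B] x by (simp add: projection_opD(7) emeasure_eq_measure represents_def)
  qed
  also have "\<dots> = \<mu> x"
    using measure_of_of_measure[of "\<mu> x"] by (simp add: sets sp)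
  finally show ?thesis .
qed

theorem spectral_resolution_ex:
  assumes A: "self_adjoint_op V A"
  shows "\<exists>E. spectral_resolution V A E"
proof -
  note bA = self_adjoint_opD(1)[OF A]
  show ?thesis
  proof (rule spectral_projections_ex[OF A])
    fix E K assume E: "\<And>l. projection_op (E l)"
      and mono: "\<And>l m x. l \<le> m \<Longrightarrow> x \<in> V \<Longrightarrow> E m (E l x) = E l x"
      and mono': "\<And>l m x. l \<le> m \<Longrightarrow> x \<in> V \<Longrightarrow> E l (E m x) = E l x"
      and low: "\<And>l x. x \<in> V \<Longrightarrow> E l x = x \<Longrightarrow> Re (cinner (A x) x) \<le> l * (norm x)\<^sup>2"
      and high: "\<And>l x. x \<in> V \<Longrightarrow> E l x = 0 \<Longrightarrow> l * (norm x)\<^sup>2 \<le> Re (cinner (A x) x)"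
      and EA: "\<And>l x. x \<in> V \<Longrightarrow> A (E l x) = E l (A x)"
      and K: "K > 0" and Elow: "\<And>l x. x \<in> V \<Longrightarrow> l \<le> - K \<Longrightarrow> E l x = 0"
      and Ehigh: "\<And>l x. x \<in> V \<Longrightarrow> K \<le> l \<Longrightarrow> E l x = x"
      and right: "\<And>l x. x \<in> V \<Longrightarrow> (\<lambda>n. E (l + 1 / real (Suc n)) x) \<longlonglongrightarrow> E l x"
    note EV = projection_opD(3)[OF E] and EE = projection_opD(4)[OF E] and bE = projection_opD(2)[OF E]
    \<comment> \<open>\<open>F x\<close> becomes the distribution function of the spectral measure
      at \<open>x\<close>. Right continuity comes from that of the projections, and the limits at
      infinity are trivial because \<open>F x\<close> is constant below \<open>- K\<close> and above
      \<open>K\<close>.\<close>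
    define F where "F x l = (norm (E l x))\<^sup>2" for x l
    have F_diff: "F x m - F x l = (norm (E m x - E l x))\<^sup>2" if "l \<le> m" "x \<in> V" for x l m
    proof -
      have "cinner (E m x) (E l x) = cinner (E l x) (E l x)"
        using projection_opD(5)[OF E that(2) EV[OF that(2)], of m l] mono[OF that]
          projection_opD(5)[OF E that(2) EV[OF that(2)], of l l] EE[OF that(2)] by simp
      then show ?thesis by (simp add: norm_sq_diff F_def cinner_self)
    qed
    have F_mono: "F x l \<le> F x m" if "l \<le> m" "x \<in> V" for x l m
      using F_diff[OF that] zero_le_power2[of "norm (E m x - E l x)"] by linarith
    have F_low: "F x l = 0" if "l \<le> - K" "x \<in> V" for x l
      using Elow that by (simp add: F_def)
    have F_high: "F x l = (norm x)\<^sup>2" if "K \<le> l" "x \<in> V" for x l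
      using Ehigh that by (simp add: F_def)
    have F_right: "continuous (at_right l) (F x)" if x: "x \<in> V" for x l
      unfolding continuous_within
    proof (rule order_tendstoI)
      fix a assume "a < F x l"
      then show "eventually (\<lambda>m. a < F x m) (at_right l)"
        by (intro eventually_mono[OF eventually_at_right_less])
          (use F_mono[OF less_imp_le x] in \<open>fastforce intro: less_le_trans\<close>)
    next
      fix a assume a: "F x l < a"
      have "(\<lambda>n. F x (l + 1 / real (Suc n))) \<longlonglongrightarrow> F x l"
        unfolding F_def by (intro tendsto_intros right x)
      then have "eventually (\<lambda>n. F x (l + 1 / real (Suc n)) < a) sequentially"
        using a by (rule order_tendstoD)
      then obtain n where n: "F x (l + 1 / real (Suc n)) < a"
        by (auto simp: eventually_sequentially)
      have "F x m < a" if "l < m" "m < l + 1 / real (Suc n)" for m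
        using F_mono[of m "l + 1 / real (Suc n)" x] that x n by simp
      then show "eventually (\<lambda>m. F x m < a) (at_right l)"
        by (intro eventually_at_rightI[of l "l + 1 / real (Suc n)"]) auto
    qed
    have F_bot: "(F x \<longlongrightarrow> 0) at_bot" if "x \<in> V" for x
      by (rule tendsto_eventually) (use F_low that in \<open>auto simp: eventually_at_bot_linorder\<close>)
    have F_top: "(F x \<longlongrightarrow> (norm x)\<^sup>2) at_top" if "x \<in> V" for x
      by (rule tendsto_eventually) (use F_high that in \<open>auto simp: eventually_at_top_linorder\<close>)
    define \<mu> where "\<mu> x = interval_measure (F x)" for x
    have fbm: "finite_borel_measure (\<mu> x)" if "x \<in> V" for x
      unfolding \<mu>_def
      by (rule finite_borel_measure_interval_measure[OF F_mono F_right F_bot F_top]) (use that in auto)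
    then have fin: "finite_measure (\<mu> x)" if "x \<in> V" for x
      using that by (simp add: finite_borel_measure_def)
    have sets: "sets (\<mu> x) = sets borel" for x by (simp add: \<mu>_def)
    have sp: "space (\<mu> x) = UNIV" for x by (simp add: \<mu>_def)
    have total: "measure (\<mu> x) UNIV = (norm x)\<^sup>2" if x: "x \<in> V" for x
    proof -
      have "emeasure (\<mu> x) UNIV = (norm x)\<^sup>2"
        unfolding \<mu>_def
        by (rule interval_measure_UNIV[OF F_mono F_right F_bot F_top]) (use that in auto)
      then show ?thesis by (simp add: measure_def)
    qed
    have Iic: "measure (\<mu> x) {..l} = F x l" if x: "x \<in> V" for x l
      unfolding \<mu>_def
      by (rule measure_interval_measure_Iic[OF F_mono F_right F_bot]) (use that in auto)
    have "represents \<mu> {..l} (E l)" for l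
      unfolding represents_def by (simp add: E Iic F_def)
    from represents_borel[OF fin sets total this]
    have "\<exists>P. B \<in> sets borel \<longrightarrow> represents \<mu> B P" for B
      by blast
    then obtain G where G: "\<And>B. B \<in> sets borel \<Longrightarrow> represents \<mu> B (G B)"
      by metis
    have sm: "scalar_measure G x = \<mu> x" if "x \<in> V" for x
      by (rule scalar_measure_of_represents[OF fin sets G that])
    have quad: "integrable (\<mu> x) (\<lambda>t. t) \<and> cinner (A x) x = complex_of_real (\<integral>t. t \<partial>\<mu> x)"
      if x: "x \<in> V" for x
    proof -
      interpret finite_measure "\<mu> x" by (rule fin[OF x])
      have [measurable_cong]: "sets (\<mu> x) = sets borel" by (rule sets)
      have Ioc: "measure (\<mu> x) {a<..b} = F x b - F x a" if "a \<le> b" for a b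
      proof -
        have "{a<..b} = {..b} - {..a}" by auto
        then show ?thesis
          using finite_measure_Diff[of "{..b}" "{..a}"] that by (simp add: sets Iic[OF x])
      qed
      have AE: "AE t in \<mu> x. t \<in> {-K<..K}"
      proof -
        have "emeasure (\<mu> x) (UNIV - {-K<..K}) = 0"
        proof -
          have "measure (\<mu> x) (UNIV - {-K<..K}) = measure (\<mu> x) UNIV - measure (\<mu> x) {-K<..K}"
            using finite_measure_compl[of "{-K<..K}"] by (simp add: sets sp)
          also have "\<dots> = 0"
            using K x by (simp add: total Ioc F_low F_high)
          finally show ?thesis by (simp add: emeasure_eq_measure)
        qed
        then show ?thesis
          by (intro AE_I[of _ _ "UNIV - {-K<..K}"]) (auto simp: sets sp)
      qed
      have int: "integrable (\<mu> x) (\<lambda>t. t)"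
        by (rule integrable_const_bound[where B = K]) (auto intro!: eventually_mono[OF AE])
      \<comment> \<open>\<open>D\<close> compares the form of \<open>A\<close>, cut off by
        \<open>E s\<close>, with the truncated first moment \<open>I\<close>. From \<open>s\<close>
        to \<open>t\<close> both change by a number between \<open>s\<close> and \<open>t\<close>
        times the mass of \<open>{s<..t}\<close>, so \<open>D\<close> changes by at most
        \<open>t - s\<close> times that mass and is constant by
        \<open>eq_if_increment_bound\<close>. It vanishes at \<open>- K\<close>, and its value at
        \<open>K\<close> is the error of the spectral formula.\<close>
      define I where "I s = (\<integral>t. indicator {..s} t * t \<partial>\<mu> x)" for s
      define D where "D s = Re (cinner (A (E s x)) x) - I s" for s
      have inti: "integrable (\<mu> x) (\<lambda>t. indicator B t * t)" if "B \<in> sets borel" for B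
        using integrable_mult_indicator[OF _ int, of B] that by (simp add: sets)
      have "D K = D (- K)"
      proof (rule eq_if_increment_bound[where D = D and F = "F x" and a = "- K" and b = K])
        fix s t assume st: "- K \<le> s" "s \<le> t" "t \<le> K"
        define y where "y = E t x - E s x"
        have y: "y \<in> V" "E t y = y" "E s y = 0"
          using x EV EE st mono mono' by (auto simp: y_def bounded_op_diff[OF bE])
        have ny: "(norm y)\<^sup>2 = F x t - F x s"
          using F_diff[OF st(2) x] by (simp add: y_def)
        have EAy: "E t (A y) = A y" "E s (A y) = 0"
          using y EA[OF y(1), of t] EA[OF y(1), of s] by (simp_all add: bounded_op_0[OF bA])
        have "cinner (A y) y = cinner (A y) (E t x) - cinner (A y) (E s x)"
          by (subst (2) y_def) (rule cinner_diff_right)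
        also have "\<dots> = cinner (A y) x"
          using projection_opD(5)[OF E bounded_opD(1)[OF bA y(1)] x, of t]
            projection_opD(5)[OF E bounded_opD(1)[OF bA y(1)] x, of s] by (simp add: EAy)
        also have "\<dots> = cinner (A (E t x)) x - cinner (A (E s x)) x"
          using x EV by (simp add: y_def bounded_op_diff[OF bA] cinner_diff_left)
        finally have Ay: "cinner (A y) y = cinner (A (E t x)) x - cinner (A (E s x)) x" .
        have G1: "s * (F x t - F x s) \<le> Re (cinner (A y) y)" "Re (cinner (A y) y) \<le> t * (F x t - F x s)"
          using low[OF y(1,2)] high[OF y(1,3)] by (simp_all add: ny)
        have It: "I t - I s = (\<integral>r. indicator {s<..t} r * r \<partial>\<mu> x)"
        proof -
          have "I t - I s = (\<integral>r. indicator {..t} r * r - indicator {..s} r * r \<partial>\<mu> x)"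
            unfolding I_def by (intro Bochner_Integration.integral_diff[symmetric] inti) auto
          also have "\<dots> = (\<integral>r. indicator {s<..t} r * r \<partial>\<mu> x)"
            using st by (intro Bochner_Integration.integral_cong) (auto simp: indicator_def)
          finally show ?thesis .
        qed
        have ci: "(\<integral>r. indicator {s<..t} r * c \<partial>\<mu> x) = c * (F x t - F x s)" for c
          using st by (simp add: Ioc sp)
        have cint: "integrable (\<mu> x) (\<lambda>r. indicator {s<..t} r * c)" for c :: real
          by (simp add: sets emeasure_eq_measure)
        have "(\<integral>r. indicator {s<..t} r * s \<partial>\<mu> x) \<le> (\<integral>r. indicator {s<..t} r * r \<partial>\<mu> x)"
          by (intro integral_mono inti cint) (auto simp: indicator_def)
        moreover have "(\<integral>r. indicator {s<..t} r * r \<partial>\<mu> x) \<le> (\<integral>r. indicator {s<..t} r * t \<partial>\<mu> x)"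
          by (intro integral_mono inti cint) (auto simp: indicator_def)
        ultimately have G2: "s * (F x t - F x s) \<le> I t - I s" "I t - I s \<le> t * (F x t - F x s)"
          by (simp_all only: It ci)
        have "D t - D s = Re (cinner (A y) y) - (I t - I s)"
          by (simp add: D_def Ay)
        then show "\<bar>D t - D s\<bar> \<le> (t - s) * (F x t - F x s)"
          using G1 G2 unfolding left_diff_distrib by linarith
      qed (use K in simp)
      moreover have "D (- K) = 0"
      proof -
        have "I (- K) = (\<integral>t. 0 \<partial>\<mu> x)"
          unfolding I_def by (rule integral_cong_AE) (auto intro!: eventually_mono[OF AE])
        then show ?thesis by (simp add: D_def Elow[OF x] bounded_op_0[OF bA])
      qed
      moreover have "I K = (\<integral>t. t \<partial>\<mu> x)"
        unfolding I_def by (rule integral_cong_AE) (auto intro!: eventually_mono[OF AE])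
      ultimately have "Re (cinner (A x) x) = (\<integral>t. t \<partial>\<mu> x)"
        by (simp add: D_def Ehigh[OF x])
      then show ?thesis
        using int self_adjoint_quadratic_real[OF A x] by simp
    qed
    have "spectral_resolution V A G"
      unfolding spectral_resolution_def
      using projection_measure_of_represents[OF fin sets total G] quad sm by simp
    then show ?thesis by blast
  qed
qed

end

section \<open>Borel functional calculus\<close>

definition bounded_borel :: "(real \<Rightarrow> complex) \<Rightarrow> bool" where
  "bounded_borel f \<longleftrightarrow> f \<in> borel_measurable borel \<and> (\<exists>M. \<forall>t. norm (f t) \<le> M)"

lemma bounded_borelI: "f \<in> borel_measurable borel \<Longrightarrow> (\<And>t. norm (f t) \<le> M) \<Longrightarrow> bounded_borel f"
  by (auto simp: bounded_borel_def)

lemma bounded_borel_measurable [measurable_dest]: "bounded_borel f \<Longrightarrow> f \<in> borel_measurable borel"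
  by (simp add: bounded_borel_def)

lemma borel_measurable_cnj [measurable]: "cnj \<in> borel_measurable borel"
  by (intro borel_measurable_continuous_onI continuous_intros)

lemma bounded_borel_const: "bounded_borel (\<lambda>t. c)"
  by (rule bounded_borelI[where M = "norm c"]) auto

lemma bounded_borel_indicator: "B \<in> sets borel \<Longrightarrow> bounded_borel (indicator B)"
  by (rule bounded_borelI[where M = 1]) (auto simp: indicator_def)

lemma bounded_borel_cnj: "bounded_borel f \<Longrightarrow> bounded_borel (\<lambda>t. cnj (f t))"
  unfolding bounded_borel_def by auto

lemma bounded_borel_add:
  assumes "bounded_borel f" "bounded_borel g"
  shows "bounded_borel (\<lambda>t. f t + g t)"
proof -
  obtain M N where "\<And>t. norm (f t) \<le> M" "\<And>t. norm (g t) \<le> N"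
    using assms by (auto simp: bounded_borel_def)
  then show ?thesis
    using assms by (intro bounded_borelI[where M = "M + N"])
      (auto simp: bounded_borel_def intro!: norm_triangle_le add_mono)
qed

lemma bounded_borel_mult:
  assumes "bounded_borel f" "bounded_borel g"
  shows "bounded_borel (\<lambda>t. f t * g t)"
proof -
  obtain M N where MN: "\<And>t. norm (f t) \<le> M" "\<And>t. norm (g t) \<le> N"
    using assms by (auto simp: bounded_borel_def)
  have "0 \<le> M" using MN(1)[of 0] norm_ge_zero order_trans by blast
  then show ?thesis
    using assms MN by (intro bounded_borelI[where M = "M * N"])
      (auto simp: bounded_borel_def norm_mult intro!: mult_mono)
qed

lemma bounded_borel_scale: "bounded_borel f \<Longrightarrow> bounded_borel (\<lambda>t. c * f t)"
  by (rule bounded_borel_mult[OF bounded_borel_const])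

lemma bounded_borel_diff: "bounded_borel f \<Longrightarrow> bounded_borel g \<Longrightarrow> bounded_borel (\<lambda>t. f t - g t)"
  using bounded_borel_add[OF _ bounded_borel_scale[of g "-1"]] by simp

lemma bounded_borel_truncate:
  "f \<in> borel_measurable borel \<Longrightarrow> 0 \<le> M \<Longrightarrow> bounded_borel (\<lambda>t. if norm (f t) \<le> M then f t else 0)"
  by (rule bounded_borelI[where M = M]) auto

locale self_adjoint_operator = hilbert_subspace +
  fixes A :: "'a \<Rightarrow> 'a"
  assumes self_adjoint: "self_adjoint_op V A"
begin

lemmas bounded = self_adjoint_opD(1)[OF self_adjoint]

abbreviation E :: "real set \<Rightarrow> 'a \<Rightarrow> 'a" where "E \<equiv> spectral_family V A"
abbreviation \<mu> :: "'a \<Rightarrow> real measure" where "\<mu> \<equiv> spectral_measure V A"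
abbreviation calc :: "(real \<Rightarrow> complex) \<Rightarrow> 'a \<Rightarrow> 'a" where "calc \<equiv> bounded_calculus V A"

lemma spectral_family_resolution: "spectral_resolution V A E"
  unfolding spectral_family_def by (rule someI_ex[OF spectral_resolution_ex[OF self_adjoint]])

lemma projection_E: "B \<in> sets borel \<Longrightarrow> projection_op (E B)"
  using spectral_family_resolution
  by (simp add: spectral_resolution_def projection_measure_def projection_op_def)

lemmas E_mem = projection_opD(3)[OF projection_E]
  and bounded_E = projection_opD(2)[OF projection_E]
  and E_E = projection_opD(4)[OF projection_E]
  and cinner_E = projection_opD(5)[OF projection_E]

lemma E_UNIV: "x \<in> V \<Longrightarrow> E UNIV x = x"
  using spectral_family_resolution
  by (simp add: spectral_resolution_def projection_measure_def)

lemma E_sums: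
  fixes B :: "nat \<Rightarrow> real set"
  shows "range B \<subseteq> sets borel \<Longrightarrow> disjoint_family B \<Longrightarrow> x \<in> V \<Longrightarrow> (\<lambda>i. E (B i) x) sums E (\<Union>i. B i) x"
  using spectral_family_resolution
  by (simp add: spectral_resolution_def projection_measure_def)

lemma E_empty: "x \<in> V \<Longrightarrow> E {} x = 0"
proof -
  assume x: "x \<in> V"
  have "(\<lambda>i::nat. E {} x) sums E (\<Union>i::nat. {}) x"
    using x by (intro E_sums) (auto simp: disjoint_family_on_def)
  then have "(\<lambda>i::nat. E {} x) \<longlonglongrightarrow> 0"
    by (rule summable_LIMSEQ_zero[OF sums_summable])
  then show ?thesis by (simp add: LIMSEQ_const_iff)
qed

lemma E_Un:
  assumes B: "B \<in> sets borel" and C: "C \<in> sets borel" and BC: "B \<inter> C = {}" and x: "x \<in> V"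
  shows "E (B \<union> C) x = E B x + E C x"
proof -
  define D where "D n = (if n = 0 then B else if n = 1 then C else {})" for n :: nat
  have D: "(\<Union>n. D n) = B \<union> C"
    by (auto simp: D_def split: if_splits)
  have "(\<lambda>n. E (D n) x) sums E (\<Union>n. D n) x"
    using B C BC x by (intro E_sums) (auto simp: D_def disjoint_family_on_def)
  moreover have "(\<lambda>n. E (D n) x) sums (\<Sum>n\<in>{0,1}. E (D n) x)"
    by (rule sums_finite) (use x in \<open>auto simp: D_def E_empty\<close>)
  ultimately have "E (\<Union>n. D n) x = (\<Sum>n\<in>{0,1}. E (D n) x)"
    by (rule sums_unique2)
  then show ?thesis by (simp add: D) (simp add: D_def)
qed

text \<open>\<open>projection_measure\<close> asks for projections and additivity only;
  multiplicativity follows. For disjoint sets the sum of two projections is again idempotent, which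
  forces their product to be 0; the general case splits both sets along the intersection.\<close>

lemma E_Int:
  assumes B: "B \<in> sets borel" and C: "C \<in> sets borel" and x: "x \<in> V"
  shows "E B (E C x) = E (B \<inter> C) x"
proof -
  have disj: "E B (E C x) = 0"
    if B: "B \<in> sets borel" and C: "C \<in> sets borel" and BC: "B \<inter> C = {}" and x: "x \<in> V" for B C x
  proof -
    define y where "y = E C x"
    have y: "y \<in> V" "E C y = y" using x C by (auto simp: y_def E_mem E_E)
    have BCy: "E (B \<union> C) y = E B y + y" using E_Un[OF B C BC y(1)] y by simp
    have "E (B \<union> C) (E (B \<union> C) y) = E (B \<union> C) y"
      using B C y by (intro E_E) auto
    then have "E B (E B y + y) + E C (E B y + y) = E B y + y"
      using E_Un[OF B C BC, of "E B y + y"] y B by (simp add: BCy E_mem)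
    then have z: "E B y + E C (E B y) = 0"
      using y B C by (simp add: bounded_opD(2)[OF bounded_E] E_mem E_E)
    then have "cinner (E B y + E C (E B y)) y = 0" by simp
    then have "(norm (E B y))\<^sup>2 + Re (cinner (E C (E B y)) y) = 0"
      using projection_opD(7)[OF projection_E[OF B] y(1)] by (metis cinner_add_left plus_complex.simps(1) zero_complex.simps(1))
    moreover have "cinner (E C (E B y)) y = cinner (E B y) y"
      using cinner_E[OF C E_mem[OF B y(1)] y(1)] y by simp
    ultimately have "2 * (norm (E B y))\<^sup>2 = 0"
      using projection_opD(7)[OF projection_E[OF B] y(1)] by simp
    then show ?thesis by (simp add: y_def)
  qed
  have sp: "B \<inter> C \<in> sets borel" "C - B \<in> sets borel" "B - C \<in> sets borel"
    using B C by auto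
  have "(B \<inter> C) \<union> (C - B) = C" "(B \<inter> C) \<inter> (C - B) = {}" by auto
  then have "E C x = E (B \<inter> C) x + E (C - B) x"
    using E_Un[OF sp(1,2) _ x] by simp
  then have "E B (E C x) = E B (E (B \<inter> C) x) + E B (E (C - B) x)"
    using x sp by (simp add: bounded_opD(2)[OF bounded_E[OF B]] E_mem)
  also have "E B (E (C - B) x) = 0"
    using B sp x by (intro disj) auto
  also have "E B (E (B \<inter> C) x) = E (B \<inter> C) (E (B \<inter> C) x) + E (B - C) (E (B \<inter> C) x)"
  proof -
    have "(B \<inter> C) \<union> (B - C) = B" "(B \<inter> C) \<inter> (B - C) = {}" by auto
    then show ?thesis
      using E_Un[OF sp(1,3) _ E_mem[OF sp(1) x]] by simp
  qed
  also have "E (B - C) (E (B \<inter> C) x) = 0"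
    using sp x by (intro disj) auto
  finally show ?thesis using x sp by (simp add: E_E)
qed

lemma sets_\<mu> [simp, measurable_cong]: "sets (\<mu> x) = sets borel"
  using sets.sigma_sets_eq[of "borel :: real measure"]
  by (simp add: spectral_measure_def scalar_measure_def)

lemma space_\<mu> [simp]: "space (\<mu> x) = UNIV"
  by (simp add: spectral_measure_def scalar_measure_def)

text \<open>\<open>measure_of\<close> falls back to the zero measure when the set function is not
  countably additive, so additivity has to be verified before values can be read off.\<close>

lemma emeasure_\<mu>:
  assumes x: "x \<in> V" and B: "B \<in> sets borel"
  shows "emeasure (\<mu> x) B = ennreal ((norm (E B x))\<^sup>2)"
proof -
  have "emeasure (\<mu> x) B = ennreal (Re (cinner (E B x) x))"
  proof (rule emeasure_measure_of[OF spectral_measure_def[of V A x, unfolded scalar_measure_def]])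
    show "sets borel \<subseteq> Pow (UNIV :: real set)" by simp
    show "B \<in> sets (\<mu> x)" using B by simp
    show "positive (sets (\<mu> x)) (\<lambda>B. ennreal (Re (cinner (E B x) x)))"
      using x by (simp add: positive_def E_empty)
    show "countably_additive (sets (\<mu> x)) (\<lambda>B. ennreal (Re (cinner (E B x) x)))"
    proof (rule countably_additiveI)
      fix D :: "nat \<Rightarrow> real set" assume D: "range D \<subseteq> sets (\<mu> x)" "disjoint_family D"
      then have Db: "D i \<in> sets borel" for i by auto
      have "(\<lambda>i. E (D i) x) sums E (\<Union>i. D i) x"
        using D x by (intro E_sums) auto
      then have "(\<lambda>i. Re (cinner (E (D i) x) x)) sums Re (cinner (E (\<Union>i. D i) x) x)"
        by (intro bounded_linear.sums[OF bounded_linear_Re] bounded_linear.sums[OF bounded_linear_cinner_left])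
      then show "(\<Sum>i. ennreal (Re (cinner (E (D i) x) x))) = ennreal (Re (cinner (E (\<Union>i. D i) x) x))"
        by (intro suminf_ennreal_eq) (auto simp: projection_opD(7)[OF projection_E[OF Db] x])
    qed
  qed
  then show ?thesis
    by (simp add: projection_opD(7)[OF projection_E[OF B] x])
qed

lemma finite_measure_\<mu>: "x \<in> V \<Longrightarrow> finite_measure (\<mu> x)"
  by (rule finite_measureI) (simp add: emeasure_\<mu>)

lemma measure_\<mu>: "x \<in> V \<Longrightarrow> B \<in> sets borel \<Longrightarrow> measure (\<mu> x) B = (norm (E B x))\<^sup>2"
  by (simp add: measure_def emeasure_\<mu>)

lemma integrable_bounded_borel:
  fixes f :: "real \<Rightarrow> complex"
  assumes x: "x \<in> V" and f: "bounded_borel f"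
  shows "integrable (\<mu> x) f"
proof -
  interpret finite_measure "\<mu> x" by (rule finite_measure_\<mu>[OF x])
  obtain M where M: "\<And>t. norm (f t) \<le> M" using f by (auto simp: bounded_borel_def)
  show ?thesis
    using f by (intro integrable_const_bound[where B = M]) (auto simp: M bounded_borel_def)
qed

text \<open>This makes null sets portable between vectors: the condition \<open>E S x = 0\<close> is
  linear and continuous in \<open>x\<close>, whereas the measure itself is not linear in
  \<open>x\<close>.\<close>

lemma AE_\<mu>_iff:
  assumes x: "x \<in> V" and B: "{t. P t} \<in> sets borel"
  shows "(AE t in \<mu> x. P t) \<longleftrightarrow> E {t. \<not> P t} x = 0"
proof -
  have c: "{t. \<not> P t} \<in> sets borel"
    using B borel_comp[of "{t. P t}"] by (simp add: Collect_neg_eq)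
  have "(AE t in \<mu> x. P t) \<longleftrightarrow> emeasure (\<mu> x) {t. \<not> P t} = 0"
    using c by (subst AE_iff_measurable[of "{t. \<not> P t}"]) auto
  then show ?thesis
    using x c by (simp add: emeasure_\<mu>)
qed

subsection \<open>Bounded functions\<close>

definition represents_fun :: "(real \<Rightarrow> complex) \<Rightarrow> ('a \<Rightarrow> 'a) \<Rightarrow> bool" where
  "represents_fun f T \<longleftrightarrow> bounded_op V T \<and> (\<forall>x\<in>V. cinner (T x) x = (\<integral>t. f t \<partial>\<mu> x))"

lemma represents_fun_unique:
  "represents_fun f S \<Longrightarrow> represents_fun f T \<Longrightarrow> x \<in> V \<Longrightarrow> S x = T x"
  using quadratic_form_eqI[of S T x] by (simp add: represents_fun_def)

lemma represents_fun_add: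
  assumes "represents_fun f S" "represents_fun g T" "bounded_borel f" "bounded_borel g"
  shows "represents_fun (\<lambda>t. f t + g t) (\<lambda>x. S x + T x)"
  using assms by (simp add: represents_fun_def bounded_op_add cinner_add_left integrable_bounded_borel)

lemma represents_fun_scaleC:
  assumes "represents_fun f S" "bounded_borel f"
  shows "represents_fun (\<lambda>t. c * f t) (\<lambda>x. scaleC c (S x))"
  using assms by (simp add: represents_fun_def bounded_op_scaleC cinner_scaleC_left integrable_bounded_borel)

lemma represents_fun_diff:
  assumes "represents_fun f S" "represents_fun g T" "bounded_borel f" "bounded_borel g"
  shows "represents_fun (\<lambda>t. f t - g t) (\<lambda>x. S x - T x)"
  using assms by (simp add: represents_fun_def bounded_op_diff_op cinner_diff_left integrable_bounded_borel)

lemma represents_fun_indicator: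
  assumes B: "B \<in> sets borel"
  shows "represents_fun (indicator B) (E B)"
  unfolding represents_fun_def
proof (intro conjI ballI bounded_E[OF B])
  fix x assume x: "x \<in> V"
  interpret finite_measure "\<mu> x" by (rule finite_measure_\<mu>[OF x])
  have "(\<integral>t. indicator B t \<partial>\<mu> x) = (\<integral>t. complex_of_real (indicator B t) \<partial>\<mu> x)"
    by (intro Bochner_Integration.integral_cong) (auto simp: indicator_def)
  also have "\<dots> = complex_of_real (measure (\<mu> x) B)"
    using B by (subst integral_complex_of_real) simp
  finally show "cinner (E B x) x = (\<integral>t. indicator B t \<partial>\<mu> x)"
    using B x by (simp add: measure_\<mu> projection_opD(6)[OF projection_E[OF B] x])
qed

text \<open>The level sets are disjoint, so the summands are orthogonal. The resulting isometry with
  the square-integrable functions of \<open>\<mu> x\<close> is what will turn convergence of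
  functions into convergence of operators.\<close>

lemma represents_simple_function:
  fixes f :: "real \<Rightarrow> complex"
  assumes f: "simple_function borel f"
  shows "\<exists>T. represents_fun f T \<and> (\<forall>x\<in>V. (norm (T x))\<^sup>2 = (\<integral>t. (norm (f t))\<^sup>2 \<partial>\<mu> x))"
proof -
  have fin: "finite (range f)"
    using f by (simp add: simple_function_def)
  have sets: "f -` {c} \<in> sets borel" for c
  proof (cases "c \<in> range f")
    case True
    then show ?thesis using f by (auto simp: simple_function_def)
  next
    case False
    then have "f -` {c} = {}" by auto
    then show ?thesis by simp
  qed
  define B where "B c = f -` {c}" for c
  have B: "B c \<in> sets borel" for c by (simp add: B_def sets)
  define T where "T x = (\<Sum>c\<in>range f. scaleC c (E (B c) x))" for x
  have sum_ind: "(\<Sum>c\<in>range f. g c * indicator (B c) t) = g (f t)" for g :: "complex \<Rightarrow> 'c::semiring_1" and t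
  proof -
    have "(\<Sum>c\<in>range f. g c * indicator (B c) t) = (\<Sum>c\<in>range f. if c = f t then g (f t) else 0)"
      by (intro sum.cong) (auto simp: B_def indicator_def)
    then show ?thesis using fin by simp
  qed
  have bT: "bounded_op V T"
    unfolding T_def by (intro bounded_op_sum_op bounded_op_scaleC bounded_E B)
  have quad: "cinner (T x) x = (\<integral>t. f t \<partial>\<mu> x)" if x: "x \<in> V" for x
  proof -
    have "(\<integral>t. f t \<partial>\<mu> x) = (\<integral>t. (\<Sum>c\<in>range f. c * indicator (B c) t) \<partial>\<mu> x)"
      by (simp only: sum_ind[of "\<lambda>c. c"])
    also have "\<dots> = (\<Sum>c\<in>range f. \<integral>t. c * indicator (B c) t \<partial>\<mu> x)"
      by (intro Bochner_Integration.integral_sum integrable_bounded_borel[OF x] bounded_borel_scale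
          bounded_borel_indicator B)
    also have "\<dots> = (\<Sum>c\<in>range f. c * cinner (E (B c) x) x)"
      using represents_fun_indicator[OF B] x by (simp add: represents_fun_def)
    finally show ?thesis
      by (simp add: T_def cinner_sum_left cinner_scaleC_left)
  qed
  have "(norm (T x))\<^sup>2 = (\<integral>t. (norm (f t))\<^sup>2 \<partial>\<mu> x)" if x: "x \<in> V" for x
  proof -
    interpret finite_measure "\<mu> x" by (rule finite_measure_\<mu>[OF x])
    have "(norm (T x))\<^sup>2 = (\<Sum>c\<in>range f. (norm (scaleC c (E (B c) x)))\<^sup>2)"
      unfolding T_def
    proof (rule norm_orthogonal_sum[OF fin])
      fix c d :: complex assume "c \<noteq> d"
      then have "B c \<inter> B d = {}" by (auto simp: B_def)
      then have "cinner (E (B c) x) (E (B d) x) = 0"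
        using cinner_E[OF B x E_mem[OF B x]] E_Int[OF B B x] E_empty[OF x] by simp
      then show "cinner (scaleC c (E (B c) x)) (scaleC d (E (B d) x)) = 0"
        by (simp add: cinner_scaleC_left cinner_scaleC_right)
    qed
    also have "\<dots> = (\<Sum>c\<in>range f. \<integral>t. (norm c)\<^sup>2 * indicator (B c) t \<partial>\<mu> x)"
      by (simp add: power_mult_distrib measure_\<mu>[OF x B])
    also have "\<dots> = (\<integral>t. (\<Sum>c\<in>range f. (norm c)\<^sup>2 * indicator (B c) t) \<partial>\<mu> x)"
      by (intro Bochner_Integration.integral_sum[symmetric] integrable_mult_right integrable_real_indicator)
        (auto simp: B emeasure_eq_measure)
    also have "\<dots> = (\<integral>t. (norm (f t))\<^sup>2 \<partial>\<mu> x)"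
      by (simp only: sum_ind[of "\<lambda>c. (norm c)\<^sup>2"])
    finally show ?thesis .
  qed
  then show ?thesis
    using bT quad by (auto simp: represents_fun_def)
qed

lemma simple_function_bounded_borel:
  assumes f: "simple_function borel (f :: real \<Rightarrow> complex)"
  shows "bounded_borel f"
proof -
  have fin: "finite (range f)" using f by (simp add: simple_function_def)
  have "norm (f t) \<le> Max (norm ` range f)" for t
    using fin by (intro Max_ge) auto
  moreover have "f \<in> borel_measurable borel"
    by (rule borel_measurable_simple_function[OF f])
  ultimately show ?thesis by (rule bounded_borelI[rotated])
qed

text \<open>Simple approximants converge to \<open>f\<close> in mean square for every
  \<open>\<mu> x\<close> by dominated convergence; by the isometry the operators converge strongly,
  and norm identity and quadratic form pass to the limit.\<close>

lemma represents_fun_ex: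
  assumes f: "bounded_borel f"
  shows "\<exists>T. represents_fun f T \<and> (\<forall>x\<in>V. (norm (T x))\<^sup>2 = (\<integral>t. (norm (f t))\<^sup>2 \<partial>\<mu> x))"
proof -
  have [measurable]: "f \<in> borel_measurable borel" using f by (simp add: bounded_borel_def)
  obtain M where M: "\<And>t. norm (f t) \<le> M" using f by (auto simp: bounded_borel_def)
  have M0: "0 \<le> M" using M[of 0] norm_ge_zero order_trans by blast
  obtain F where F: "\<And>i. simple_function borel (F i)" "\<And>t. (\<lambda>i. F i t) \<longlonglongrightarrow> f t"
    and Fb: "\<And>i t. norm (F i t) \<le> 2 * norm (f t)"
    using borel_measurable_implies_sequence_metric[of f borel 0] by auto
  have bF: "bounded_borel (F i)" for i by (rule simple_function_bounded_borel[OF F(1)])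
  then have [measurable]: "F i \<in> borel_measurable borel" for i by (simp add: bounded_borel_def)
  \<comment> \<open>The approximants are bounded by twice \<open>f\<close>, not by \<open>f\<close>
    itself; hence the constants \<open>2 * M\<close>, \<open>3 * M\<close> and
    \<open>4 * M\<^sup>2\<close>.\<close>
  have FM: "norm (F i t) \<le> 2 * M" for i t
    using Fb[of i t] M[of t] by linarith
  have bound3: "norm ((norm (F i t - f t))\<^sup>2) \<le> (3 * M)\<^sup>2" for i t
  proof -
    have "norm (F i t - f t) \<le> 3 * M"
      using norm_triangle_ineq4[of "F i t" "f t"] FM[of i t] M[of t] by linarith
    then show ?thesis
      using power_mono[of "norm (F i t - f t)" "3 * M" 2] by simp
  qed
  have "\<forall>i. \<exists>T. represents_fun (F i) T" using represents_simple_function[OF F(1)] by blast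
  then obtain T where T: "\<And>i. represents_fun (F i) (T i)" by metis
  have bT: "bounded_op V (T i)" and quadT: "\<And>x. x \<in> V \<Longrightarrow> cinner (T i x) x = (\<integral>t. F i t \<partial>\<mu> x)" for i
    using T by (auto simp: represents_fun_def)
  have normT: "(norm (T i x))\<^sup>2 = (\<integral>t. (norm (F i t))\<^sup>2 \<partial>\<mu> x)" if x: "x \<in> V" for i x
    using represents_simple_function[OF F(1)[of i]] represents_fun_unique[OF T[of i] _ x] x by metis
  have normTT: "(norm (T i x - T j x))\<^sup>2 = (\<integral>t. (norm (F i t - F j t))\<^sup>2 \<partial>\<mu> x)" if x: "x \<in> V" for i j x
  proof -
    have "simple_function borel (\<lambda>t. F i t - F j t)"
      by (intro simple_function_diff F)
    from represents_simple_function[OF this]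
    obtain S where S: "represents_fun (\<lambda>t. F i t - F j t) S"
      "(norm (S x))\<^sup>2 = (\<integral>t. (norm (F i t - F j t))\<^sup>2 \<partial>\<mu> x)"
      using x by blast
    then show ?thesis
      using represents_fun_unique[OF S(1) represents_fun_diff[OF T T bF bF] x] by simp
  qed
  have conv: "\<exists>y\<in>V. (\<lambda>i. T i x) \<longlonglongrightarrow> y" if x: "x \<in> V" for x
  proof (rule Cauchy_lim)
    show "T i x \<in> V" for i using bT x by (rule bounded_opD)
    interpret finite_measure "\<mu> x" by (rule finite_measure_\<mu>[OF x])
    have lim: "(\<lambda>i. \<integral>t. (norm (F i t - f t))\<^sup>2 \<partial>\<mu> x) \<longlonglongrightarrow> (\<integral>t. 0 \<partial>\<mu> x)"
    proof (rule integral_dominated_convergence[where w = "\<lambda>_. (3 * M)\<^sup>2"])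
      show "AE t in \<mu> x. (\<lambda>i. (norm (F i t - f t))\<^sup>2) \<longlonglongrightarrow> 0"
      proof (intro AE_I2)
        fix t
        have "(\<lambda>i. (norm (F i t - f t))\<^sup>2) \<longlonglongrightarrow> (norm (f t - f t))\<^sup>2"
          by (intro tendsto_intros F)
        then show "(\<lambda>i. (norm (F i t - f t))\<^sup>2) \<longlonglongrightarrow> 0" by simp
      qed
      fix i show "AE t in \<mu> x. norm ((norm (F i t - f t))\<^sup>2) \<le> (3 * M)\<^sup>2"
      by (rule AE_I2) (rule bound3)
    qed auto
    have int: "integrable (\<mu> x) (\<lambda>t. (norm (F i t - f t))\<^sup>2)" for i
    proof (rule integrable_const_bound[where B = "(3 * M)\<^sup>2"])
      show "AE t in \<mu> x. norm ((norm (F i t - f t))\<^sup>2) \<le> (3 * M)\<^sup>2"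
      by (rule AE_I2) (rule bound3)
    qed auto
    have bound: "(norm (T i x - T j x))\<^sup>2 \<le>
        2 * (\<integral>t. (norm (F i t - f t))\<^sup>2 \<partial>\<mu> x) + 2 * (\<integral>t. (norm (F j t - f t))\<^sup>2 \<partial>\<mu> x)" for i j
    proof -
      have "(\<integral>t. (norm (F i t - F j t))\<^sup>2 \<partial>\<mu> x) \<le>
          (\<integral>t. 2 * (norm (F i t - f t))\<^sup>2 + 2 * (norm (F j t - f t))\<^sup>2 \<partial>\<mu> x)"
      proof (rule integral_mono')
        show "integrable (\<mu> x) (\<lambda>t. 2 * (norm (F i t - f t))\<^sup>2 + 2 * (norm (F j t - f t))\<^sup>2)"
          using int by auto
        fix t
        have "norm (F i t - F j t) \<le> norm (F i t - f t) + norm (F j t - f t)"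
          using norm_triangle_ineq4[of "F i t - f t" "F j t - f t"] by simp
        then have "(norm (F i t - F j t))\<^sup>2 \<le> (norm (F i t - f t) + norm (F j t - f t))\<^sup>2"
          by (intro power_mono) auto
        also have "\<dots> \<le> 2 * (norm (F i t - f t))\<^sup>2 + 2 * (norm (F j t - f t))\<^sup>2"
          using sum_squares_bound[of "norm (F i t - f t)" "norm (F j t - f t)"]
          by (simp add: power2_sum)
        finally show "(norm (F i t - F j t))\<^sup>2 \<le> 2 * (norm (F i t - f t))\<^sup>2 + 2 * (norm (F j t - f t))\<^sup>2" .
      qed simp
      then show ?thesis
        using int by (simp add: normTT[OF x])
    qed
    show "Cauchy (\<lambda>i. T i x)"
    proof (rule metric_CauchyI)
      fix e :: real assume e: "0 < e"
      have "eventually (\<lambda>i. (\<integral>t. (norm (F i t - f t))\<^sup>2 \<partial>\<mu> x) < e\<^sup>2 / 4) sequentially"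
        using lim by (rule order_tendstoD) (use e in simp)
      then obtain N where N: "\<And>i. N \<le> i \<Longrightarrow> (\<integral>t. (norm (F i t - f t))\<^sup>2 \<partial>\<mu> x) < e\<^sup>2 / 4"
        by (auto simp: eventually_sequentially)
      have "dist (T i x) (T j x) < e" if "N \<le> i" "N \<le> j" for i j
      proof -
        have "(norm (T i x - T j x))\<^sup>2 < e\<^sup>2"
          using bound[of i j] N[OF that(1)] N[OF that(2)] by linarith
        then show ?thesis
          using e unfolding dist_norm by (meson less_eq_real_def power_less_imp_less_base)
      qed
      then show "\<exists>M. \<forall>m\<ge>M. \<forall>n\<ge>M. dist (T m x) (T n x) < e" by blast
    qed
  qed
  then obtain U where UV: "\<And>x. x \<in> V \<Longrightarrow> U x \<in> V" and U: "\<And>x. x \<in> V \<Longrightarrow> (\<lambda>i. T i x) \<longlonglongrightarrow> U x"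
    by metis
  have Unorm: "(norm (U x))\<^sup>2 = (\<integral>t. (norm (f t))\<^sup>2 \<partial>\<mu> x)" if x: "x \<in> V" for x
  proof (rule LIMSEQ_unique)
    interpret finite_measure "\<mu> x" by (rule finite_measure_\<mu>[OF x])
    show "(\<lambda>i. (norm (T i x))\<^sup>2) \<longlonglongrightarrow> (norm (U x))\<^sup>2"
      by (intro tendsto_intros U x)
    show "(\<lambda>i. (norm (T i x))\<^sup>2) \<longlonglongrightarrow> (\<integral>t. (norm (f t))\<^sup>2 \<partial>\<mu> x)"
      unfolding normT[OF x]
    proof (rule integral_dominated_convergence[where w = "\<lambda>_. 4 * M\<^sup>2"])
      show "AE t in \<mu> x. norm ((norm (F i t))\<^sup>2) \<le> 4 * M\<^sup>2" for i
        using power_mono[OF FM norm_ge_zero, of i _ 2] by (intro AE_I2) (simp add: power_mult_distrib)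
    qed (auto intro!: AE_I2 tendsto_intros F)
  qed
  have Uquad: "cinner (U x) x = (\<integral>t. f t \<partial>\<mu> x)" if x: "x \<in> V" for x
  proof (rule LIMSEQ_unique)
    interpret finite_measure "\<mu> x" by (rule finite_measure_\<mu>[OF x])
    show "(\<lambda>i. cinner (T i x) x) \<longlonglongrightarrow> cinner (U x) x"
      by (intro tendsto_intros U x)
    show "(\<lambda>i. cinner (T i x) x) \<longlonglongrightarrow> (\<integral>t. f t \<partial>\<mu> x)"
      unfolding quadT[OF x]
      by (rule integral_dominated_convergence[where w = "\<lambda>_. 2 * M"])
        (auto intro!: AE_I2 F simp: FM)
  qed
  have bU: "bounded_op V U"
  proof (rule bounded_opI[where K = M])
    fix x c assume x: "x \<in> V"
    show "U x \<in> V" by (rule UV[OF x])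
    interpret finite_measure "\<mu> x" by (rule finite_measure_\<mu>[OF x])
    have "(norm (U x))\<^sup>2 \<le> (\<integral>t. M\<^sup>2 \<partial>\<mu> x)"
      unfolding Unorm[OF x] by (rule integral_mono') (auto simp: M power_mono)
    also have "\<dots> = (M * norm x)\<^sup>2"
      using x by (simp add: measure_\<mu> E_UNIV power_mult_distrib)
    finally show "norm (U x) \<le> M * norm x"
      by (rule power2_le_imp_le) (use M0 in simp)
    have "(\<lambda>i. T i (scaleC c x)) \<longlonglongrightarrow> scaleC c (U x)"
      unfolding bounded_opD(3)[OF bT x] by (intro tendsto_intros U x)
    then show "U (scaleC c x) = scaleC c (U x)"
      using U[OF scaleC_mem[OF x]] LIMSEQ_unique by blast
    fix y assume y: "y \<in> V"
    have "(\<lambda>i. T i (x + y)) \<longlonglongrightarrow> U x + U y"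
      unfolding bounded_opD(2)[OF bT x y] by (intro tendsto_intros U x y)
    then show "U (x + y) = U x + U y"
      using U[OF add_mem[OF x y]] LIMSEQ_unique by blast
  qed
  show ?thesis
    using bU Uquad Unorm by (auto simp: represents_fun_def)
qed

lemma represents_fun_calc: "bounded_borel f \<Longrightarrow> represents_fun f (calc f)"
proof -
  assume "bounded_borel f"
  then have "\<exists>T. bounded_op V T \<and> (\<forall>x\<in>V. cinner (T x) x = (\<integral>t. f t \<partial>\<mu> x))"
    using represents_fun_ex[of f] by (auto simp: represents_fun_def)
  from someI_ex[OF this] show ?thesis
    by (simp add: bounded_calculus_def represents_fun_def)
qed

lemma bounded_calc: "bounded_borel f \<Longrightarrow> bounded_op V (calc f)"
  and quadratic_calc: "bounded_borel f \<Longrightarrow> x \<in> V \<Longrightarrow> cinner (calc f x) x = (\<integral>t. f t \<partial>\<mu> x)"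
  by (simp_all add: represents_fun_calc[unfolded represents_fun_def])

lemma calc_mem: "bounded_borel f \<Longrightarrow> x \<in> V \<Longrightarrow> calc f x \<in> V"
  by (rule bounded_opD(1)[OF bounded_calc])

lemma calc_eqI:
  assumes "bounded_borel f" "bounded_op V T" "\<And>x. x \<in> V \<Longrightarrow> cinner (T x) x = (\<integral>t. f t \<partial>\<mu> x)" "x \<in> V"
  shows "calc f x = T x"
  using represents_fun_unique[OF represents_fun_calc, of f T x] assms by (simp add: represents_fun_def)

lemma norm_calc: "bounded_borel f \<Longrightarrow> x \<in> V \<Longrightarrow> (norm (calc f x))\<^sup>2 = (\<integral>t. (norm (f t))\<^sup>2 \<partial>\<mu> x)"
  using represents_fun_ex[of f] represents_fun_unique[OF represents_fun_calc] by metis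

lemma calc_add: "bounded_borel f \<Longrightarrow> bounded_borel g \<Longrightarrow> x \<in> V \<Longrightarrow> calc (\<lambda>t. f t + g t) x = calc f x + calc g x"
  by (rule represents_fun_unique[OF represents_fun_calc[OF bounded_borel_add]
        represents_fun_add[OF represents_fun_calc represents_fun_calc]])

lemma calc_diff: "bounded_borel f \<Longrightarrow> bounded_borel g \<Longrightarrow> x \<in> V \<Longrightarrow> calc (\<lambda>t. f t - g t) x = calc f x - calc g x"
  by (rule represents_fun_unique[OF represents_fun_calc[OF bounded_borel_diff]
        represents_fun_diff[OF represents_fun_calc represents_fun_calc]])

lemma calc_scale: "bounded_borel f \<Longrightarrow> x \<in> V \<Longrightarrow> calc (\<lambda>t. c * f t) x = scaleC c (calc f x)"
  by (rule represents_fun_unique[OF represents_fun_calc[OF bounded_borel_scale]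
        represents_fun_scaleC[OF represents_fun_calc]])

lemma calc_indicator: "B \<in> sets borel \<Longrightarrow> x \<in> V \<Longrightarrow> calc (indicator B) x = E B x"
  by (rule represents_fun_unique[OF represents_fun_calc[OF bounded_borel_indicator] represents_fun_indicator])

lemma calc_one: "x \<in> V \<Longrightarrow> calc (\<lambda>_. 1) x = x"
  using calc_indicator[of UNIV x] E_UNIV[of x] by (simp add: indicator_def[abs_def])

lemma calc_zero: "x \<in> V \<Longrightarrow> calc (\<lambda>_. 0) x = 0"
  by (rule calc_eqI[where T = "\<lambda>x. 0"]) (auto simp: bounded_borel_const bounded_op_zero)

lemma calc_cong_AE:
  assumes f: "bounded_borel f" and g: "bounded_borel g" and x: "x \<in> V" and eq: "AE t in \<mu> x. f t = g t"
  shows "calc f x = calc g x"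
proof -
  have [measurable]: "f \<in> borel_measurable borel" "g \<in> borel_measurable borel"
    using f g by (auto simp: bounded_borel_def)
  have "(norm (calc f x - calc g x))\<^sup>2 = (\<integral>t. (norm (f t - g t))\<^sup>2 \<partial>\<mu> x)"
    using norm_calc[OF bounded_borel_diff[OF f g] x] by (simp add: calc_diff[OF f g x])
  also have "\<dots> = (\<integral>t. 0 \<partial>\<mu> x)"
    by (rule integral_cong_AE) (auto intro!: eventually_mono[OF eq])
  finally show ?thesis by simp
qed

text \<open>The isometry \<open>norm_calc\<close>, polarized: expanding the norm of a sum gives the
  real part, and replacing \<open>f\<close> by \<open>- \<i> * f\<close> the imaginary part.\<close>

lemma cinner_calc_calc:
  assumes f: "bounded_borel f" and g: "bounded_borel g" and x: "x \<in> V"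
  shows "cinner (calc f x) (calc g x) = (\<integral>t. f t * cnj (g t) \<partial>\<mu> x)"
proof -
  have [measurable]: "f \<in> borel_measurable borel" "g \<in> borel_measurable borel"
    using f g by (auto simp: bounded_borel_def)
  have re: "Re (cinner (calc f x) (calc g x)) = Re (\<integral>t. f t * cnj (g t) \<partial>\<mu> x)"
    if f: "bounded_borel f" and g: "bounded_borel g" for f g
  proof -
    have ff: "integrable (\<mu> x) (\<lambda>t. h t * cnj (k t))" if "bounded_borel h" "bounded_borel k" for h k
      by (intro integrable_bounded_borel[OF x] bounded_borel_mult bounded_borel_cnj that)
    have sq: "(\<integral>t. (norm (h t))\<^sup>2 \<partial>\<mu> x) = Re (\<integral>t. h t * cnj (h t) \<partial>\<mu> x)" if "bounded_borel h" for h
      unfolding complex_norm_square[symmetric] by (simp add: integral_complex_of_real del: of_real_power)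
    have "(norm (calc f x + calc g x))\<^sup>2 = Re (\<integral>t. (f t + g t) * cnj (f t + g t) \<partial>\<mu> x)"
      using norm_calc[OF bounded_borel_add[OF f g] x] sq[OF bounded_borel_add[OF f g]]
      by (simp only: calc_add[OF f g x])
    also have "(\<integral>t. (f t + g t) * cnj (f t + g t) \<partial>\<mu> x) =
        (\<integral>t. f t * cnj (f t) + g t * cnj (g t) + f t * cnj (g t) + g t * cnj (f t) \<partial>\<mu> x)"
      by (simp add: algebra_simps)
    also have "\<dots> = (\<integral>t. f t * cnj (f t) \<partial>\<mu> x) + (\<integral>t. g t * cnj (g t) \<partial>\<mu> x) +
        (\<integral>t. f t * cnj (g t) \<partial>\<mu> x) + (\<integral>t. g t * cnj (f t) \<partial>\<mu> x)"
      using ff[OF f f] ff[OF g g] ff[OF f g] ff[OF g f] by simp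
    also have "(\<integral>t. g t * cnj (f t) \<partial>\<mu> x) = cnj (\<integral>t. f t * cnj (g t) \<partial>\<mu> x)"
      by (simp flip: Bochner_Integration.integral_cnj add: mult.commute)
    finally have "(norm (calc f x + calc g x))\<^sup>2 =
        (norm (calc f x))\<^sup>2 + (norm (calc g x))\<^sup>2 + 2 * Re (\<integral>t. f t * cnj (g t) \<partial>\<mu> x)"
      using norm_calc[OF f x] norm_calc[OF g x] sq[OF f] sq[OF g] by simp
    then show ?thesis
      by (simp add: norm_sq_add)
  qed
  show ?thesis
  proof (rule complex_eqI)
    show "Re (cinner (calc f x) (calc g x)) = Re (\<integral>t. f t * cnj (g t) \<partial>\<mu> x)"
      by (rule re[OF f g])
    have "Re (cinner (calc (\<lambda>t. - \<i> * f t) x) (calc g x)) = Re (\<integral>t. (- \<i> * f t) * cnj (g t) \<partial>\<mu> x)"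
      by (rule re[OF bounded_borel_scale[OF f] g])
    then show "Im (cinner (calc f x) (calc g x)) = Im (\<integral>t. f t * cnj (g t) \<partial>\<mu> x)"
      by (simp only: calc_scale[OF f x] cinner_scaleC_left mult.assoc integral_mult_right_zero) simp
  qed
qed

text \<open>The forms of \<open>calc f\<close> and of the calculus at the conjugate function are
  conjugate to each other; polarization transports this to pairs \<open>x\<close>,
  \<open>y\<close>.\<close>

lemma calc_adjoint:
  assumes f: "bounded_borel f" and x: "x \<in> V" and y: "y \<in> V"
  shows "cinner (calc f x) y = cinner x (calc (\<lambda>t. cnj (f t)) y)"
proof -
  note g = bounded_borel_cnj[OF f]
  have q: "cinner (calc f z) z = cnj (cinner (calc (\<lambda>t. cnj (f t)) z) z)" if "z \<in> V" for z
    using quadratic_calc[OF f that] quadratic_calc[OF g that] by simp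
  let ?C = "calc (\<lambda>t. cnj (f t))"
  define q' where "q' z = cinner (?C z) z" for z
  have q'_scale: "q' (scaleC c z) = (c * cnj c) * q' z" if "z \<in> V" for c z
    using that by (simp add: q'_def bounded_opD(3)[OF bounded_calc[OF g]] cinner_simps)
  \<comment> \<open>Each vector in the polarization identity for \<open>x\<close>, \<open>y\<close>
    is a unimodular multiple of one in the identity for \<open>y\<close>, \<open>x\<close>, and
    \<open>q'\<close> does not see unimodular factors.\<close>
  have e1: "x - y = scaleC (- 1) (y - x)" by (simp add: minus_eq_scaleC[symmetric])
  have e2: "x + scaleC \<i> y = scaleC \<i> (y - scaleC \<i> x)"
    by (simp add: scaleC_diff_right scaleC_scaleC minus_eq_scaleC[symmetric])
  have e3: "x - scaleC \<i> y = scaleC (- \<i>) (y + scaleC \<i> x)"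
    by (simp add: scaleC_add_right scaleC_scaleC scaleC_minus_left)
  have "4 * cinner (calc f x) y = cnj (q' (x + y)) - cnj (q' (x - y))
      + \<i> * cnj (q' (x + scaleC \<i> y)) - \<i> * cnj (q' (x - scaleC \<i> y))"
    using x y by (simp only: polarization[OF bounded_calc[OF f] x y] q q'_def add_mem diff_mem scaleC_mem)
  also have "\<dots> = cnj (q' (y + x) - q' (y - x) + \<i> * q' (y + scaleC \<i> x) - \<i> * q' (y - scaleC \<i> x))"
    unfolding e1 e2 e3 using x y by (simp add: q'_scale add.commute)
  also have "\<dots> = cnj (4 * cinner (?C y) x)"
    unfolding q'_def by (simp only: polarization[OF bounded_calc[OF g] y x])
  finally have "cinner (calc f x) y = cnj (cinner (?C y) x)" by simp
  then show ?thesis by (metis cinner_commute)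
qed

lemma calc_mult:
  assumes f: "bounded_borel f" and g: "bounded_borel g" and x: "x \<in> V"
  shows "calc (\<lambda>t. f t * g t) x = calc f (calc g x)"
proof (rule calc_eqI[where T = "\<lambda>x. calc f (calc g x)", OF bounded_borel_mult[OF f g] _ _ x])
  show "bounded_op V (\<lambda>x. calc f (calc g x))"
    by (rule bounded_op_compose[OF bounded_calc[OF f] bounded_calc[OF g]])
  show "cinner (calc f (calc g y)) y = (\<integral>t. f t * g t \<partial>\<mu> y)" if y: "y \<in> V" for y
    using calc_adjoint[OF f calc_mem[OF g y] y] cinner_calc_calc[OF g bounded_borel_cnj[OF f] y]
    by (simp add: mult.commute)
qed

end

context self_adjoint_operator
begin

subsection \<open>The operator as a function of itself\<close>

lemma quadratic_integral:
  assumes "x \<in> V"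
  shows "integrable (\<mu> x) (\<lambda>t. t)" "cinner (A x) x = complex_of_real (\<integral>t. t \<partial>\<mu> x)"
  using spectral_family_resolution assms
  by (auto simp: spectral_resolution_def spectral_measure_def)

text \<open>The sign \<open>s\<close> serves upper and lower bounds at once. For
  \<open>y = E C x\<close> the function \<open>s * t - s * b\<close> is positive almost everywhere
  but has nonpositive integral, so the spectral measure at \<open>y\<close> is zero.\<close>

lemma E_vanishes_if_quadratic:
  assumes C: "C \<in> sets borel" and x: "x \<in> V"
    and quad: "\<And>y. y \<in> V \<Longrightarrow> s * Re (cinner (A y) y) \<le> s * b * (norm y)\<^sup>2"
    and sep: "\<And>t. t \<in> C \<Longrightarrow> s * b < s * t"
  shows "E C x = 0"
proof -
  define y where "y = E C x"
  have y: "y \<in> V" using C x by (simp add: y_def E_mem)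
  interpret finite_measure "\<mu> y" by (rule finite_measure_\<mu>[OF y])
  have "E {t. \<not> t \<in> C} y = 0"
    using C x borel_comp[OF C] E_empty[OF x]
    by (simp add: y_def E_Int Collect_neg_eq)
  then have AE: "AE t in \<mu> y. t \<in> C"
    using AE_\<mu>_iff[OF y, of "\<lambda>t. t \<in> C"] C by simp
  have int: "integrable (\<mu> y) (\<lambda>t. s * t - s * b)"
    using quadratic_integral(1)[OF y] by (intro Bochner_Integration.integrable_diff) auto
  have pos: "AE t in \<mu> y. 0 \<le> s * t - s * b"
    by (rule eventually_mono[OF AE]) (use sep in \<open>simp add: less_imp_le\<close>)
  have "(\<integral>t. s * t - s * b \<partial>\<mu> y) = s * Re (cinner (A y) y) - s * b * (norm y)\<^sup>2"
    using quadratic_integral[OF y] by (simp add: measure_\<mu>[OF y] E_UNIV[OF y])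
  then have "(\<integral>t. s * t - s * b \<partial>\<mu> y) \<le> 0" using quad[OF y] by simp
  then have "(\<integral>t. s * t - s * b \<partial>\<mu> y) = 0"
    using integral_nonneg_AE[OF pos] by simp
  then have "AE t in \<mu> y. s * t - s * b = 0"
    using integral_nonneg_eq_0_iff_AE[OF int pos] by simp
  then have "AE t in \<mu> y. False"
    using AE by eventually_elim (use sep in force)
  then have "E UNIV y = 0"
    using AE_\<mu>_iff[OF y, of "\<lambda>t. False"] by simp
  then show ?thesis
    using y by (simp add: E_UNIV) (simp add: y_def)
qed

lemma AE_spectral_le:
  assumes "x \<in> V" "\<And>y. y \<in> V \<Longrightarrow> Re (cinner (A y) y) \<le> b * (norm y)\<^sup>2"
  shows "AE t in \<mu> x. t \<le> b"
proof -
  have "E {b<..} x = 0"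
    by (rule E_vanishes_if_quadratic[where s = 1 and b = b]) (use assms in auto)
  then show ?thesis
    using AE_\<mu>_iff[OF assms(1), of "\<lambda>t. t \<le> b"] by (simp add: not_le greaterThan_def)
qed

lemma AE_spectral_ge:
  assumes "x \<in> V" "\<And>y. y \<in> V \<Longrightarrow> b * (norm y)\<^sup>2 \<le> Re (cinner (A y) y)"
  shows "AE t in \<mu> x. b \<le> t"
proof -
  have "E {..<b} x = 0"
    by (rule E_vanishes_if_quadratic[where s = "-1" and b = b]) (use assms in auto)
  then show ?thesis
    using AE_\<mu>_iff[OF assms(1), of "\<lambda>t. b \<le> t"] by (simp add: not_le lessThan_def)
qed

definition spectral_bound :: real where
  "spectral_bound = (SOME K. \<forall>x\<in>V. AE t in \<mu> x. \<bar>t\<bar> \<le> K)"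

lemma AE_spectral_bound: "x \<in> V \<Longrightarrow> AE t in \<mu> x. \<bar>t\<bar> \<le> spectral_bound"
proof -
  assume "x \<in> V"
  obtain K where K: "K > 0" "\<And>x. x \<in> V \<Longrightarrow> norm (A x) \<le> K * norm x"
    using bounded_op_bound[OF bounded] by blast
  have Kq: "\<bar>Re (cinner (A x) x)\<bar> \<le> K * (norm x)\<^sup>2" if "x \<in> V" for x
  proof -
    have "\<bar>Re (cinner (A x) x)\<bar> \<le> norm (A x) * norm x"
      using norm_cinner_le[of "A x" x] abs_Re_le_cmod order_trans by blast
    also have "\<dots> \<le> K * norm x * norm x" using K(2)[OF that] by (intro mult_right_mono) auto
    finally show ?thesis by (simp add: power2_eq_square mult.assoc)
  qed
  have "AE t in \<mu> x. \<bar>t\<bar> \<le> K" if "x \<in> V" for x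
  proof -
    have "AE t in \<mu> x. t \<le> K"
      by (rule AE_spectral_le[OF that]) (use Kq in \<open>auto simp: abs_le_iff\<close>)
    moreover have "AE t in \<mu> x. - K \<le> t"
      by (rule AE_spectral_ge[OF that]) (use Kq in \<open>force simp: abs_le_iff\<close>)
    ultimately show ?thesis by eventually_elim auto
  qed
  then have "\<exists>K. \<forall>x\<in>V. AE t in \<mu> x. \<bar>t\<bar> \<le> K" by blast
  then have "\<forall>x\<in>V. AE t in \<mu> x. \<bar>t\<bar> \<le> spectral_bound"
    unfolding spectral_bound_def by (rule someI_ex)
  then show ?thesis using \<open>x \<in> V\<close> by blast
qed

text \<open>The identity function is unbounded and thus outside the bounded calculus. Cutting it off
  at a bound common to all spectral measures changes it on null sets only.\<close>

definition spectral_id :: "real \<Rightarrow> complex" where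
  "spectral_id t = (if \<bar>t\<bar> \<le> spectral_bound then complex_of_real t else 0)"

lemma measurable_spectral_id [measurable]: "spectral_id \<in> borel_measurable borel"
  unfolding spectral_id_def[abs_def] by measurable

lemma bounded_borel_spectral_id: "bounded_borel spectral_id"
  by (rule bounded_borelI[where M = "\<bar>spectral_bound\<bar>"]) (auto simp: spectral_id_def)

lemma AE_spectral_id: "x \<in> V \<Longrightarrow> AE t in \<mu> x. spectral_id t = complex_of_real t"
  by (rule eventually_mono[OF AE_spectral_bound]) (auto simp: spectral_id_def)

lemma calc_spectral_id:
  assumes x: "x \<in> V"
  shows "calc spectral_id x = A x"
proof (rule calc_eqI[OF bounded_borel_spectral_id bounded _ x])
  fix y assume y: "y \<in> V"
  have "(\<integral>t. spectral_id t \<partial>\<mu> y) = (\<integral>t. complex_of_real t \<partial>\<mu> y)"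
    by (rule integral_cong_AE) (use AE_spectral_id[OF y] in auto)
  then show "cinner (A y) y = (\<integral>t. spectral_id t \<partial>\<mu> y)"
    by (simp add: quadratic_integral(2)[OF y] integral_complex_of_real)
qed

lemma bounded_borel_power: "bounded_borel f \<Longrightarrow> bounded_borel (\<lambda>t. f t ^ n)"
  by (induction n) (auto simp: bounded_borel_const bounded_borel_mult)

lemma funpow_mem: "x \<in> V \<Longrightarrow> (A ^^ n) x \<in> V"
  by (rule bounded_opD(1)[OF bounded_op_funpow[OF bounded]])

lemma calc_spectral_id_power:
  assumes x: "x \<in> V"
  shows "calc (\<lambda>t. spectral_id t ^ n) x = (A ^^ n) x"
proof (induction n)
  case 0
  show ?case by (simp add: calc_one[OF x])
next
  case (Suc n)
  have "calc (\<lambda>t. spectral_id t * spectral_id t ^ n) x = calc spectral_id (calc (\<lambda>t. spectral_id t ^ n) x)"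
    by (rule calc_mult[OF bounded_borel_spectral_id bounded_borel_power[OF bounded_borel_spectral_id] x])
  then show ?case
    by (simp add: Suc calc_spectral_id funpow_mem[OF x])
qed

lemma calc_commute:
  assumes f: "bounded_borel f" and x: "x \<in> V"
  shows "A (calc f x) = calc f (A x)"
proof -
  have "A (calc f x) = calc (\<lambda>t. spectral_id t * f t) x"
    using calc_mult[OF bounded_borel_spectral_id f x] by (simp add: calc_spectral_id calc_mem f x)
  also have "(\<lambda>t. spectral_id t * f t) = (\<lambda>t. f t * spectral_id t)"
    by (simp add: mult.commute)
  also have "calc \<dots> x = calc f (A x)"
    using calc_mult[OF f bounded_borel_spectral_id x] by (simp add: calc_spectral_id x)
  finally show ?thesis .
qed

lemma moment:
  assumes x: "x \<in> V"
  shows "complex_of_real (\<integral>t. t ^ n \<partial>\<mu> x) = cinner ((A ^^ n) x) x"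
proof -
  have "cinner ((A ^^ n) x) x = (\<integral>t. spectral_id t ^ n \<partial>\<mu> x)"
    using quadratic_calc[OF bounded_borel_power[OF bounded_borel_spectral_id] x]
    by (simp add: calc_spectral_id_power[OF x])
  also have "\<dots> = (\<integral>t. complex_of_real (t ^ n) \<partial>\<mu> x)"
    by (rule integral_cong_AE) (auto intro!: eventually_mono[OF AE_spectral_id[OF x]])
  finally show ?thesis by (simp add: integral_complex_of_real del: of_real_power)
qed

text \<open>The squared norm of \<open>A x\<close> is the integral of the square of
  \<open>t\<close>, so it vanishes exactly when the spectral measure at \<open>x\<close> is carried
  by the point 0.\<close>

lemma E_kernel:
  assumes x: "x \<in> V"
  shows "A x = 0 \<longleftrightarrow> E {0} x = x"
proof
  assume "A x = 0"
  then have 0: "(\<integral>t. (norm (spectral_id t))\<^sup>2 \<partial>\<mu> x) = 0"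
    using norm_calc[OF bounded_borel_spectral_id x] by (simp add: calc_spectral_id x)
  interpret finite_measure "\<mu> x" by (rule finite_measure_\<mu>[OF x])
  have "integrable (\<mu> x) (\<lambda>t. (norm (spectral_id t))\<^sup>2)"
    by (rule integrable_const_bound[where B = "spectral_bound\<^sup>2"])
      (auto simp: spectral_id_def abs_le_square_iff[symmetric])
  then have "AE t in \<mu> x. (norm (spectral_id t))\<^sup>2 = 0"
    using 0 by (subst (asm) integral_nonneg_eq_0_iff_AE) auto
  then have "AE t in \<mu> x. t = 0"
    using AE_spectral_id[OF x] by eventually_elim auto
  then have "E {t. t \<noteq> 0} x = 0"
    using AE_\<mu>_iff[OF x, of "\<lambda>t. t = 0"] by simp
  moreover have "E ({0} \<union> {t. t \<noteq> 0}) x = E {0} x + E {t. t \<noteq> 0} x"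
    by (rule E_Un[OF _ _ _ x]) auto
  moreover have "{0} \<union> {t. t \<noteq> (0::real)} = UNIV" by auto
  ultimately show "E {0} x = x"
    using E_UNIV[OF x] by simp
next
  assume *: "E {0} x = x"
  have "A x = calc spectral_id (calc (indicator {0}) x)"
    using * x by (simp add: calc_indicator calc_spectral_id)
  also have "\<dots> = calc (\<lambda>t. spectral_id t * indicator {0} t) x"
    by (rule calc_mult[symmetric, OF bounded_borel_spectral_id bounded_borel_indicator x]) simp
  also have "(\<lambda>t. spectral_id t * indicator {0} t) = (\<lambda>t. 0)"
    by (auto simp: spectral_id_def indicator_def)
  finally show "A x = 0" by (simp add: calc_zero x)
qed

text \<open>Beyond level \<open>N\<close> all truncations agree almost everywhere, so the limit is
  eventually constant. Only an almost-everywhere bound is asked for, since a phase function is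
  controlled no better than that.\<close>

lemma borel_calculus_eq_calc:
  assumes f: "f \<in> borel_measurable borel" and N: "0 \<le> N" and x: "x \<in> V"
    and AE: "AE t in \<mu> x. norm (f t) \<le> N"
  shows "borel_calculus V A f x = calc (\<lambda>t. if norm (f t) \<le> N then f t else 0) x"
  unfolding borel_calculus_def
proof (intro limI tendsto_eventually eventually_sequentiallyI[of "nat \<lceil>N\<rceil>"])
  fix n assume "nat \<lceil>N\<rceil> \<le> n"
  then have n: "N \<le> real n" by linarith
  show "calc (\<lambda>t. if norm (f t) \<le> real n then f t else 0) x = calc (\<lambda>t. if norm (f t) \<le> N then f t else 0) x"
    by (rule calc_cong_AE[OF bounded_borel_truncate bounded_borel_truncate x])
      (use f N n in \<open>auto intro!: eventually_mono[OF AE]\<close>)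
qed

lemma borel_calculus_bounded:
  assumes f: "bounded_borel f" and x: "x \<in> V"
  shows "borel_calculus V A f x = calc f x"
proof -
  obtain M where M: "\<And>t. norm (f t) \<le> M" using f by (auto simp: bounded_borel_def)
  have "0 \<le> M" using M[of 0] norm_ge_zero order_trans by blast
  then show ?thesis
    using borel_calculus_eq_calc[of f M x] f x M by (simp add: bounded_borel_def)
qed

end

section \<open>Uniqueness of the spectral measure\<close>

text \<open>Truncated multiples of the distance to the complement increase to the indicator of an
  open set, and open sets form a generator stable under intersection.\<close>

lemma finite_measure_eqI_continuous:
  fixes M N :: "'a::metric_space measure"
  assumes M: "finite_measure M" "sets M = sets borel" and N: "finite_measure N" "sets N = sets borel"
    and eq: "\<And>g :: 'a \<Rightarrow> real. continuous_on UNIV g \<Longrightarrow> (\<And>x. 0 \<le> g x \<and> g x \<le> 1) \<Longrightarrow> integral\<^sup>L M g = integral\<^sup>L N g"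
  shows "M = N"
proof -
  interpret M: finite_measure M by fact
  interpret N: finite_measure N by fact
  have [measurable_cong]: "sets M = sets borel" "sets N = sets borel" by fact+
  have sp: "space M = UNIV" "space N = UNIV"
    using sets_eq_imp_space_eq[OF M(2)] sets_eq_imp_space_eq[OF N(2)] by auto
  have eq_open: "measure M U = measure N U" if U: "open U" for U
  proof (cases "U = UNIV")
    \<comment> \<open>Separate because \<open>infdist\<close> to the empty set is 0 by convention,
      so the cut-offs used otherwise would vanish identically.\<close>
    case True
    have "integral\<^sup>L M (\<lambda>_. 1::real) = integral\<^sup>L N (\<lambda>_. 1)"
      by (rule eq) auto
    then show ?thesis using True by (simp add: sp)
  next
    case False
    have [measurable]: "U \<in> sets borel" by (rule borel_open[OF U])
    define g where "g n x = min 1 (real n * infdist x (- U))" for n x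
    have cont: "continuous_on UNIV (g n)" for n
      unfolding g_def by (intro continuous_intros)
    then have [measurable]: "g n \<in> borel_measurable borel" for n
      by (rule borel_measurable_continuous_onI)
    have g01: "0 \<le> g n x \<and> g n x \<le> 1" for n x
      by (auto simp: g_def infdist_nonneg)
    have lim: "(\<lambda>n. g n x) \<longlonglongrightarrow> indicator U x" for x
    proof (cases "x \<in> U")
      case True
      have "infdist x (- U) \<noteq> 0"
        using in_closed_iff_infdist_zero[of "- U" x] U False True by (auto simp: closed_def)
      then have pos: "0 < infdist x (- U)"
        using infdist_nonneg[of x "- U"] by simp
      then obtain k where k: "1 \<le> real k * infdist x (- U)"
        using reals_Archimedean3[OF pos] less_imp_le by metis
      have "g n x = 1" if "k \<le> n" for n
      proof -
        have "real k * infdist x (- U) \<le> real n * infdist x (- U)"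
          using that pos by (intro mult_right_mono) auto
        then show ?thesis using k by (simp add: g_def)
      qed
      then show ?thesis
        using True by (intro tendsto_eventually eventually_sequentiallyI[of k]) auto
    next
      case False
      then show ?thesis by (simp add: g_def infdist_zero)
    qed
    have conv: "(\<lambda>n. integral\<^sup>L L (g n)) \<longlonglongrightarrow> measure L U"
      if L: "finite_measure L" and sL [measurable_cong]: "sets L = sets borel" for L
    proof -
      interpret L: finite_measure L by fact
      have spL: "space L = UNIV" using sets_eq_imp_space_eq[OF sL] by simp
      have "(\<lambda>n. integral\<^sup>L L (g n)) \<longlonglongrightarrow> integral\<^sup>L L (indicator U :: 'a \<Rightarrow> real)"
        by (rule integral_dominated_convergence[where w = "\<lambda>_. 1"])
          (use g01 lim U in \<open>auto simp: abs_le_iff intro: order_trans[of _ 0]\<close>)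
      then show ?thesis using U by (simp add: spL)
    qed
    have "(\<lambda>n. integral\<^sup>L M (g n)) = (\<lambda>n. integral\<^sup>L N (g n))"
      using eq[OF cont g01] by auto
    then show ?thesis
      using conv[OF M] conv[OF N] LIMSEQ_unique by metis
  qed
  show ?thesis
  proof (rule measure_eqI_generator_eq[where \<Omega> = UNIV and E = "{S. open S}" and A = "\<lambda>_. UNIV"])
    show "Int_stable {S :: 'a set. open S}" by (auto simp: Int_stable_def)
    show "sets M = sigma_sets UNIV {S. open S}" "sets N = sigma_sets UNIV {S. open S}"
      by (auto simp: M N borel_def)
    show "emeasure M X = emeasure N X" if "X \<in> {S. open S}" for X
      using eq_open that by (simp add: M.emeasure_eq_measure N.emeasure_eq_measure)
  qed auto
qed

text \<open>Stone-Weierstrass on a compact set carrying both measures. It serves twice: on the line,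
  to compare spectral measures by moments, and in the plane, to show that Fourier coefficients
  determine a function.\<close>

lemma finite_measure_eqI_polynomial:
  fixes M N :: "'a::euclidean_space measure"
  assumes M: "finite_measure M" "sets M = sets borel" and N: "finite_measure N" "sets N = sets borel"
    and S: "compact S" "AE x in M. x \<in> S" "AE x in N. x \<in> S"
    and eq: "\<And>p. real_polynomial_function p \<Longrightarrow> integral\<^sup>L M p = integral\<^sup>L N p"
  shows "M = N"
proof (rule finite_measure_eqI_continuous[OF M N])
  fix g :: "'a \<Rightarrow> real" assume g: "continuous_on UNIV g"
  have approx: "\<bar>integral\<^sup>L L g - integral\<^sup>L L p\<bar> \<le> e * measure L (space L)"
    if L: "finite_measure L" and sL [measurable_cong]: "sets L = sets borel" and SL: "AE x in L. x \<in> S"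
      and p: "continuous_on UNIV p" and pg: "\<And>x. x \<in> S \<Longrightarrow> \<bar>g x - p x\<bar> < e" for L p e
  proof -
    interpret L: finite_measure L by fact
    have int: "integrable L h" if h: "continuous_on UNIV h" for h :: "'a \<Rightarrow> real"
    proof -
      have [measurable]: "h \<in> borel_measurable borel" by (rule borel_measurable_continuous_onI[OF h])
      have "bounded (h ` S)"
        using S(1) h compact_continuous_image continuous_on_subset compact_imp_bounded by blast
      then obtain B where "\<And>x. x \<in> S \<Longrightarrow> norm (h x) \<le> B" by (auto simp: bounded_iff)
      then show ?thesis
        by (intro L.integrable_const_bound[where B = B]) (auto intro!: eventually_mono[OF SL])
    qed
    have "\<bar>integral\<^sup>L L g - integral\<^sup>L L p\<bar> = norm (\<integral>x. g x - p x \<partial>L)"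
      using int[OF g] int[OF p] by simp
    also have "\<dots> \<le> (\<integral>x. norm (g x - p x) \<partial>L)" by (rule integral_norm_bound)
    also have "\<dots> \<le> (\<integral>x. e \<partial>L)"
      by (rule integral_mono_AE) (use int[OF g] int[OF p] pg in \<open>auto intro!: eventually_mono[OF SL] less_imp_le\<close>)
    finally show ?thesis by (simp add: mult.commute)
  qed
  define m where "m = measure M (space M) + measure N (space N)"
  have m: "0 \<le> m" by (simp add: m_def)
  have le: "\<bar>integral\<^sup>L M g - integral\<^sup>L N g\<bar> \<le> e * m" if e: "0 < e" for e
  proof -
    obtain p where p: "real_polynomial_function p" and pg: "\<And>x. x \<in> S \<Longrightarrow> \<bar>g x - p x\<bar> < e"
      using Stone_Weierstrass_real_polynomial_function[OF S(1) continuous_on_subset[OF g subset_UNIV] e] by blast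
    have pc: "continuous_on UNIV p"
      using p continuous_real_polymonial_function continuous_at_imp_continuous_on by blast
    have "\<bar>integral\<^sup>L M g - integral\<^sup>L N g\<bar> \<le>
        \<bar>integral\<^sup>L M g - integral\<^sup>L M p\<bar> + \<bar>integral\<^sup>L N g - integral\<^sup>L N p\<bar>"
      using eq[OF p] by linarith
    then show ?thesis
      using approx[OF M S(2) pc pg] approx[OF N S(3) pc pg] by (simp add: m_def distrib_left)
  qed
  have "\<bar>integral\<^sup>L M g - integral\<^sup>L N g\<bar> \<le> 0"
  proof (rule field_le_epsilon)
    fix e :: real assume e: "0 < e"
    \<comment> \<open>\<open>m + 1\<close> instead of \<open>m\<close>, since both measures may be
      zero.\<close>
    have "e / (m + 1) * m \<le> e"
      using e m by (simp add: field_simps)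
    then show "\<bar>integral\<^sup>L M g - integral\<^sup>L N g\<bar> \<le> 0 + e"
      using le[of "e / (m + 1)"] e m by simp
  qed
  then show "integral\<^sup>L M g = integral\<^sup>L N g" by simp
qed

text \<open>Spectral families on \<open>V\<close> and on \<open>K\<close> are independent choices,
  so not even their values on vectors of \<open>V\<close> are related by definition. The moments
  \<open>cinner ((A ^^ n) x) x\<close> are common to both and determine a compactly supported
  measure.\<close>

locale operator_extension = V: self_adjoint_operator V A + K: self_adjoint_operator K B
  for V :: "'a::complex_inner set" and A and K :: "'a set" and B +
  assumes subset: "V \<subseteq> K" and extends: "\<And>x. x \<in> V \<Longrightarrow> B x = A x"
begin

lemma funpow_extends: "x \<in> V \<Longrightarrow> (B ^^ n) x = (A ^^ n) x"
  by (induction n) (auto simp: extends V.funpow_mem)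

lemma spectral_measure_extends:
  assumes x: "x \<in> V"
  shows "K.\<mu> x = V.\<mu> x"
proof -
  have xK: "x \<in> K" using x subset by blast
  define b where "b = max V.spectral_bound K.spectral_bound"
  have V: "AE t in V.\<mu> x. t \<in> {-b..b}"
    using V.AE_spectral_bound[OF x] by (rule eventually_mono) (auto simp: b_def)
  have K: "AE t in K.\<mu> x. t \<in> {-b..b}"
    using K.AE_spectral_bound[OF xK] by (rule eventually_mono) (auto simp: b_def)
  have int: "integrable M (\<lambda>t. t ^ n)"
    if M: "finite_measure M" "AE t in M. t \<in> {-b..b}" and [measurable_cong]: "sets M = sets borel"
    for M :: "real measure" and n
  proof -
    interpret finite_measure M by fact
    show ?thesis
    proof (rule integrable_const_bound[where B = "b ^ n"])
      show "AE t in M. norm (t ^ n) \<le> b ^ n"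
        using M(2) by (rule eventually_mono) (auto simp: power_abs intro!: power_mono)
    qed measurable
  qed
  note fV = V.finite_measure_\<mu>[OF x] and fK = K.finite_measure_\<mu>[OF xK]
  have mom: "(\<integral>t. t ^ n \<partial>K.\<mu> x) = (\<integral>t. t ^ n \<partial>V.\<mu> x)" for n
    using V.moment[OF x, of n] K.moment[OF xK, of n] by (simp add: funpow_extends[OF x])
      (metis of_real_eq_iff)
  show ?thesis
  proof (rule finite_measure_eqI_polynomial[OF fK _ fV _ compact_Icc K V])
    fix p :: "real \<Rightarrow> real" assume "real_polynomial_function p"
    then obtain a n where p: "p = (\<lambda>t. \<Sum>i\<le>n. a i * t ^ i)"
      by (auto simp: real_polynomial_function_iff_sum)
    show "integral\<^sup>L (K.\<mu> x) p = integral\<^sup>L (V.\<mu> x) p"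
      using int[OF fK K] int[OF fV V] by (simp add: p mom)
  qed auto
qed

text \<open>Equal spectral measures yield equality only when tested against \<open>V\<close>, and
  \<open>K.calc f x\<close> might a priori leave \<open>V\<close>. Its norm equals that of
  \<open>V.calc f x\<close>, which rules out a component orthogonal to \<open>V\<close>.\<close>

lemma calc_extends:
  assumes f: "bounded_borel f" and x: "x \<in> V"
  shows "K.calc f x = V.calc f x"
proof -
  have xK: "x \<in> K" using x subset by blast
  have VK: "y \<in> K" if "y \<in> V" for y using that subset by blast
  have quad: "cinner (K.calc f y) y = cinner (V.calc f y) y" if "y \<in> V" for y
    using V.quadratic_calc[OF f that] K.quadratic_calc[OF f VK[OF that]]
    by (simp add: spectral_measure_extends[OF that])
  have weak: "cinner (K.calc f x) y = cinner (V.calc f x) y" if y: "y \<in> V" for y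
  proof -
    have "4 * cinner (K.calc f x) y = 4 * cinner (V.calc f x) y"
      using x y
      by (simp only: K.polarization[OF K.bounded_calc[OF f] xK VK[OF y]]
          V.polarization[OF V.bounded_calc[OF f] x y] quad V.add_mem V.diff_mem V.scaleC_mem)
    then show ?thesis by simp
  qed
  have "norm (K.calc f x) = norm (V.calc f x)"
    using V.norm_calc[OF f x] K.norm_calc[OF f xK] spectral_measure_extends[OF x]
    by (metis norm_ge_zero power2_eq_imp_eq)
  moreover have "cinner (K.calc f x) (V.calc f x) = cinner (V.calc f x) (V.calc f x)"
    by (rule weak[OF V.calc_mem[OF f x]])
  ultimately have "(norm (K.calc f x - V.calc f x))\<^sup>2 = 0"
    by (simp add: norm_sq_diff cinner_self)
  then show ?thesis by simp
qed

lemma borel_calculus_extends: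
  assumes "f \<in> borel_measurable borel" "x \<in> V"
  shows "borel_calculus K B f x = borel_calculus V A f x"
  unfolding borel_calculus_def
  using calc_extends[OF bounded_borel_truncate[OF assms(1)] assms(2)] by simp

end

section \<open>Cyclic vectors\<close>

lemma cyclic_vector_approx:
  assumes "cyclic_vector V A v" "x \<in> V"
  obtains N :: "nat \<Rightarrow> nat" and c :: "nat \<Rightarrow> nat \<Rightarrow> complex"
  where "(\<lambda>j. \<Sum>n<N j. scaleC (c j n) ((A ^^ n) v)) \<longlonglongrightarrow> x"
proof -
  let ?S = "{\<Sum>n<N. scaleC (c n) ((A ^^ n) v) | (N::nat) (c::nat \<Rightarrow> complex). True}"
  have "x \<in> closure ?S"
    using assms by (simp add: cyclic_vector_def)
  then obtain y where y: "\<And>j. y j \<in> ?S" "y \<longlonglongrightarrow> x"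
    unfolding closure_sequential by blast
  have "\<forall>j. \<exists>N c. y j = (\<Sum>n<N. scaleC (c n) ((A ^^ n) v))"
    using y(1) by blast
  then obtain N c where "\<And>j. y j = (\<Sum>n<N j. scaleC (c j n) ((A ^^ n) v))"
    by metis
  then have "y = (\<lambda>j. \<Sum>n<N j. scaleC (c j n) ((A ^^ n) v))" by auto
  then show thesis using that y(2) by blast
qed

context hilbert_subspace
begin

text \<open>\<open>C\<close> lives on a larger space \<open>K\<close> because operators on
  \<open>H2\<close> will be tested on the cyclic subspace \<open>ran_H u\<close>, which they are not
  assumed to preserve.\<close>

lemma cyclic_vector_bounded_op_eq_0:
  assumes C: "bounded_op K C" and K: "hilbert_subspace K" "V \<subseteq> K"
    and v: "cyclic_vector V A v" and A: "\<And>x. x \<in> V \<Longrightarrow> A x \<in> V"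
    and 0: "\<And>n. C ((A ^^ n) v) = 0" and x: "x \<in> V"
  shows "C x = 0"
proof -
  interpret K: hilbert_subspace K by fact
  obtain N c where lim: "(\<lambda>j. \<Sum>n<N j. scaleC (c j n) ((A ^^ n) v)) \<longlonglongrightarrow> x"
    using cyclic_vector_approx[OF v x] .
  have vV: "v \<in> V" using v by (simp add: cyclic_vector_def)
  have AV: "(A ^^ n) v \<in> V" for n
    by (induction n) (auto simp: vV A)
  then have AK: "(A ^^ n) v \<in> K" for n using K by blast
  have "(\<lambda>j. C (\<Sum>n<N j. scaleC (c j n) ((A ^^ n) v))) \<longlonglongrightarrow> C x"
    using x K by (intro K.bounded_op_tendsto[OF C _ _ lim]) (auto simp: AK)
  moreover have "C (\<Sum>n<N j. scaleC (c j n) ((A ^^ n) v)) = 0" for j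
    by (subst K.bounded_op_sum[OF C]) (auto simp: AK 0 bounded_opD(3)[OF C])
  ultimately show ?thesis by (simp add: LIMSEQ_const_iff)
qed

lemma cyclic_vector_orthogonal_eq_0:
  assumes v: "cyclic_vector V A v" and y: "y \<in> V" "\<And>n. cinner y ((A ^^ n) v) = 0"
  shows "y = 0"
proof -
  obtain N c where lim: "(\<lambda>j. \<Sum>n<N j. scaleC (c j n) ((A ^^ n) v)) \<longlonglongrightarrow> y"
    using cyclic_vector_approx[OF v y(1)] .
  have "(\<lambda>j. cinner y (\<Sum>n<N j. scaleC (c j n) ((A ^^ n) v))) \<longlonglongrightarrow> cinner y y"
    by (intro tendsto_intros lim)
  moreover have "cinner y (\<Sum>n<N j. scaleC (c j n) ((A ^^ n) v)) = 0" for j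
    by (simp add: cinner_sum_right cinner_scaleC_right y)
  ultimately show ?thesis by (simp add: LIMSEQ_const_iff)
qed

lemma cinner_funpow:
  assumes A: "self_adjoint_op V A" and "x \<in> V" "y \<in> V"
  shows "cinner ((A ^^ n) x) y = cinner x ((A ^^ n) y)"
  by (rule self_adjoint_opD(2)[OF self_adjoint_op_funpow[OF A] assms(2,3)])

lemma funpow_commute:
  assumes "\<And>x. x \<in> V \<Longrightarrow> A x \<in> V" "\<And>x. x \<in> V \<Longrightarrow> S x \<in> V"
    and "\<And>x. x \<in> V \<Longrightarrow> S (A x) = A (S x)" "x \<in> V"
  shows "S ((A ^^ n) x) = (A ^^ n) (S x) \<and> (A ^^ n) x \<in> V"
  using assms(4) by (induction n) (auto simp: assms)

text \<open>For a self-adjoint \<open>R\<close> commuting with \<open>A\<close>, all \<open>\<langle>R v, A\<^sup>n v\<rangle>\<close> are real, so \<open>R v\<close> is already a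
  limit of polynomials in \<open>A\<close> with real coefficients applied to \<open>v\<close>.\<close>

lemma commutant_real_approx:
  assumes A: "self_adjoint_op V A" and v: "cyclic_vector V A v"
    and R: "self_adjoint_op V R" "\<And>x. x \<in> V \<Longrightarrow> R (A x) = A (R x)"
  obtains N :: "nat \<Rightarrow> nat" and r :: "nat \<Rightarrow> nat \<Rightarrow> real"
  where "(\<lambda>j. \<Sum>n<N j. r j n *\<^sub>R (A ^^ n) v) \<longlonglongrightarrow> R v"
proof -
  note bA = self_adjoint_opD(1)[OF A] and bR = self_adjoint_opD(1)[OF R(1)]
  have vV: "v \<in> V" using v by (simp add: cyclic_vector_def)
  have AV: "(A ^^ n) v \<in> V" for n
    by (rule bounded_opD(1)[OF bounded_op_funpow[OF bA] vV])
  have AR: "R ((A ^^ n) v) = (A ^^ n) (R v)" for n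
    using funpow_commute[of A R v n] bA bR R(2) vV by (simp add: bounded_opD)
  have real_RA: "Im (cinner (R v) ((A ^^ n) v)) = 0" for n
  proof -
    have "cinner (R v) ((A ^^ n) v) = cinner ((A ^^ n) v) (R v)"
      using self_adjoint_opD(2)[OF R(1) vV AV] cinner_funpow[OF A vV bounded_opD(1)[OF bR vV]]
      by (simp add: AR)
    then show ?thesis
      by (metis cinner_commute cnj.simps(2) eq_neg_iff_add_eq_0 equal_neg_zero)
  qed
  have real_AA: "Im (cinner ((A ^^ m) v) ((A ^^ n) v)) = 0" for m n
  proof -
    have "cinner ((A ^^ m) v) ((A ^^ n) v) = cinner ((A ^^ (n + m)) v) v"
      using cinner_funpow[OF A AV vV, of n m] by (simp add: funpow_add)
    also have "\<dots> = complex_of_real (Re (cinner ((A ^^ (n + m)) v) v))"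
      by (rule self_adjoint_quadratic_real[OF self_adjoint_op_funpow[OF A] vV])
    finally show ?thesis by (metis Im_complex_of_real)
  qed
  obtain N c where lim: "(\<lambda>j. \<Sum>n<N j. scaleC (c j n) ((A ^^ n) v)) \<longlonglongrightarrow> R v"
    using cyclic_vector_approx[OF v bounded_opD(1)[OF bR vV]] .
  define a where "a j = (\<Sum>n<N j. Re (c j n) *\<^sub>R (A ^^ n) v)" for j
  define b where "b j = (\<Sum>n<N j. Im (c j n) *\<^sub>R (A ^^ n) v)" for j
  have ab: "(\<Sum>n<N j. scaleC (c j n) ((A ^^ n) v)) = a j + scaleC \<i> (b j)" for j
  proof -
    have "scaleC (c j n) w = Re (c j n) *\<^sub>R w + scaleC \<i> (Im (c j n) *\<^sub>R w)" for n and w :: 'a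
      by (simp add: scaleR_eq_scaleC scaleC_scaleC scaleC_add_left[symmetric] complex_eq[symmetric])
    then show ?thesis
      by (simp add: a_def b_def scaleC_sum_right sum.distrib)
  qed
  \<comment> \<open>\<open>R v - a j\<close> and \<open>b j\<close> have a real inner product, so
    \<open>scaleC \<i> (b j)\<close> is orthogonal to \<open>R v - a j\<close> in the real sense; by
    Pythagoras dropping it only improves the approximation.\<close>
  have le: "norm (R v - a j) \<le> norm (R v - (a j + scaleC \<i> (b j)))" for j
  proof -
    have "Im (cinner (R v - a j) (b j)) = 0"
      by (simp add: a_def b_def cinner_diff_left cinner_sum_left cinner_sum_right scaleR_eq_scaleC
          cinner_scaleC_left cinner_scaleC_right real_RA real_AA)
    then have "Re (cinner (R v - a j) (scaleC \<i> (b j))) = 0"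
      by (simp add: cinner_scaleC_right)
    then have "(norm (R v - a j - scaleC \<i> (b j)))\<^sup>2 = (norm (R v - a j))\<^sup>2 + (norm (scaleC \<i> (b j)))\<^sup>2"
      by (simp add: norm_sq_diff)
    then have "(norm (R v - a j))\<^sup>2 \<le> (norm (R v - a j - scaleC \<i> (b j)))\<^sup>2" by simp
    from power2_le_imp_le[OF this] show ?thesis
      by (simp add: diff_diff_eq)
  qed
  have "(\<lambda>j. norm (R v - (a j + scaleC \<i> (b j)))) \<longlonglongrightarrow> norm (R v - R v)"
    by (intro tendsto_intros lim[unfolded ab])
  then have "(\<lambda>j. norm (R v - (a j + scaleC \<i> (b j)))) \<longlonglongrightarrow> 0" by simp
  then have "(\<lambda>j. R v - a j) \<longlonglongrightarrow> 0"
    by (rule Lim_null_comparison[rotated]) (simp add: le)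
  then have "(\<lambda>j. R v - (R v - a j)) \<longlonglongrightarrow> R v - 0"
    by (intro tendsto_intros)
  then have "a \<longlonglongrightarrow> R v" by simp
  then show thesis
    unfolding a_def[abs_def] by (rule that)
qed

text \<open>All numbers \<open>cinner ((A ^^ k) (S v)) (T v)\<close> are real, hence unchanged when
  \<open>S\<close> and \<open>T\<close> trade places. This symmetry makes the matrix elements of
  \<open>S T\<close> and \<open>T S\<close> on the orbit of \<open>v\<close> coincide, without
  describing the commutant as functions of \<open>A\<close>.\<close>

lemma commutant_commutative:
  assumes A: "self_adjoint_op V A" and v: "cyclic_vector V A v"
    and S: "self_adjoint_op V S" "\<And>x. x \<in> V \<Longrightarrow> S (A x) = A (S x)"
    and T: "self_adjoint_op V T" "\<And>x. x \<in> V \<Longrightarrow> T (A x) = A (T x)"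
    and x: "x \<in> V"
  shows "S (T x) = T (S x)"
proof -
  note bA = self_adjoint_opD(1)[OF A] and bS = self_adjoint_opD(1)[OF S(1)]
    and bT = self_adjoint_opD(1)[OF T(1)]
  have vV: "v \<in> V" using v by (simp add: cyclic_vector_def)
  have AV: "(A ^^ n) w \<in> V" if "w \<in> V" for n w
    by (rule bounded_opD(1)[OF bounded_op_funpow[OF bA] that])
  have SV: "S w \<in> V" "T w \<in> V" "A w \<in> V" if "w \<in> V" for w
    using that bS bT bA by (auto simp: bounded_opD)
  have AS: "S ((A ^^ n) w) = (A ^^ n) (S w)" if "w \<in> V" for n w
    using funpow_commute[of A S w n] S(2) that SV by simp
  have AT: "T ((A ^^ n) w) = (A ^^ n) (T w)" if "w \<in> V" for n w
    using funpow_commute[of A T w n] T(2) that SV by simp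
  have real_S: "Im (cinner ((A ^^ k) (S v)) v) = 0" for k
  proof -
    have "cinner ((A ^^ k) (S v)) v = cinner v ((A ^^ k) (S v))"
      using cinner_funpow[OF A SV(1)[OF vV] vV] self_adjoint_opD(2)[OF S(1) vV AV[OF vV]]
      by (simp add: AS vV)
    then show ?thesis
      by (metis cinner_commute cnj.simps(2) eq_neg_iff_add_eq_0 equal_neg_zero)
  qed
  \<comment> \<open>\<open>T v\<close> is a limit of real polynomials in \<open>A\<close> applied to
    \<open>v\<close>; moving these powers to the left reduces the claim to
    \<open>real_S\<close>.\<close>
  have real: "Im (cinner ((A ^^ k) (S v)) (T v)) = 0" for k
  proof -
    obtain N r where lim: "(\<lambda>j. \<Sum>n<N j. r j n *\<^sub>R (A ^^ n) v) \<longlonglongrightarrow> T v"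
      using commutant_real_approx[OF A v T] .
    have "(\<lambda>j. Im (cinner ((A ^^ k) (S v)) (\<Sum>n<N j. r j n *\<^sub>R (A ^^ n) v))) \<longlonglongrightarrow>
        Im (cinner ((A ^^ k) (S v)) (T v))"
      by (intro tendsto_intros lim)
    moreover have "Im (cinner ((A ^^ k) (S v)) (\<Sum>n<N j. r j n *\<^sub>R (A ^^ n) v)) = 0" for j
    proof -
      have "cinner ((A ^^ k) (S v)) ((A ^^ n) v) = cinner ((A ^^ (n + k)) (S v)) v" for n
        using cinner_funpow[OF A AV[OF SV(1)[OF vV]] vV] by (simp add: funpow_add)
      then show ?thesis
        by (simp add: cinner_sum_right scaleR_eq_scaleC cinner_scaleC_right real_S)
    qed
    ultimately show ?thesis by (simp add: LIMSEQ_const_iff)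
  qed
  define D where "D y = S (T y) - T (S y)" for y
  have bD: "bounded_op V D"
    unfolding D_def
    by (rule bounded_op_diff_op[OF bounded_op_compose[OF bS bT] bounded_op_compose[OF bT bS]])
  have DA: "cinner (D ((A ^^ n) v)) ((A ^^ m) v) = 0" for m n
  proof -
    have "cinner (S (T ((A ^^ n) v))) ((A ^^ m) v) = cinner ((A ^^ n) (T v)) ((A ^^ m) (S v))"
      using self_adjoint_opD(2)[OF S(1) SV(2)[OF AV[OF vV]] AV[OF vV]] by (simp add: AS AT vV SV)
    also have "\<dots> = cinner (T v) ((A ^^ (n + m)) (S v))"
      using cinner_funpow[OF A SV(2)[OF vV] AV[OF SV(1)[OF vV]]] by (simp add: funpow_add)
    also have "\<dots> = cinner ((A ^^ (n + m)) (S v)) (T v)"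
      using real[of "n + m"] cinner_commute[of "T v"] by (simp add: complex_eq_iff)
    also have "\<dots> = cinner ((A ^^ n) (S v)) ((A ^^ m) (T v))"
      using cinner_funpow[OF A AV[OF SV(1)[OF vV]] SV(2)[OF vV], of m n]
      by (simp add: add.commute[of n] funpow_add)
    also have "\<dots> = cinner (T (S ((A ^^ n) v))) ((A ^^ m) v)"
      using self_adjoint_opD(2)[OF T(1) SV(1)[OF AV[OF vV]] AV[OF vV]] by (simp add: AS AT vV SV)
    finally show ?thesis
      by (simp add: D_def cinner_diff_left)
  qed
  have D0: "D ((A ^^ n) v) = 0" for n
    by (rule cyclic_vector_orthogonal_eq_0[OF v bounded_opD(1)[OF bD AV[OF vV]] DA])
  have "D x = 0"
    by (rule cyclic_vector_bounded_op_eq_0[OF bD hilbert_subspace_axioms subset_refl v SV(3) D0 x])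
  then show ?thesis by (simp add: D_def)
qed

end

section \<open>Polar decomposition of self-adjoint operators\<close>

context hilbert_subspace
begin

lemma polar_decomposition_cong:
  assumes "bounded_op V T" "positive_op V (abs_op V T)"
    and "closure (adj_op V T ` V) \<subseteq> V" "\<And>x. x \<in> V \<Longrightarrow> \<Phi> x = \<Phi>' x"
  shows "polar_decomposition V T \<Phi> \<longleftrightarrow> polar_decomposition V T \<Phi>'"
proof -
  let ?M = "closure (adj_op V T ` V)"
  have "bounded_op V \<Phi> \<longleftrightarrow> bounded_op V \<Phi>'"
    by (rule bounded_op_cong[OF assms(4) hilbert_subspace_axioms])
  moreover have "\<Phi> ` ?M = \<Phi>' ` ?M"
    using assms(3,4) by (intro image_cong) auto
  moreover have "(\<forall>x\<in>?M. norm (\<Phi> x) = norm x) \<longleftrightarrow> (\<forall>x\<in>?M. norm (\<Phi>' x) = norm x)"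
    using assms(3,4) by (metis subsetD)
  ultimately show ?thesis
    unfolding polar_decomposition_def partial_isometry_def
    using assms(4) bounded_opD(1)[OF positive_opD(2)[OF assms(2)]] by (simp cong: ball_cong)
qed

lemma abs_op_self_adjoint:
  assumes T: "self_adjoint_op V T"
  shows "positive_op V (abs_op V T)" "x \<in> V \<Longrightarrow> abs_op V T (abs_op V T x) = T (T x)"
    "x \<in> V \<Longrightarrow> abs_op V T x = 0 \<longleftrightarrow> T x = 0"
proof -
  let ?A = "abs_op V T"
  note bT = self_adjoint_opD(1)[OF T]
  show A: "positive_op V ?A"
    unfolding abs_op_eq_sqrt_op[OF T] by (rule sqrt_op_spec(1)[OF positive_op_square[OF T]])
  assume x: "x \<in> V"
  show AA: "?A (?A x) = T (T x)"
    unfolding abs_op_eq_sqrt_op[OF T] by (rule sqrt_op_spec(2)[OF positive_op_square[OF T] x])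
  show "?A x = 0 \<longleftrightarrow> T x = 0"
  proof -
    have "cinner (?A x) (?A x) = cinner (T x) (T x)"
      using self_adjoint_opD(2)[OF positive_opD(1)[OF A] bounded_opD(1)[OF positive_opD(2)[OF A] x] x]
        self_adjoint_opD(2)[OF T bounded_opD(1)[OF bT x] x] AA by simp
    then show ?thesis by (metis cinner_self_eq_0)
  qed
qed

lemma closure_range_subset:
  assumes "self_adjoint_op V T"
  shows "closure (T ` V) \<subseteq> V" "closure (adj_op V T ` V) = closure (T ` V)"
    "hilbert_subspace (closure (T ` V))"
proof -
  note bT = self_adjoint_opD(1)[OF assms]
  have TV: "T ` V \<subseteq> V" using bT by (auto simp: bounded_opD)
  then show "closure (T ` V) \<subseteq> V"
    using closed closure_minimal by blast
  have "adj_op V T ` V = T ` V"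
    by (intro image_cong refl adj_op_self_adjoint[OF assms])
  then show "closure (adj_op V T ` V) = closure (T ` V)" by simp
  show "hilbert_subspace (closure (T ` V))"
  proof (rule hilbert_subspace_closure[OF hilbert_subspace_axioms TV])
    show "0 \<in> T ` V" using bounded_op_0[OF bT] by (metis imageI zero_mem)
    show "x + y \<in> T ` V" if "x \<in> T ` V" "y \<in> T ` V" for x y
      using that by (auto simp flip: bounded_opD(2)[OF bT])
    show "scaleC c x \<in> T ` V" if "x \<in> T ` V" for c x
      using that by (auto simp flip: bounded_opD(3)[OF bT])
  qed
qed

lemma orthogonal_range_kernel:
  assumes T: "self_adjoint_op V T" and x: "x \<in> V" "\<And>y. y \<in> closure (T ` V) \<Longrightarrow> cinner x y = 0"
  shows "T x = 0"
proof -
  note bT = self_adjoint_opD(1)[OF T]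
  have "T (T x) \<in> closure (T ` V)"
    by (rule subsetD[OF closure_subset imageI[OF bounded_opD(1)[OF bT x(1)]]])
  then have "cinner (T x) (T x) = 0"
    using self_adjoint_opD(2)[OF T x(1) bounded_opD(1)[OF bT x(1)]] x(2) by simp
  then show ?thesis by simp
qed

text \<open>With \<open>f\<close> unimodular on the positive axis, \<open>?f\<close> and its adjoint
  \<open>?g\<close> invert each other off the eigenprojection at 0, so \<open>?f\<close> is unitary
  on the closure of the range. On the kernel it vanishes either because \<open>f 0 = 0\<close> or
  because the kernel is trivial.\<close>

lemma polar_decomposition_calculus:
  assumes T: "self_adjoint_op V T" and f: "bounded_borel f"
    and unimod: "\<And>x. x \<in> V \<Longrightarrow> AE t in spectral_measure V (abs_op V T) x. 0 < t \<longrightarrow> norm (f t) = 1"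
    and zero: "f 0 = 0 \<or> (\<forall>x\<in>V. T x = 0 \<longrightarrow> x = 0)"
    and phase: "\<And>x. x \<in> V \<Longrightarrow> T x = bounded_calculus V (abs_op V T) f (abs_op V T x)"
  shows "polar_decomposition V T (bounded_calculus V (abs_op V T) f)"
proof -
  let ?A = "abs_op V T"
  note pA = abs_op_self_adjoint(1)[OF T]
  interpret A: self_adjoint_operator V ?A
    by unfold_locales (rule positive_opD(1)[OF pA])
  note bT = self_adjoint_opD(1)[OF T]
  note g = bounded_borel_cnj[OF f]
  let ?f = "A.calc f" and ?g = "A.calc (\<lambda>t. cnj (f t))"
  have E0: "T (A.E {0} x) = 0" if "x \<in> V" for x
  proof -
    have "A.E {0} (A.E {0} x) = A.E {0} x" using that by (intro A.E_E) auto
    then show ?thesis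
      using A.E_kernel[OF A.E_mem[of "{0}" x]] abs_op_self_adjoint(3)[OF T A.E_mem[of "{0}" x]] that by simp
  qed
  have kernel: "T x = 0 \<longleftrightarrow> A.E {0} x = x" if "x \<in> V" for x
    using A.E_kernel[OF that] abs_op_self_adjoint(3)[OF T that] by simp
  have nonneg: "AE t in A.\<mu> x. 0 \<le> t" if "x \<in> V" for x
    by (rule A.AE_spectral_ge[OF that]) (use positive_opD(3)[OF pA] in simp)
  \<comment> \<open>If \<open>f 0\<close> is not 0, the kernel is trivial and the point 0 is a null
    set, so the prescribed value there is harmless.\<close>
  have modulus: "AE t in A.\<mu> x. f t * cnj (f t) = 1 - indicator {0} t" if x: "x \<in> V" for x
  proof (cases "f 0 = 0")
    case True
    show ?thesis
      using unimod[OF x] nonneg[OF x]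
    proof eventually_elim
      case (elim t)
      then show ?case
        using True complex_norm_square[of "f t"] by (cases "t = 0") auto
    qed
  next
    case False
    then have "A.E {0} x = 0"
      using zero E0[OF x] A.E_mem[of "{0}" x] x by auto
    then have "AE t in A.\<mu> x. t \<noteq> 0"
      using A.AE_\<mu>_iff[OF x, of "\<lambda>t. t \<noteq> 0"] borel_comp[of "{0::real}"]
      by (simp add: Collect_neg_eq)
    with unimod[OF x] nonneg[OF x] show ?thesis
    proof eventually_elim
      case (elim t)
      then show ?case
        using complex_norm_square[of "f t"] by auto
    qed
  qed
  have ind: "bounded_borel (indicator {0::real})"
    by (rule bounded_borel_indicator) simp
  have ff: "?f (?g x) = x - A.E {0} x" "?g (?f x) = x - A.E {0} x" if x: "x \<in> V" for x
  proof -
    have "A.calc (\<lambda>t. f t * cnj (f t)) x = A.calc (\<lambda>t. 1 - indicator {0} t) x"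
      by (rule A.calc_cong_AE[OF bounded_borel_mult[OF f g] bounded_borel_diff[OF bounded_borel_const ind] x modulus[OF x]])
    also have "\<dots> = x - A.E {0} x"
      using A.calc_diff[OF bounded_borel_const ind x] by (simp add: A.calc_one A.calc_indicator x)
    finally have *: "A.calc (\<lambda>t. f t * cnj (f t)) x = x - A.E {0} x" .
    show "?f (?g x) = x - A.E {0} x"
      using A.calc_mult[OF f g x] * by simp
    show "?g (?f x) = x - A.E {0} x"
      using A.calc_mult[OF g f x] * by (simp add: mult.commute)
  qed
  have norm_f: "norm (?f x) = norm x" if x: "x \<in> V" and "A.E {0} x = 0" for x
  proof -
    have "cinner (?f x) (?f x) = cinner x (?g (?f x))"
      by (rule A.calc_adjoint[OF f x A.calc_mem[OF f x]])
    then have "(norm (?f x))\<^sup>2 = (norm x)\<^sup>2"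
      using ff(2)[OF x] that(2) by (simp add: norm_sq_eq_Re_cinner)
    then show ?thesis by (simp add: power2_eq_iff_nonneg)
  qed
  have E_f: "A.E {0} (A.calc h x) = A.calc h (A.E {0} x)" if h: "bounded_borel h" and x: "x \<in> V" for h x
    using A.calc_mult[OF ind h x] A.calc_mult[OF h ind x]
    by (simp add: A.calc_indicator A.calc_mem h x mult.commute)
  let ?M = "closure (T ` V)"
  note M = closure_range_subset[OF T]
  interpret M: hilbert_subspace ?M by (rule M(3))
  \<comment> \<open>The closed range of a self-adjoint operator is the complement of its kernel, and
    the kernel is the range of \<open>A.E {0}\<close>. In this form invariance under the calculus is
    immediate.\<close>
  have M_eq: "?M = {x\<in>V. A.E {0} x = 0}"
  proof
    have bE: "bounded_op V (A.E {0})" by (rule A.bounded_E) simp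
    show "?M \<subseteq> {x\<in>V. A.E {0} x = 0}"
    proof (rule closure_minimal)
      show "closed {x\<in>V. A.E {0} x = 0}"
        using kernel_hilbert_subspace[OF bE] hilbert_subspace.closed by blast
      have "A.E {0} (T y) = 0" if y: "y \<in> V" for y
      proof -
        let ?z = "A.E {0} (T y)"
        have Ty: "T y \<in> V" by (rule bounded_opD(1)[OF bT y])
        have z: "?z \<in> V" using Ty by (intro A.E_mem) auto
        have "cinner ?z ?z = cinner ?z (T y)"
          using A.cinner_E[of "{0}", OF _ z Ty] A.E_E[of "{0}", OF _ Ty] by simp
        also have "\<dots> = 0"
          using self_adjoint_opD(2)[OF T z y] E0[OF Ty] by simp
        finally show ?thesis by simp
      qed
      then show "T ` V \<subseteq> {x\<in>V. A.E {0} x = 0}"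
        using bT by (auto simp: bounded_opD)
    qed
    show "{x\<in>V. A.E {0} x = 0} \<subseteq> ?M"
    proof safe
      fix y assume y: "y \<in> V" "A.E {0} y = 0"
      define k where "k = y - M.proj y"
      have kV: "k \<in> V" unfolding k_def by (rule diff_mem[OF y(1) subsetD[OF M(1) M.proj_mem]])
      have kM: "cinner k z = 0" if "z \<in> ?M" for z
        using M.cinner_diff_proj[OF that] by (simp add: k_def)
      have "T k = 0" by (rule orthogonal_range_kernel[OF T kV kM])
      then have Ek: "A.E {0} k = k" using kernel[OF kV] by simp
      have "cinner k k = cinner k y"
        using kM[OF M.proj_mem[of y]] by (subst (2) k_def) (simp add: cinner_diff_right)
      also have "\<dots> = 0"
        using A.cinner_E[of "{0}", OF _ kV y(1)] Ek y(2) by simp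
      finally have "y = M.proj y" by (simp add: k_def)
      then show "y \<in> ?M" using M.proj_mem by metis
    qed
  qed
  have f_M: "A.calc h x \<in> ?M" if "bounded_borel h" "x \<in> ?M" for h x
  proof -
    have x: "x \<in> V" "A.E {0} x = 0" using that M_eq by auto
    then show ?thesis
      using E_f[OF that(1) x(1)] A.calc_mem[OF that(1) x(1)] bounded_op_0[OF A.bounded_calc[OF that(1)]]
      unfolding M_eq by simp
  qed
  show ?thesis
    unfolding polar_decomposition_def partial_isometry_def M(2)
  proof (intro conjI ballI impI)
    show "bounded_op V ?f" by (rule A.bounded_calc[OF f])
    show "norm (?f x) = norm x" if "x \<in> ?M" for x
      using that norm_f unfolding M_eq by simp
    show "?f x = 0" if x: "x \<in> V" "\<forall>y\<in>?M. cinner x y = 0" for x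
    proof -
      have "T x = 0" using orthogonal_range_kernel[OF T x(1)] x(2) by blast
      then have "?g (?f x) = 0"
        using ff(2)[OF x(1)] kernel[OF x(1)] by simp
      then have "cinner (?f x) (?f x) = 0"
        using A.calc_adjoint[OF f x(1) A.calc_mem[OF f x(1)]] by simp
      then show ?thesis by simp
    qed
    show "?f ` ?M = ?M"
    proof
      show "?f ` ?M \<subseteq> ?M" using f_M[OF f] by auto
      show "?M \<subseteq> ?f ` ?M"
      proof
        fix y assume y: "y \<in> ?M"
        then have "y = ?f (?g y)"
          using ff(1)[of y] unfolding M_eq by simp
        then show "y \<in> ?f ` ?M"
          using f_M[OF g y] by blast
      qed
    qed
    show "T x = ?f (?A x)" if "x \<in> V" for x by (rule phase[OF that])
  qed
qed

end

section \<open>From a phase relation on a cyclic subspace to the polar decomposition\<close>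

context hilbert_subspace
begin

text \<open>An almost-everywhere bound by 1 can fail only at the point 0, and there only if
  \<open>f 0\<close> is nonzero; then the kernel is trivial and the point has no mass.\<close>

lemma borel_calculus_unimodular:
  assumes T: "self_adjoint_op V T" and f: "f \<in> borel_measurable borel" and x: "x \<in> V"
    and unimod: "AE t in spectral_measure V (abs_op V T) x. 0 < t \<longrightarrow> norm (f t) = 1"
    and zero: "f 0 = 0 \<or> (\<forall>x\<in>V. T x = 0 \<longrightarrow> x = 0)"
  shows "borel_calculus V (abs_op V T) f x =
    bounded_calculus V (abs_op V T) (\<lambda>t. if norm (f t) \<le> 1 then f t else 0) x"
proof -
  let ?A = "abs_op V T"
  note pA = abs_op_self_adjoint(1)[OF T]
  interpret A: self_adjoint_operator V ?A
    by unfold_locales (rule positive_opD(1)[OF pA])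
  have nonneg: "AE t in A.\<mu> x. 0 \<le> t"
    by (rule A.AE_spectral_ge[OF x]) (use positive_opD(3)[OF pA] in simp)
  have "AE t in A.\<mu> x. norm (f t) \<le> 1"
  proof (cases "f 0 = 0")
    case True
    show ?thesis
      using unimod nonneg
    proof eventually_elim
      case (elim t)
      then show ?case using True by (cases "t = 0") auto
    qed
  next
    case False
    have z: "A.E {0} x \<in> V" using x by (intro A.E_mem) auto
    have "A.E {0} (A.E {0} x) = A.E {0} x" using x by (intro A.E_E) auto
    then have "T (A.E {0} x) = 0"
      using A.E_kernel[OF z] abs_op_self_adjoint(3)[OF T z] by simp
    then have "A.E {0} x = 0"
      using zero z False by blast
    then have "AE t in A.\<mu> x. t \<noteq> 0"
      using A.AE_\<mu>_iff[OF x, of "\<lambda>t. t \<noteq> 0"] borel_comp[of "{0::real}"]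
      by (simp add: Collect_neg_eq)
    with unimod nonneg show ?thesis
      by eventually_elim auto
  qed
  from A.borel_calculus_eq_calc[OF f zero_le_one x this] show ?thesis .
qed

text \<open>In the application \<open>V\<close> is \<open>H2\<close> and \<open>W\<close> is
  \<open>ran_H u\<close>. The phase relation is assumed on one orbit only; cyclicity spreads it over
  \<open>W\<close>, and off \<open>W\<close> everything vanishes. The second conclusion is the
  adjoint of the first and handles a phase that is given in conjugated form.\<close>

theorem polar_decomposition_cyclic:
  assumes T: "self_adjoint_op V T"
    and W: "hilbert_subspace W" "W \<subseteq> V" "T ` V \<subseteq> W"
    and B: "positive_op W B" "\<And>x. x \<in> W \<Longrightarrow> B (B x) = T (T x)"
    and u: "cyclic_vector W (T \<circ> T) u"
    and \<psi>: "\<psi> \<in> borel_measurable borel"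
    and unimod: "AE t in spectral_measure V (abs_op V T) u. 0 < t \<longrightarrow> norm (\<psi> t) = 1"
    and phase: "\<And>n. T (((T \<circ> T) ^^ n) u) = B (borel_calculus W B \<psi> (((T \<circ> T) ^^ n) u))"
    and \<phi>: "\<phi> \<in> borel_measurable borel" "\<And>t. t \<noteq> 0 \<Longrightarrow> \<phi> t = \<psi> t"
    and zero: "\<phi> 0 = 0 \<or> (\<forall>x\<in>V. T x = 0 \<longrightarrow> x = 0)"
  shows "polar_decomposition V T (borel_calculus V (abs_op V T) \<phi>)"
    and "polar_decomposition V T (borel_calculus V (abs_op V T) (\<lambda>t. cnj (\<phi> t)))"
proof -
  let ?A = "abs_op V T"
  note pA = abs_op_self_adjoint(1)[OF T] and AA = abs_op_self_adjoint(2)[OF T]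
    and A0 = abs_op_self_adjoint(3)[OF T]
  note bT = self_adjoint_opD(1)[OF T] and bB = positive_opD(2)[OF B(1)] and bA = positive_opD(2)[OF pA]
  interpret W: hilbert_subspace W by fact
  interpret A: self_adjoint_operator V ?A
    by unfold_locales (rule positive_opD(1)[OF pA])
  interpret B: self_adjoint_operator W B
    by unfold_locales (rule positive_opD(1)[OF B(1)])
  have WV: "x \<in> V" if "x \<in> W" for x using that W by blast
  have TW: "T x \<in> W" if "x \<in> V" for x using that W by blast
  have kernel: "T x = 0" if x: "x \<in> V" and orth: "\<And>y. y \<in> W \<Longrightarrow> cinner x y = 0" for x
  proof -
    have "cinner (T x) (T x) = cinner x (T (T x))"
      by (rule self_adjoint_opD(2)[OF T x bounded_opD(1)[OF bT x]])
    also have "\<dots> = 0" by (rule orth[OF TW[OF bounded_opD(1)[OF bT x]]])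
    finally show ?thesis by simp
  qed
  \<comment> \<open>The component of \<open>x\<close> orthogonal to \<open>W\<close>; it lies in the
    kernel of \<open>T\<close>.\<close>
  define k where "k x = x - W.proj x" for x
  have k: "k x \<in> V" "T (k x) = 0" "x = W.proj x + k x" if x: "x \<in> V" for x
  proof -
    show kV: "k x \<in> V" unfolding k_def by (rule diff_mem[OF x WV[OF W.proj_mem]])
    show "T (k x) = 0"
      by (rule kernel[OF kV]) (simp add: k_def W.cinner_diff_proj)
  qed (simp add: k_def)
  have T_proj: "T x = T (W.proj x)" if x: "x \<in> V" for x
    using bounded_opD(2)[OF bT WV[OF W.proj_mem] k(1)[OF x], of x] k[OF x] by simp

  \<comment> \<open>\<open>C\<close> extends \<open>B\<close> by 0 from \<open>W\<close> to
    \<open>V\<close>. It is a positive root of the square of \<open>T\<close>, hence the modulus, so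
    that \<open>?A\<close> restricts to \<open>B\<close> on \<open>W\<close>.\<close>
  define C where "C x = B (W.proj x)" for x
  have C: "positive_op V C"
    unfolding positive_op_def self_adjoint_op_def
  proof (intro conjI ballI)
    obtain K where K: "K > 0" "\<And>x. x \<in> W \<Longrightarrow> norm (B x) \<le> K * norm x"
      using bounded_op_bound[OF bB] by blast
    show "bounded_op V C"
    proof (rule bounded_opI[where K = K])
      fix x c assume "x \<in> V"
      show "C x \<in> V" unfolding C_def by (rule WV[OF bounded_opD(1)[OF bB W.proj_mem]])
      show "C (scaleC c x) = scaleC c (C x)"
        by (simp add: C_def W.proj_scaleC bounded_opD(3)[OF bB])
      have "norm (C x) \<le> K * norm (W.proj x)" unfolding C_def by (rule K(2)[OF W.proj_mem])
      also have "\<dots> \<le> K * norm x" using K(1) W.norm_proj_le by simp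
      finally show "norm (C x) \<le> K * norm x" .
      fix y show "C (x + y) = C x + C y"
        by (simp add: C_def W.proj_add bounded_opD(2)[OF bB])
    qed
    fix x y
    show "cinner (C x) y = cinner x (C y)"
      using self_adjoint_opD(2)[OF positive_opD(1)[OF B(1)] W.proj_mem W.proj_mem, of x y]
        W.cinner_proj_right[OF bounded_opD(1)[OF bB W.proj_mem], of x y]
        W.cinner_proj_left[OF bounded_opD(1)[OF bB W.proj_mem], of x y]
      by (simp add: C_def)
    show "0 \<le> Re (cinner (C x) x)"
      using positive_opD(3)[OF B(1) W.proj_mem, of x]
        W.cinner_proj_right[OF bounded_opD(1)[OF bB W.proj_mem], of x x]
      by (simp add: C_def)
  qed
  have CC: "C (C x) = ?A (?A x)" if x: "x \<in> V" for x
    using B(2)[OF W.proj_mem, of x] T_proj[OF x] AA[OF x] bounded_opD(1)[OF bB W.proj_mem, of x]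
    by (simp add: C_def)
  have AB: "?A x = B x" if "x \<in> W" for x
    using positive_sqrt_unique[OF C pA CC WV[OF that]] that by (simp add: C_def)
  interpret ext: operator_extension W B V ?A
    by unfold_locales (use W AB in auto)

  have uW: "u \<in> W" using u by (simp add: cyclic_vector_def)
  have TT: "(T \<circ> T) x \<in> W" if "x \<in> W" for x
    using that TW WV by simp
  have TTn: "((T \<circ> T) ^^ n) u \<in> W" for n
    by (induction n) (use uW TT in auto)

  \<comment> \<open>The hypothesis speaks of the spectral measure at \<open>u\<close> only. It says
    that the projection \<open>A.E S\<close> of the bad set kills \<open>u\<close>; commuting with
    the square of \<open>T\<close>, it kills the orbit and hence \<open>W\<close>. The vectors
    \<open>k x\<close> have spectral mass only at 0, which is not in \<open>S\<close>.\<close>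
  have unimod_all: "AE t in A.\<mu> x. 0 < t \<longrightarrow> norm (\<psi> t) = 1" if x: "x \<in> V" for x
  proof -
    define S where "S = {t. \<not> (0 < t \<longrightarrow> norm (\<psi> t) = 1)}"
    have good: "{t. 0 < t \<longrightarrow> norm (\<psi> t) = 1} \<in> sets borel"
      using \<psi> by measurable
    have S: "S \<in> sets borel"
      unfolding S_def using \<psi> by measurable
    note bE = A.bounded_E[OF S]
    have EA: "A.E S (?A y) = ?A (A.E S y)" if "y \<in> V" for y
      using A.calc_commute[OF bounded_borel_indicator[OF S] that] bounded_opD(1)[OF bA that]
      by (simp add: A.calc_indicator[OF S] that)
    have EW: "A.E S (((T \<circ> T) ^^ n) u) = 0" for n
    proof (induction n)
      case 0
      show ?case
        using A.AE_\<mu>_iff[OF WV[OF uW] good] unimod by (simp add: S_def)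
    next
      case (Suc n)
      let ?y = "((T \<circ> T) ^^ n) u"
      have y: "?y \<in> V" by (rule WV[OF TTn])
      have "A.E S (T (T ?y)) = ?A (?A (A.E S ?y))"
        using EA[OF bounded_opD(1)[OF bA y]] EA[OF y] by (simp add: AA[OF y, symmetric])
      then have 1: "A.E S (T (T ?y)) = 0"
        by (simp only: Suc bounded_op_0[OF bA])
      show ?case
        using 1 by (simp add: comp_def)
    qed
    have p: "A.E S (W.proj x) = 0"
      by (rule W.cyclic_vector_bounded_op_eq_0[OF bE hilbert_subspace_axioms W(2) u TT EW W.proj_mem])
    have "A.E {0} (k x) = k x"
      using A.E_kernel[OF k(1)[OF x]] A0[OF k(1)[OF x]] k(2)[OF x] by simp
    then have "A.E S (k x) = A.E (S \<inter> {0}) (k x)"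
      using A.E_Int[OF S _ k(1)[OF x], of "{0}"] by simp
    also have "S \<inter> {0} = {}" by (auto simp: S_def)
    finally have "A.E S (k x) = 0" by (simp add: A.E_empty[OF k(1)[OF x]])
    then have "A.E S x = 0"
      using bounded_opD(2)[OF bE WV[OF W.proj_mem] k(1)[OF x], of x] p k(3)[OF x] by simp
    then show ?thesis
      using A.AE_\<mu>_iff[OF x good] by (simp add: S_def)
  qed
  have unimod\<phi>: "AE t in A.\<mu> x. 0 < t \<longrightarrow> norm (\<phi> t) = 1" if "x \<in> V" for x
    using unimod_all[OF that] by eventually_elim (use \<phi>(2) in auto)
  have nonneg: "AE t in A.\<mu> x. 0 \<le> t" if "x \<in> V" for x
    by (rule A.AE_spectral_ge[OF that]) (use positive_opD(3)[OF pA] in simp)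
  \<comment> \<open>Clipping makes the phase bounded everywhere. It changes \<open>\<phi>\<close>
    only on sets without spectral mass, by unimodularity on the positive axis and the alternative in
    \<open>zero\<close>.\<close>
  define f where "f t = (if norm (\<phi> t) \<le> 1 then \<phi> t else 0)" for t
  have f: "bounded_borel f"
    unfolding f_def[abs_def] by (rule bounded_borel_truncate[OF \<phi>(1)]) simp
  note g = bounded_borel_cnj[OF f]
  have f0: "f 0 = 0 \<or> (\<forall>x\<in>V. T x = 0 \<longrightarrow> x = 0)"
    using zero by (auto simp: f_def)
  have unimodf: "AE t in A.\<mu> x. 0 < t \<longrightarrow> norm (f t) = 1" if "x \<in> V" for x
    using unimod\<phi>[OF that] by eventually_elim (auto simp: f_def)
  \<comment> \<open>The value \<open>\<psi> 0\<close> is unconstrained, so the bound has to include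
    it.\<close>
  define M where "M = max 1 (norm (\<psi> 0))"
  have M0: "0 \<le> M" by (simp add: M_def)
  have AE_M: "AE t in A.\<mu> x. norm (\<psi> t) \<le> M" if "x \<in> V" for x
    using unimod_all[OF that] nonneg[OF that]
  proof eventually_elim
    case (elim t)
    then show ?case by (cases "t = 0") (auto simp: M_def)
  qed
  \<comment> \<open>\<open>\<psi>\<close> and \<open>f\<close> may disagree at 0 even on a set of
    positive mass; the factor \<open>?A\<close> in front removes the discrepancy.\<close>
  have psi: "?A (borel_calculus W B \<psi> x) = ?A (A.calc f x)" if xW: "x \<in> W" for x
  proof -
    have x: "x \<in> V" by (rule WV[OF xW])
    have *: "borel_calculus V ?A \<psi> x = A.calc (\<lambda>t. if norm (\<psi> t) \<le> M then \<psi> t else 0) x"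
      by (rule A.borel_calculus_eq_calc[OF \<psi> M0 x AE_M[OF x]])
    note h = bounded_borel_truncate[OF \<psi> M0]
    note s = A.bounded_borel_spectral_id
    have "A.calc (\<lambda>t. A.spectral_id t * (if norm (\<psi> t) \<le> M then \<psi> t else 0)) x = A.calc (\<lambda>t. A.spectral_id t * f t) x"
    proof (rule A.calc_cong_AE[OF bounded_borel_mult[OF s h] bounded_borel_mult[OF s f] x])
      show "AE t in A.\<mu> x. A.spectral_id t * (if norm (\<psi> t) \<le> M then \<psi> t else 0) = A.spectral_id t * f t"
        using unimod_all[OF x] nonneg[OF x]
      proof eventually_elim
        case (elim t)
        then show ?case
          using \<phi>(2)[of t] by (cases "t = 0") (auto simp: A.spectral_id_def f_def M_def)
      qed
    qed
    then show ?thesis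
      using A.calc_mult[OF s h x] A.calc_mult[OF s f x]
      by (simp add: A.calc_spectral_id A.calc_mem h f x * flip: ext.borel_calculus_extends[OF \<psi> xW])
  qed
  have phase_W: "T x = ?A (A.calc f x)" if x: "x \<in> W" for x
  proof -
    define D where "D y = T y - ?A (A.calc f y)" for y
    have bD: "bounded_op V D"
      unfolding D_def
      by (rule bounded_op_diff_op[OF bT bounded_op_compose[OF bA A.bounded_calc[OF f]]])
    have D0: "D (((T \<circ> T) ^^ n) u) = 0" for n
    proof -
      have "borel_calculus W B \<psi> (((T \<circ> T) ^^ n) u) \<in> W"
      proof -
        let ?y = "((T \<circ> T) ^^ n) u"
        have "borel_calculus W B \<psi> ?y = B.calc (\<lambda>t. if norm (\<psi> t) \<le> M then \<psi> t else 0) ?y"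
          by (rule B.borel_calculus_eq_calc[OF \<psi> M0 TTn AE_M[OF WV[OF TTn], unfolded ext.spectral_measure_extends[OF TTn]]])
        then show ?thesis
          using B.calc_mem[OF bounded_borel_truncate[OF \<psi> M0] TTn] by simp
      qed
      then show ?thesis
        unfolding D_def using phase[of n] psi[OF TTn, of n] by (simp add: AB)
    qed
    have "D x = 0"
      by (rule W.cyclic_vector_bounded_op_eq_0[OF bD hilbert_subspace_axioms W(2) u TT D0 x])
    then show ?thesis by (simp add: D_def)
  qed
  \<comment> \<open>On \<open>k x\<close> both sides are 0: \<open>?A\<close> annihilates it and
    commutes with the calculus.\<close>
  have phase_f': "T x = ?A (A.calc f x)" if x: "x \<in> V" for x
  proof -
    have Ak: "?A (k x) = 0" using A0[OF k(1)[OF x]] k(2)[OF x] by simp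
    have "?A (A.calc f (k x)) = 0"
      using A.calc_commute[OF f k(1)[OF x]] Ak bounded_op_0[OF A.bounded_calc[OF f]] by simp
    moreover have "?A (A.calc f (W.proj x + k x)) = ?A (A.calc f (W.proj x)) + ?A (A.calc f (k x))"
      using WV[OF W.proj_mem, of x] k(1)[OF x]
      by (simp add: bounded_opD(2)[OF A.bounded_calc[OF f]] bounded_opD(2)[OF bA] A.calc_mem[OF f])
    ultimately show ?thesis
      using T_proj[OF x] phase_W[OF W.proj_mem, of x] k(3)[OF x] by simp
  qed
  have phase_f: "T x = A.calc f (?A x)" if x: "x \<in> V" for x
    using phase_f'[OF x] A.calc_commute[OF f x] by simp
  \<comment> \<open>\<open>T\<close> and \<open>?A\<close> are self-adjoint, so taking adjoints in
    \<open>phase_f'\<close> replaces the phase by its conjugate and leaves \<open>T\<close>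
    unchanged.\<close>
  have phase_g: "T x = A.calc (\<lambda>t. cnj (f t)) (?A x)" if x: "x \<in> V" for x
  proof (rule cinner_eqI)
    have Ax: "?A x \<in> V" by (rule bounded_opD(1)[OF bA x])
    show "T x \<in> V" "A.calc (\<lambda>t. cnj (f t)) (?A x) \<in> V"
      using bounded_opD(1)[OF bT x] A.calc_mem[OF g Ax] by auto
    fix z assume z: "z \<in> V"
    have "cinner (T x) z = cinner x (?A (A.calc f z))"
      using self_adjoint_opD(2)[OF T x z] phase_f'[OF z] by simp
    also have "\<dots> = cinner (?A x) (A.calc f z)"
      using self_adjoint_opD(2)[OF positive_opD(1)[OF pA] x A.calc_mem[OF f z]] by simp
    also have "\<dots> = cinner (A.calc (\<lambda>t. cnj (f t)) (?A x)) z"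
      using A.calc_adjoint[OF g Ax z] by simp
    finally show "cinner (T x) z = cinner (A.calc (\<lambda>t. cnj (f t)) (?A x)) z" .
  qed
  note cong = polar_decomposition_cong[OF bT pA, unfolded closure_range_subset(2)[OF T],
      OF closure_range_subset(1)[OF T]]
  have "polar_decomposition V T (A.calc f)"
    by (rule polar_decomposition_calculus[OF T f unimodf f0 phase_f])
  moreover have "borel_calculus V ?A \<phi> x = A.calc f x" if "x \<in> V" for x
    unfolding f_def[abs_def] by (rule borel_calculus_unimodular[OF T \<phi>(1) that unimod\<phi>[OF that] zero])
  ultimately show "polar_decomposition V T (borel_calculus V ?A \<phi>)"
    using cong by blast
  have "polar_decomposition V T (A.calc (\<lambda>t. cnj (f t)))"
    by (rule polar_decomposition_calculus[OF T g _ _ phase_g]) (use unimodf f0 in auto)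
  moreover have "borel_calculus V ?A (\<lambda>t. cnj (\<phi> t)) x = A.calc (\<lambda>t. cnj (f t)) x" if "x \<in> V" for x
  proof -
    have "borel_calculus V ?A (\<lambda>t. cnj (\<phi> t)) x =
        A.calc (\<lambda>t. if norm (cnj (\<phi> t)) \<le> 1 then cnj (\<phi> t) else 0) x"
      by (rule borel_calculus_unimodular[OF T _ that]) (use \<phi>(1) unimod\<phi>[OF that] zero in auto)
    also have "(\<lambda>t. if norm (cnj (\<phi> t)) \<le> 1 then cnj (\<phi> t) else 0) = (\<lambda>t. cnj (f t))"
      by (auto simp: f_def)
    finally show ?thesis .
  qed
  ultimately show "polar_decomposition V T (borel_calculus V ?A (\<lambda>t. cnj (\<phi> t)))"
    using cong by blast
qed

end

section \<open>Fourier series on the circle\<close>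

lemma L2_rel_rep: "L2_rel (rep_L2_circle f) (rep_L2_circle f)"
  using Quotient3_rep_reflp[OF Quotient3_L2_circle] .

lemma square_integrable_rep: "square_integrable (rep_L2_circle f)"
  using L2_rel_rep by (simp add: L2_rel_def)

lemma rep_abs_L2: "square_integrable g \<Longrightarrow> AE z in circle_measure. rep_L2_circle (abs_L2_circle g) z = g z"
  using Quotient3_rep_abs[OF Quotient3_L2_circle, of g] by (simp add: L2_rel_def)

lemma abs_rep_L2: "abs_L2_circle (rep_L2_circle f) = f"
  using Quotient3_abs_rep[OF Quotient3_L2_circle] .

lemma cinner_abs_L2:
  assumes "square_integrable f" "square_integrable g"
  shows "cinner (abs_L2_circle f) (abs_L2_circle g) = (\<integral>z. f z * cnj (g z) \<partial>circle_measure)"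
  using assms by (intro cinner_L2_circle.abs_eq) (simp_all add: L2_rel_def)

lemma cinner_L2: "cinner f g = (\<integral>z. rep_L2_circle f z * cnj (rep_L2_circle g z) \<partial>circle_measure)"
  using cinner_abs_L2[OF square_integrable_rep square_integrable_rep, of f g] by (simp add: abs_rep_L2)

lemma measurable_powi [measurable]: "(\<lambda>z::complex. z powi k) \<in> borel_measurable borel"
  unfolding power_int_def by measurable

lemma AE_circle_powi:
  "AE z in circle_measure. norm (z powi k) = 1 \<and> cnj (z powi k) = z powi (- k) \<and> z \<noteq> 0"
  using AE_circle_norm_1
proof eventually_elim
  case (elim z)
  then have "z * cnj z = 1" by (simp flip: complex_norm_square)
  then have "cnj z = inverse z" by (metis inverse_unique)
  then show ?case using elim by (auto simp: norm_power_int power_int_minus power_int_inverse)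
qed

lemma square_integrable_powi: "square_integrable (\<lambda>z. z powi k)"
proof -
  have "integrable circle_measure (\<lambda>z. (norm (z powi k))\<^sup>2)"
  proof (rule circle_measure.integrable_const_bound[where B = 1])
    show "AE z in circle_measure. norm ((norm (z powi k))\<^sup>2) \<le> 1"
      using AE_circle_powi[of k] by eventually_elim simp
  qed simp
  then show ?thesis by (simp add: square_integrable_def)
qed

definition monomial :: "int \<Rightarrow> L2_circle" where
  "monomial k = abs_L2_circle (\<lambda>z. z powi k)"

lemma integral_mult_powi:
  assumes f: "f \<in> borel_measurable borel"
  shows "(\<integral>z. f z * cnj (z powi k) \<partial>circle_measure) = fourier_coeff f k"
  unfolding fourier_coeff_def
proof (rule integral_cong_AE)
  show "AE z in circle_measure. f z * cnj (z powi k) = f z * z powi (- k)"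
    using AE_circle_powi[of k] by eventually_elim simp
qed (use f in auto)

lemma fourier_coeff_rep: "fourier_coeff (rep_L2_circle f) k = cinner f (monomial k)"
proof -
  have "cinner f (monomial k) = (\<integral>z. rep_L2_circle f z * cnj (z powi k) \<partial>circle_measure)"
    using cinner_abs_L2[OF square_integrable_rep square_integrable_powi, of f k]
    by (simp add: monomial_def abs_rep_L2)
  also have "\<dots> = fourier_coeff (rep_L2_circle f) k"
    by (rule integral_mult_powi) (use square_integrable_rep in \<open>simp add: square_integrable_def\<close>)
  finally show ?thesis by simp
qed

lemma integral_circle:
  fixes f :: "complex \<Rightarrow> complex"
  assumes [measurable]: "f \<in> borel_measurable borel"
  shows "(\<integral>z. f z \<partial>circle_measure) = (LINT t|lborel. indicator {0..2*pi} t *\<^sub>R f (cis t)) /\<^sub>R (2 * pi)"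
proof -
  have [measurable]: "cis \<in> borel_measurable borel"
    by (intro borel_measurable_continuous_onI continuous_intros)
  have u: "uniform_measure lborel {0..2*pi} = density lborel (\<lambda>t. ennreal (indicator {0..2*pi} t / (2 * pi)))"
    unfolding uniform_measure_def
    by (intro density_cong) (auto intro!: AE_I2 simp: indicator_def divide_ennreal[symmetric] ennreal_numeral
        ennreal_mult[symmetric])
  have "(\<integral>z. f z \<partial>circle_measure) = (\<integral>t. f (cis t) \<partial>uniform_measure lborel {0..2*pi})"
    unfolding circle_measure_def by (rule integral_distr) auto
  also have "\<dots> = (LINT t|lborel. (indicator {0..2*pi} t / (2 * pi)) *\<^sub>R f (cis t))"
    unfolding u by (rule integral_density) auto
  also have "\<dots> = (LINT t|lborel. (indicator {0..2*pi} t *\<^sub>R f (cis t)) /\<^sub>R (2 * pi))"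
    by (simp only: divide_inverse_commute scaleR_scaleR)
  also have "\<dots> = (LINT t|lborel. indicator {0..2*pi} t *\<^sub>R f (cis t)) /\<^sub>R (2 * pi)"
    by (rule integral_scaleR_right)
  finally show ?thesis .
qed

lemma integral_circle_powi: "(\<integral>z. z powi k \<partial>circle_measure) = (if k = 0 then 1 else 0)"
proof (cases "k = 0")
  case True
  then show ?thesis
    using emeasure_circle_measure_UNIV by (simp add: measure_def)
next
  case False
  define F where "F t = cis (of_int k * t) / (\<i> * of_int k)" for t :: real
  have "(F has_vector_derivative cis (of_int k * t)) (at t within {0..2*pi})" for t
  proof -
    have "((\<lambda>z. exp (\<i> * of_int k * z) / (\<i> * of_int k)) has_field_derivative exp (\<i> * of_int k * complex_of_real t))
        (at (complex_of_real t))"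
      using False by (auto intro!: derivative_eq_intros)
    from has_vector_derivative_real_field[OF this]
    show ?thesis by (simp add: F_def[abs_def] cis_conv_exp mult.assoc)
  qed
  then have "(LINT t|lborel. indicator {0..2*pi} t *\<^sub>R cis (of_int k * t)) = F (2*pi) - F 0"
    by (intro integral_FTC_Icc continuous_intros) auto
  also have "\<dots> = 0"
    using cis_multiple_2pi[of "of_int k"] by (simp add: F_def mult.commute mult.assoc)
  finally show ?thesis
    using False by (subst integral_circle) (auto simp: cis_power_int)
qed

lemma cinner_monomial: "cinner (monomial j) (monomial k) = (if j = k then 1 else 0)"
proof -
  have "cinner (monomial j) (monomial k) = (\<integral>z. z powi j * cnj (z powi k) \<partial>circle_measure)"
    unfolding monomial_def by (rule cinner_abs_L2[OF square_integrable_powi square_integrable_powi])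
  also have "\<dots> = (\<integral>z. z powi (j - k) \<partial>circle_measure)"
  proof (rule integral_cong_AE)
    show "AE z in circle_measure. z powi j * cnj (z powi k) = z powi (j - k)"
      using AE_circle_powi[of k] by eventually_elim (simp add: power_int_add[symmetric])
  qed auto
  finally show ?thesis by (simp add: integral_circle_powi)
qed

lemma integrable_of_square_integrable:
  assumes "square_integrable f"
  shows "integrable circle_measure f"
  using integrable_mult_cnj[OF assms, of "\<lambda>_. 1"] by (simp add: square_integrable_def)

text \<open>On the circle \<open>Re z\<close> and \<open>Im z\<close> are combinations of \<open>z\<close> and \<open>1 / z\<close>, so multiplication by a real
  polynomial preserves the class of functions without Fourier coefficients.\<close>

lemma fourier_zero_mult_polynomial:
  assumes p: "real_polynomial_function p" and "square_integrable f" "\<And>k. fourier_coeff f k = 0"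
  shows "square_integrable (\<lambda>z. complex_of_real (p z) * f z) \<and>
    (\<forall>k. fourier_coeff (\<lambda>z. complex_of_real (p z) * f z) k = 0)"
  using assms
proof (induction arbitrary: f rule: real_polynomial_function.induct)
  case (linear p)
  note sf = linear.prems(1) and zf = linear.prems(2)
  interpret bounded_linear p by fact
  \<comment> \<open>A real-linear function is determined by its values at 1 and \<open>\<i>\<close>;
    this \<open>a\<close> makes \<open>p z\<close> equal to twice the real part of
    \<open>a * z\<close>.\<close>
  define a where "a = Complex (p 1) (- p \<i>) / 2"
  have pz: "complex_of_real (p z) = a * z + cnj a * cnj z" for z
  proof -
    have "z = Re z *\<^sub>R 1 + Im z *\<^sub>R \<i>" by (simp add: complex_eq_iff)
    then have "p z = Re z * p 1 + Im z * p \<i>"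
      by (metis add scaleR real_scaleR_def)
    then show ?thesis by (simp add: a_def complex_eq_iff field_simps)
  qed
  have fm [measurable]: "f \<in> borel_measurable borel" using sf by (simp add: square_integrable_def)
  have s1: "square_integrable (\<lambda>z. z * f z)" by (rule square_integrable_shift[OF sf])
  have s2: "square_integrable (\<lambda>z. cnj z * f z)"
    by (rule square_integrable_mult_bounded[OF sf, where K = 1])
      (use AE_circle_norm_1 in \<open>auto intro: eventually_mono\<close>)
  have sq: "square_integrable (\<lambda>z. complex_of_real (p z) * f z)"
    using square_integrable_add[OF square_integrable_scale[OF s1, of a] square_integrable_scale[OF s2, of "cnj a"]]
    by (simp add: pz distrib_right mult.assoc)
  have int: "integrable circle_measure (\<lambda>z. f z * z powi k)" for k
    using integrable_mult_cnj[OF sf square_integrable_powi[of "- k"]]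
  proof (rule Bochner_Integration.integrable_cong_AE_imp)
    show "AE z in circle_measure. f z * cnj (z powi (- k)) = f z * z powi k"
      using AE_circle_powi[of "- k"] by eventually_elim simp
  qed auto
  have "fourier_coeff (\<lambda>z. complex_of_real (p z) * f z) k =
      a * fourier_coeff f (k - 1) + cnj a * fourier_coeff f (k + 1)" for k
  proof -
    have "fourier_coeff (\<lambda>z. complex_of_real (p z) * f z) k =
        (\<integral>z. a * (f z * z powi (- (k - 1))) + cnj a * (f z * z powi (- (k + 1))) \<partial>circle_measure)"
      unfolding fourier_coeff_def
    proof (rule integral_cong_AE)
      show "AE z in circle_measure. complex_of_real (p z) * f z * z powi - k =
          a * (f z * z powi (- (k - 1))) + cnj a * (f z * z powi (- (k + 1)))"
        using AE_circle_powi[of 1]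
      proof eventually_elim
        case (elim z)
        have "z powi (- (k - 1)) = z * z powi (- k)"
          using elim power_int_add[of z 1 "- k"] by simp
        moreover have "z powi (- (k + 1)) = cnj z * z powi (- k)"
        proof -
          have "z powi (- (k + 1)) = z powi (- 1 + - k)"
            by (rule arg_cong[where f = "\<lambda>n. z powi n"]) simp
          then show ?thesis
            using elim power_int_add[of z "-1" "- k"] by simp
        qed
        ultimately show ?case by (simp add: pz algebra_simps)
      qed
    qed (auto simp: pz)
    then show ?thesis
      using int by (simp add: fourier_coeff_def)
  qed
  then show ?case using sq zf by simp
next
  case (const c)
  have "fourier_coeff (\<lambda>z. complex_of_real c * f z) k = complex_of_real c * fourier_coeff f k" for k
    by (simp add: fourier_coeff_def mult.assoc)
  then show ?case using const square_integrable_scale by simp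
next
  case (add p q)
  note P = add.IH(1)[OF add.prems] and Q = add.IH(2)[OF add.prems]
  have int: "integrable circle_measure (\<lambda>z. h z * z powi - k)" if "square_integrable h" for h k
    using integrable_mult_cnj[OF that square_integrable_powi[of k]]
  proof (rule Bochner_Integration.integrable_cong_AE_imp)
    show "AE z in circle_measure. h z * cnj (z powi k) = h z * z powi - k"
      using AE_circle_powi[of k] by eventually_elim simp
  qed (use that in \<open>auto simp: square_integrable_def\<close>)
  have "fourier_coeff (\<lambda>z. complex_of_real (p z) * f z + complex_of_real (q z) * f z) k =
      fourier_coeff (\<lambda>z. complex_of_real (p z) * f z) k + fourier_coeff (\<lambda>z. complex_of_real (q z) * f z) k" for k
    using int[of "\<lambda>z. complex_of_real (p z) * f z" k] int[of "\<lambda>z. complex_of_real (q z) * f z" k] P Q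
    by (simp add: fourier_coeff_def distrib_right)
  then show ?case
    using P Q square_integrable_add by (simp add: distrib_right)
next
  case (mult p q)
  have "square_integrable (\<lambda>z. complex_of_real (q z) * f z) \<and> (\<forall>k. fourier_coeff (\<lambda>z. complex_of_real (q z) * f z) k = 0)"
    by (rule mult.IH(2)[OF mult.prems])
  then show ?case
    using mult.IH(1)[of "\<lambda>z. complex_of_real (q z) * f z"] by (simp add: mult.assoc)
qed

text \<open>The positive and negative parts of \<open>Re (f z)\<close>, taken as densities, give two
  finite measures with equal integrals of every polynomial, since multiplying \<open>f\<close> by a
  polynomial keeps all its Fourier coefficients 0. So the measures coincide, and with them the two
  parts.\<close>

lemma AE_Re_eq_0_if_fourier_zero:
  assumes f: "square_integrable f" and zero: "\<And>k. fourier_coeff f k = 0"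
  shows "AE z in circle_measure. Re (f z) = 0"
proof -
  have [measurable]: "f \<in> borel_measurable borel" using f by (simp add: square_integrable_def)
  define g h where "g z = max 0 (Re (f z))" and "h z = max 0 (- Re (f z))" for z
  have [measurable]: "g \<in> borel_measurable borel" "h \<in> borel_measurable borel"
    unfolding g_def h_def by measurable
  have int: "integrable circle_measure (\<lambda>z. Re (f z))"
    using integrable_of_square_integrable[OF f] by simp
  have ig: "integrable circle_measure g" and ih: "integrable circle_measure h"
    unfolding g_def h_def using int by (auto intro!: integrable_max)
  have fin: "finite_measure (density circle_measure (\<lambda>z. ennreal (k z)))"
    if "integrable circle_measure k" "\<And>z. 0 \<le> k z" and [measurable]: "k \<in> borel_measurable borel" for k
  proof (rule finite_measureI)
    have "(\<integral>\<^sup>+z. ennreal (k z) \<partial>circle_measure) = ennreal (integral\<^sup>L circle_measure k)"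
      using that by (intro nn_integral_eq_integral) auto
    then show "emeasure (density circle_measure (\<lambda>z. ennreal (k z))) (space (density circle_measure (\<lambda>z. ennreal (k z)))) \<noteq> \<infinity>"
      by (simp add: emeasure_density)
  qed
  have "density circle_measure (\<lambda>z. ennreal (g z)) = density circle_measure (\<lambda>z. ennreal (h z))"
  proof (rule finite_measure_eqI_polynomial[where S = "cball 0 1"])
    show "finite_measure (density circle_measure (\<lambda>z. ennreal (g z)))"
      by (rule fin[OF ig]) (auto simp: g_def)
    show "finite_measure (density circle_measure (\<lambda>z. ennreal (h z)))"
      by (rule fin[OF ih]) (auto simp: h_def)
    show "AE z in density circle_measure (\<lambda>z. ennreal (g z)). z \<in> cball 0 1"
      "AE z in density circle_measure (\<lambda>z. ennreal (h z)). z \<in> cball 0 1"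
      using AE_circle_norm_1 by (auto simp: AE_density elim!: eventually_mono)
    fix p :: "complex \<Rightarrow> real" assume p: "real_polynomial_function p"
    have pc: "continuous_on UNIV p"
      using p continuous_real_polymonial_function continuous_at_imp_continuous_on by blast
    then have [measurable]: "p \<in> borel_measurable borel"
      by (rule borel_measurable_continuous_onI)
    have "bounded (p ` cball 0 1)"
      using pc compact_continuous_image[of "cball 0 1" p] continuous_on_subset compact_imp_bounded compact_cball by blast
    then obtain B where B: "\<And>z. z \<in> cball 0 1 \<Longrightarrow> norm (p z) \<le> B"
      unfolding bounded_iff by (metis imageI)
    have ip: "integrable circle_measure (\<lambda>z. k z * p z)" if k: "integrable circle_measure k" for k :: "complex \<Rightarrow> real"
    proof (rule Bochner_Integration.integrable_bound)
      show "integrable circle_measure (\<lambda>z. B * k z)" using k by simp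
      show "AE z in circle_measure. norm (k z * p z) \<le> norm (B * k z)"
        using AE_circle_norm_1
      proof eventually_elim
        case (elim z)
        then have "norm (p z) \<le> B" by (intro B) simp
        then have "norm (p z) \<le> \<bar>B\<bar>" by linarith
        then show ?case
          by (simp add: abs_mult mult.commute[of "\<bar>B\<bar>"] mult_left_mono)
      qed
    qed (use k in simp)
    note P = fourier_zero_mult_polynomial[OF p f zero]
    have "(\<integral>z. complex_of_real (p z) * f z \<partial>circle_measure) = 0"
      using P[THEN conjunct2, rule_format, of 0] by (simp add: fourier_coeff_def)
    moreover have "integrable circle_measure (\<lambda>z. complex_of_real (p z) * f z)"
      using P integrable_of_square_integrable by blast
    ultimately have "(\<integral>z. Re (complex_of_real (p z) * f z) \<partial>circle_measure) = 0"
      by (subst integral_Re) auto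
    moreover have "Re (complex_of_real (p z) * f z) = g z * p z - h z * p z" for z
      by (simp add: g_def h_def max_def)
    ultimately have "(\<integral>z. g z * p z \<partial>circle_measure) = (\<integral>z. h z * p z \<partial>circle_measure)"
      using ip[OF ig] ip[OF ih] by simp
    then show "integral\<^sup>L (density circle_measure (\<lambda>z. ennreal (g z))) p =
        integral\<^sup>L (density circle_measure (\<lambda>z. ennreal (h z))) p"
      by (subst (1 2) integral_density) (auto simp: g_def h_def)
  qed auto
  then have "AE z in circle_measure. ennreal (g z) = ennreal (h z)"
    by (intro circle_measure.density_unique) auto
  then show ?thesis
    by eventually_elim (auto simp: g_def h_def max_def split: if_splits)
qed

text \<open>Totality of the monomials: the preceding lemma for \<open>f\<close> gives the real part,
  and for \<open>- \<i>\<close> times \<open>f\<close> the imaginary part.\<close>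

lemma L2_circle_eq_0I:
  assumes "\<And>k. cinner f (monomial k) = 0"
  shows "f = 0"
proof -
  let ?f = "rep_L2_circle f"
  have z: "fourier_coeff ?f k = 0" for k by (simp add: fourier_coeff_rep assms)
  note sq = square_integrable_rep[of f]
  have "fourier_coeff (\<lambda>z. - \<i> * ?f z) k = - \<i> * fourier_coeff ?f k" for k
    unfolding fourier_coeff_def by (subst integral_mult_right_zero[symmetric]) (simp add: mult.assoc)
  then have "AE z in circle_measure. Re (- \<i> * ?f z) = 0"
    by (intro AE_Re_eq_0_if_fourier_zero square_integrable_scale sq) (simp add: z)
  with AE_Re_eq_0_if_fourier_zero[OF sq z] have "AE z in circle_measure. ?f z = 0"
    by eventually_elim (simp add: complex_eq_iff)
  then have "(\<integral>z. ?f z * cnj (?f z) \<partial>circle_measure) = 0"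
    by (intro integral_eq_zero_AE) (auto elim: eventually_mono)
  then show ?thesis
    using cinner_L2[of f f] by simp
qed

lemma norm_L2: "(norm f)\<^sup>2 = (\<integral>z. (norm (rep_L2_circle f z))\<^sup>2 \<partial>circle_measure)"
proof -
  have "complex_of_real ((norm f)\<^sup>2) = complex_of_real (\<integral>z. (norm (rep_L2_circle f z))\<^sup>2 \<partial>circle_measure)"
    unfolding cinner_self[symmetric] cinner_L2 complex_norm_square[symmetric]
    by (rule integral_complex_of_real)
  then show ?thesis using of_real_eq_iff by blast
qed

text \<open>The variance of the modulus of \<open>f\<close> is nonnegative, the circle having total
  mass 1.\<close>

lemma L1_le_L2: "(\<integral>z. norm (rep_L2_circle f z) \<partial>circle_measure) \<le> norm f"
proof -
  let ?f = "\<lambda>z. norm (rep_L2_circle f z)"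
  define m where "m = integral\<^sup>L circle_measure ?f"
  note sq = square_integrable_rep[of f]
  have i1: "integrable circle_measure ?f"
    using integrable_of_square_integrable[OF sq] by simp
  have i2: "integrable circle_measure (\<lambda>z. (?f z)\<^sup>2)"
    using sq by (simp add: square_integrable_def)
  have one: "measure circle_measure UNIV = 1"
    using emeasure_circle_measure_UNIV by (simp add: measure_def)
  have "0 \<le> (\<integral>z. (?f z - m)\<^sup>2 \<partial>circle_measure)" by simp
  also have "\<dots> = (\<integral>z. (?f z)\<^sup>2 - 2 * m * ?f z + m\<^sup>2 \<partial>circle_measure)"
    by (simp add: power2_diff algebra_simps)
  also have "\<dots> = (norm f)\<^sup>2 - 2 * m * m + m\<^sup>2"
    using i1 i2 by (simp add: norm_L2 m_def one)
  finally have "m\<^sup>2 \<le> (norm f)\<^sup>2" by (simp add: power2_eq_square)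
  then show ?thesis unfolding m_def[symmetric] by (rule power2_le_imp_le) simp
qed

lemma rep_diff_L2: "AE z in circle_measure. rep_L2_circle (f - g) z = rep_L2_circle f z - rep_L2_circle g z"
proof -
  have "f - g = abs_L2_circle (\<lambda>z. rep_L2_circle f z + (- 1) * rep_L2_circle g z)"
  proof -
    have "f + scaleC (- 1) g = abs_L2_circle (rep_L2_circle f) + scaleC (- 1) (abs_L2_circle (rep_L2_circle g))"
      by (simp add: abs_rep_L2)
    also have "\<dots> = abs_L2_circle (\<lambda>z. rep_L2_circle f z + (- 1) * rep_L2_circle g z)"
      using L2_rel_rep[of f] L2_rel_rep[of g] square_integrable_scale[OF square_integrable_rep, of "- 1" g]
      by (subst scaleC_L2_circle.abs_eq, simp, subst plus_L2_circle.abs_eq) (auto simp: L2_rel_def)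
    finally show ?thesis by (simp add: diff_eq_scaleC)
  qed
  then show ?thesis
    using rep_abs_L2[OF square_integrable_add[OF square_integrable_rep square_integrable_scale[OF square_integrable_rep]], of f "- 1" g]
    by simp
qed

lemma norm_diff_L2:
  assumes "square_integrable h"
  shows "ennreal ((norm (f - abs_L2_circle h))\<^sup>2) = (\<integral>\<^sup>+z. ennreal ((norm (rep_L2_circle f z - h z))\<^sup>2) \<partial>circle_measure)"
proof -
  let ?d = "f - abs_L2_circle h"
  have "ennreal ((norm ?d)\<^sup>2) = (\<integral>\<^sup>+z. ennreal ((norm (rep_L2_circle ?d z))\<^sup>2) \<partial>circle_measure)"
    unfolding norm_L2 using square_integrable_rep[of ?d]
    by (intro nn_integral_eq_integral[symmetric]) (auto simp: square_integrable_def)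
  also have "\<dots> = (\<integral>\<^sup>+z. ennreal ((norm (rep_L2_circle f z - h z))\<^sup>2) \<partial>circle_measure)"
  proof (rule nn_integral_cong_AE)
    show "AE z in circle_measure. ennreal ((norm (rep_L2_circle ?d z))\<^sup>2) = ennreal ((norm (rep_L2_circle f z - h z))\<^sup>2)"
      using rep_diff_L2[of f "abs_L2_circle h"] rep_abs_L2[OF assms] by eventually_elim simp
  qed
  finally show ?thesis .
qed

text \<open>Riesz--Fischer: an \<open>L\<^sup>2\<close> Cauchy sequence is \<open>L\<^sup>1\<close> Cauchy, hence converges almost everywhere
  along a subsequence; Fatou's lemma identifies the limit.\<close>

lemma complete_L2_circle: "complete (UNIV :: L2_circle set)"
  unfolding complete_def
proof (intro allI impI, elim conjE)
  fix X :: "nat \<Rightarrow> L2_circle" assume X: "Cauchy X"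
  let ?r = rep_L2_circle
  have rm [measurable]: "?r f \<in> borel_measurable borel" for f
    using square_integrable_rep[of f] by (simp add: square_integrable_def)
  have L1: "(LINT z|circle_measure. norm (?r f z - ?r g z)) \<le> norm (f - g)" for f g
  proof -
    have "(LINT z|circle_measure. norm (?r f z - ?r g z)) = (LINT z|circle_measure. norm (?r (f - g) z))"
    proof (rule integral_cong_AE)
      show "AE z in circle_measure. norm (?r f z - ?r g z) = norm (?r (f - g) z)"
        using rep_diff_L2[of f g] by eventually_elim simp
    qed auto
    then show ?thesis using L1_le_L2[of "f - g"] by simp
  qed
  obtain s where s: "strict_mono s" and AEc: "AE z in circle_measure. Cauchy (\<lambda>i. ?r (X (s i)) z)"
  proof (rule cauchy_L1_AE_cauchy_subseq[of circle_measure "\<lambda>n. ?r (X n)"])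
    show "integrable circle_measure (?r (X n))" for n
      by (rule integrable_of_square_integrable[OF square_integrable_rep])
    fix e :: real assume "0 < e"
    then obtain N where N: "\<And>i j. N \<le> i \<Longrightarrow> N \<le> j \<Longrightarrow> norm (X i - X j) < e"
      using X unfolding Cauchy_iff by blast
    show "\<exists>N. \<forall>i\<ge>N. \<forall>j\<ge>N. (LINT z|circle_measure. norm (?r (X i) z - ?r (X j) z)) < e"
      using N L1 order_le_less_trans by blast
  qed
  define h where "h z = lim (\<lambda>i. ?r (X (s i)) z)" for z
  have [measurable]: "h \<in> borel_measurable borel"
    unfolding h_def[abs_def] by measurable
  have lim: "AE z in circle_measure. (\<lambda>i. ?r (X (s i)) z) \<longlonglongrightarrow> h z"
    using AEc by eventually_elim (simp add: h_def Cauchy_convergent_iff convergent_LIMSEQ_iff)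
  have fatou: "(\<integral>\<^sup>+z. ennreal ((norm (?r (X m) z - h z))\<^sup>2) \<partial>circle_measure) \<le> ennreal (e\<^sup>2)"
    if e: "0 < e" and N: "\<And>i j. N \<le> i \<Longrightarrow> N \<le> j \<Longrightarrow> norm (X i - X j) < e" and m: "N \<le> m" for e N m
  proof -
    have "(\<integral>\<^sup>+z. ennreal ((norm (?r (X m) z - h z))\<^sup>2) \<partial>circle_measure) =
        (\<integral>\<^sup>+z. liminf (\<lambda>i. ennreal ((norm (?r (X m) z - ?r (X (s i)) z))\<^sup>2)) \<partial>circle_measure)"
    proof (rule nn_integral_cong_AE)
      show "AE z in circle_measure. ennreal ((norm (?r (X m) z - h z))\<^sup>2) =
          liminf (\<lambda>i. ennreal ((norm (?r (X m) z - ?r (X (s i)) z))\<^sup>2))"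
        using lim
      proof eventually_elim
        case (elim z)
        have "(\<lambda>i. ennreal ((norm (?r (X m) z - ?r (X (s i)) z))\<^sup>2)) \<longlonglongrightarrow> ennreal ((norm (?r (X m) z - h z))\<^sup>2)"
          by (intro tendsto_ennrealI tendsto_intros elim)
        then show ?case
          using lim_imp_Liminf[of sequentially] by force
      qed
    qed
    also have "\<dots> \<le> liminf (\<lambda>i. \<integral>\<^sup>+z. ennreal ((norm (?r (X m) z - ?r (X (s i)) z))\<^sup>2) \<partial>circle_measure)"
      by (rule nn_integral_liminf) measurable
    also have "\<dots> \<le> ennreal (e\<^sup>2)"
    proof (rule Liminf_le)
      show "eventually (\<lambda>i. (\<integral>\<^sup>+z. ennreal ((norm (?r (X m) z - ?r (X (s i)) z))\<^sup>2) \<partial>circle_measure) \<le> ennreal (e\<^sup>2)) sequentially"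
      proof (rule eventually_sequentiallyI[of N])
        fix i assume "N \<le> i"
        then have "N \<le> s i" using seq_suble[OF s, of i] by simp
        then have "(norm (X m - X (s i)))\<^sup>2 \<le> e\<^sup>2"
          using N[OF m] by (intro power_mono) (auto intro: less_imp_le)
        then show "(\<integral>\<^sup>+z. ennreal ((norm (?r (X m) z - ?r (X (s i)) z))\<^sup>2) \<partial>circle_measure) \<le> ennreal (e\<^sup>2)"
          unfolding norm_diff_L2[OF square_integrable_rep, of "X m" "X (s i)", unfolded abs_rep_L2, symmetric]
          by (rule ennreal_leI)
      qed
    qed simp
    finally show ?thesis .
  qed
  \<comment> \<open>The Fatou bound with \<open>e = 1\<close> shows that \<open>h\<close> differs by
    a square-integrable function from a representative of \<open>X N\<close>.\<close>
  have sh: "square_integrable h"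
  proof -
    obtain N where N: "\<And>i j. N \<le> i \<Longrightarrow> N \<le> j \<Longrightarrow> norm (X i - X j) < 1"
      using X unfolding Cauchy_iff by (meson zero_less_one)
    have "(\<integral>\<^sup>+z. ennreal ((norm (?r (X N) z - h z))\<^sup>2) \<partial>circle_measure) < \<infinity>"
      by (rule le_less_trans[OF fatou[OF zero_less_one N order_refl]]) simp_all
    then have "square_integrable (\<lambda>z. ?r (X N) z - h z)"
      unfolding square_integrable_def by (auto intro!: integrableI_nonneg)
    from square_integrable_add[OF square_integrable_rep[of "X N"] square_integrable_scale[OF this, of "- 1"]]
    show ?thesis by simp
  qed
  have "X \<longlonglongrightarrow> abs_L2_circle h"
  proof (rule metric_LIMSEQ_I)
    fix e :: real assume e: "0 < e"
    then obtain N where N: "\<And>i j. N \<le> i \<Longrightarrow> N \<le> j \<Longrightarrow> norm (X i - X j) < e / 2"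
      using X unfolding Cauchy_iff by (meson half_gt_zero)
    have "dist (X m) (abs_L2_circle h) < e" if "N \<le> m" for m
    proof -
      have "ennreal ((norm (X m - abs_L2_circle h))\<^sup>2) \<le> ennreal ((e / 2)\<^sup>2)"
        unfolding norm_diff_L2[OF sh] by (rule fatou[OF half_gt_zero[OF e] N that])
      then have "(norm (X m - abs_L2_circle h))\<^sup>2 \<le> (e / 2)\<^sup>2"
        by (subst (asm) ennreal_le_iff) auto
      then have "norm (X m - abs_L2_circle h) \<le> e / 2"
        by (rule power2_le_imp_le) (use e in simp)
      then show ?thesis using e by (simp add: dist_norm)
    qed
    then show "\<exists>no. \<forall>n\<ge>no. dist (X n) (abs_L2_circle h) < e" by blast
  qed
  then show "\<exists>l\<in>UNIV. X \<longlonglongrightarrow> l" by blast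
qed

section \<open>The Hardy space\<close>

definition coef :: "L2_circle \<Rightarrow> nat \<Rightarrow> complex" where
  "coef f n = cinner f (monomial (int n))"

lemma coef_linear [simp]:
  "coef (f + g) n = coef f n + coef g n"
  "coef (f - g) n = coef f n - coef g n"
  "coef (scaleC c f) n = c * coef f n"
  "coef 0 n = 0"
  by (simp_all add: coef_def cinner_simps)

lemma H2_iff: "f \<in> H2 \<longleftrightarrow> (\<forall>k<0. cinner f (monomial k) = 0)"
  by (simp add: H2_def fourier_coeff_rep)

lemma closed_H2: "closed H2"
  unfolding closed_sequential_limits
proof (intro allI impI, elim conjE)
  fix X f assume X: "\<forall>n. X n \<in> H2" "X \<longlonglongrightarrow> f"
  have "cinner f (monomial k) = 0" if "k < 0" for k
  proof -
    have "(\<lambda>n. cinner (X n) (monomial k)) \<longlonglongrightarrow> cinner f (monomial k)"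
      by (intro tendsto_intros X)
    then show ?thesis
      using X(1) that by (simp add: H2_iff LIMSEQ_const_iff)
  qed
  then show "f \<in> H2" by (simp add: H2_iff)
qed

lemma hilbert_subspace_H2: "hilbert_subspace H2"
proof (rule hilbert_subspace_closed_subset[OF _ subset_UNIV closed_H2])
  show "hilbert_subspace (UNIV :: L2_circle set)"
    by standard (auto simp: complete_L2_circle)
qed (auto simp: H2_iff cinner_simps)

interpretation H2: hilbert_subspace H2
  by (rule hilbert_subspace_H2)

lemma H2_eqI:
  assumes f: "f \<in> H2" and g: "g \<in> H2" and eq: "\<And>n. coef f n = coef g n"
  shows "f = g"
proof -
  have "cinner (f - g) (monomial k) = 0" for k
  proof (cases "k < 0")
    case True
    then show ?thesis using f g by (simp add: H2_iff cinner_diff_left)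
  next
    case False
    then show ?thesis
      using eq[of "nat k"] by (simp add: coef_def cinner_diff_left)
  qed
  then have "f - g = 0" by (rule L2_circle_eq_0I)
  then show ?thesis by simp
qed

lemma monomial_H2: "monomial (int n) \<in> H2"
  by (simp add: H2_iff cinner_monomial)

lemma coef_monomial: "coef (monomial (int m)) n = (if m = n then 1 else 0)"
  by (simp add: coef_def cinner_monomial)

lemma H2_series:
  assumes c: "summable (\<lambda>n. (norm (c n))\<^sup>2)"
  obtains f where "f \<in> H2" "\<And>n. coef f n = c n" "(\<lambda>n. scaleC (c n) (monomial (int n))) sums f"
proof -
  have norm1: "norm (monomial k) = 1" for k
    using cinner_self[of "monomial k"] by (simp add: cinner_monomial power2_eq_1_iff)
      (metis norm_ge_zero of_real_1 of_real_eq_iff of_real_power power2_eq_1_iff neg_0_le_iff_le not_one_le_zero)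
  have "\<exists>f\<in>H2. (\<lambda>n. scaleC (c n) (monomial (int n))) sums f"
    by (rule H2.orthogonal_series)
      (use c in \<open>auto simp: monomial_H2 cinner_simps cinner_monomial norm1\<close>)
  then obtain f where f: "f \<in> H2" "(\<lambda>n. scaleC (c n) (monomial (int n))) sums f" by blast
  have "coef f m = c m" for m
  proof -
    have "(\<lambda>n. cinner (scaleC (c n) (monomial (int n))) (monomial (int m))) sums coef f m"
      unfolding coef_def by (rule bounded_linear.sums[OF bounded_linear_cinner_left f(2)])
    moreover have "(\<lambda>n. cinner (scaleC (c n) (monomial (int n))) (monomial (int m))) = (\<lambda>n. if n = m then c n else 0)"
      by (auto simp: cinner_scaleC_left cinner_monomial)
    ultimately show ?thesis
      using sums_single[of m c] sums_unique2 by force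
  qed
  then show thesis using that f by blast
qed

lemma bessel: "summable (\<lambda>n. (norm (coef f n))\<^sup>2)"
proof (rule summableI_nonneg_bounded)
  fix N
  define S where "S = (\<Sum>n<N. scaleC (coef f n) (monomial (int n)))"
  have S: "coef S n = (if n < N then coef f n else 0)" for n
  proof -
    have "coef S n = (\<Sum>m<N. if m = n then coef f n else 0)"
      unfolding S_def coef_def[of "\<Sum>m<N. _ m"] cinner_sum_left
      by (intro sum.cong) (auto simp: cinner_scaleC_left cinner_monomial)
    then show ?thesis by simp
  qed
  have "cinner f S = (\<Sum>n<N. complex_of_real ((norm (coef f n))\<^sup>2))"
    unfolding S_def by (simp add: cinner_sum_right cinner_scaleC_right coef_def[symmetric]
        complex_norm_square mult.commute del: of_real_power)
  moreover have "cinner S S = (\<Sum>n<N. complex_of_real ((norm (coef f n))\<^sup>2))"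
  proof -
    have "cinner S S = (\<Sum>n<N. cnj (coef f n) * coef S n)"
      by (subst (2) S_def) (simp add: cinner_sum_right cinner_scaleC_right coef_def[symmetric])
    then show ?thesis
      by (simp add: S complex_norm_square mult.commute del: of_real_power)
  qed
  ultimately have "cinner f S = complex_of_real (\<Sum>n<N. (norm (coef f n))\<^sup>2)"
    "complex_of_real ((norm S)\<^sup>2) = complex_of_real (\<Sum>n<N. (norm (coef f n))\<^sup>2)"
    by (simp_all only: cinner_self of_real_sum)
  then have "Re (cinner f S) = (\<Sum>n<N. (norm (coef f n))\<^sup>2)" "(norm S)\<^sup>2 = (\<Sum>n<N. (norm (coef f n))\<^sup>2)"
    by (simp_all only: Re_complex_of_real of_real_eq_iff)
  then show "(\<Sum>n<N. (norm (coef f n))\<^sup>2) \<le> (norm f)\<^sup>2"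
    using norm_sq_diff[of f S] zero_le_power2[of "norm (f - S)"] by simp
qed simp

text \<open>By Bessel's inequality the series converges to some \<open>g\<close> in
  \<open>H2\<close>; \<open>g\<close> has the coefficients of \<open>f\<close>, and these determine
  elements of \<open>H2\<close>.\<close>

lemma H2_expansion:
  assumes f: "f \<in> H2"
  shows "(\<lambda>n. scaleC (coef f n) (monomial (int n))) sums f"
proof -
  obtain g where g: "g \<in> H2" "\<And>n. coef g n = coef f n" "(\<lambda>n. scaleC (coef f n) (monomial (int n))) sums g"
    using H2_series[OF bessel] by blast
  then show ?thesis using H2_eqI[OF g(1) f g(2)] by simp
qed

lemma parseval_left:
  assumes "f \<in> H2"
  shows "(\<lambda>n. coef f n * cnj (coef g n)) sums cinner f g"
proof -
  have "cinner (monomial (int n)) g = cnj (coef g n)" for n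
    unfolding coef_def by (rule cinner_commute)
  then show ?thesis
    using bounded_linear.sums[OF bounded_linear_cinner_left H2_expansion[OF assms], of g]
    by (simp add: cinner_scaleC_left)
qed

subsection \<open>The shift\<close>

lemma shift_abs: "square_integrable f \<Longrightarrow> shift (abs_L2_circle f) = abs_L2_circle (\<lambda>z. z * f z)"
  by (intro shift.abs_eq) (simp add: L2_rel_def)

lemma shift_eq: "shift f = abs_L2_circle (\<lambda>z. z * rep_L2_circle f z)"
  using shift_abs[OF square_integrable_rep[of f]] by (simp add: abs_rep_L2)

lemma shift_funpow: "(shift ^^ k) f = abs_L2_circle (\<lambda>z. z ^ k * rep_L2_circle f z) \<and>
  square_integrable (\<lambda>z. z ^ k * rep_L2_circle f z)"
proof (induction k)
  case 0
  show ?case by (simp add: abs_rep_L2 square_integrable_rep)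
next
  case (Suc k)
  then show ?case
    using shift_abs square_integrable_shift[of "\<lambda>z. z ^ k * rep_L2_circle f z"] by (simp add: mult.assoc)
qed

lemma cinner_shift_shift: "cinner (shift f) (shift g) = cinner f g"
proof -
  have [measurable]: "rep_L2_circle f \<in> borel_measurable borel" "rep_L2_circle g \<in> borel_measurable borel"
    using square_integrable_rep by (auto simp: square_integrable_def)
  have "cinner (shift f) (shift g) =
      (\<integral>z. (z * rep_L2_circle f z) * cnj (z * rep_L2_circle g z) \<partial>circle_measure)"
    unfolding shift_eq by (intro cinner_abs_L2 square_integrable_shift square_integrable_rep)
  also have "\<dots> = cinner f g"
    unfolding cinner_L2
  proof (rule integral_cong_AE)
    show "AE z in circle_measure. (z * rep_L2_circle f z) * cnj (z * rep_L2_circle g z) =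
        rep_L2_circle f z * cnj (rep_L2_circle g z)"
      using AE_circle_norm_1
    proof eventually_elim
      case (elim z)
      have "(z * rep_L2_circle f z) * cnj (z * rep_L2_circle g z) =
          (z * cnj z) * (rep_L2_circle f z * cnj (rep_L2_circle g z))" by simp
      then show ?case using elim by (simp flip: complex_norm_square)
    qed
  qed auto
  finally show ?thesis .
qed

lemma shift_monomial: "shift (monomial k) = monomial (k + 1)"
proof -
  have "L2_rel (\<lambda>z. z * z powi k) (\<lambda>z. z powi (k + 1))"
    unfolding L2_rel_def
  proof (intro conjI square_integrable_shift square_integrable_powi)
    show "AE z in circle_measure. z * z powi k = z powi (k + 1)"
      using AE_circle_powi[of 1] by eventually_elim (simp add: power_int_add_1')
  qed
  then show ?thesis
    unfolding monomial_def shift_abs[OF square_integrable_powi]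
    by (rule Quotient3_rel_abs[OF Quotient3_L2_circle])
qed

lemma cinner_shift_monomial: "cinner (shift f) (monomial (k + 1)) = cinner f (monomial k)"
  using cinner_shift_shift[of f "monomial k"] by (simp add: shift_monomial)

lemma shift_add: "shift (f + g) = shift f + shift g"
  by transfer (auto simp: L2_rel_def distrib_left intro!: square_integrable_add square_integrable_shift
      intro: square_integrable_shift[OF square_integrable_add, simplified distrib_left])

lemma shift_scaleC: "shift (scaleC c f) = scaleC c (shift f)"
  by transfer (auto simp: L2_rel_def mult.left_commute
      intro: square_integrable_scale square_integrable_shift)

lemma shift_H2: "f \<in> H2 \<Longrightarrow> shift f \<in> H2"
  using cinner_shift_monomial[of f "k - 1" for k] by (auto simp: H2_iff)

lemma coef_shift_0: "f \<in> H2 \<Longrightarrow> coef (shift f) 0 = 0"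
  using cinner_shift_monomial[of f "- 1"] by (simp add: coef_def H2_iff)

lemma coef_shift_Suc: "coef (shift f) (Suc n) = coef f n"
  using cinner_shift_monomial[of f "int n"] by (simp add: coef_def add.commute)

lemma norm_shift: "norm (shift f) = norm f"
  using cinner_shift_shift[of f f] by (simp add: cinner_self)
    (metis norm_ge_zero of_real_eq_iff of_real_power power2_eq_iff_nonneg)

lemma bounded_op_shift: "bounded_op H2 shift"
  by (rule bounded_opI[where K = 1]) (auto simp: shift_H2 shift_add shift_scaleC norm_shift)

lemma coef_shift_funpow_less: "f \<in> H2 \<Longrightarrow> n < k \<Longrightarrow> coef ((shift ^^ k) f) n = 0"
proof (induction k arbitrary: n)
  case (Suc k)
  have "(shift ^^ k) f \<in> H2" using Suc.prems(1) by (induction k) (auto simp: shift_H2)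
  then show ?case
    using Suc by (cases n) (auto simp: coef_shift_0 coef_shift_Suc)
qed simp

lemma coef_shift_funpow: "coef ((shift ^^ k) f) (n + k) = coef f n"
  by (induction k) (auto simp: coef_shift_Suc)

subsection \<open>Complex conjugation of coefficients\<close>

text \<open>The map \<open>C\<close> sending \<open>f\<close> to the conjugate of \<open>f\<close>
  at the conjugate point. Working with coefficients avoids representatives of classes; the series
  with conjugated coefficients converges by Bessel's inequality.\<close>

definition conj_coef :: "L2_circle \<Rightarrow> L2_circle" where
  "conj_coef f = (SOME g. g \<in> H2 \<and> (\<forall>n. coef g n = cnj (coef f n)))"

lemma conj_coef: "conj_coef f \<in> H2" "coef (conj_coef f) n = cnj (coef f n)"
proof -
  have "summable (\<lambda>n. (norm (cnj (coef f n)))\<^sup>2)"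
    using bessel[of f] by simp
  then have "\<exists>g. g \<in> H2 \<and> (\<forall>n. coef g n = cnj (coef f n))"
    by (rule H2_series) blast
  from someI_ex[OF this] show "conj_coef f \<in> H2" "coef (conj_coef f) n = cnj (coef f n)"
    by (auto simp: conj_coef_def)
qed

lemma conj_coef_shift: "f \<in> H2 \<Longrightarrow> conj_coef (shift f) = shift (conj_coef f)"
proof (rule H2_eqI[OF conj_coef(1) shift_H2[OF conj_coef(1)]])
  fix n assume "f \<in> H2"
  then show "coef (conj_coef (shift f)) n = coef (shift (conj_coef f)) n"
    by (cases n) (auto simp: conj_coef coef_shift_0 coef_shift_Suc)
qed

lemma conj_coef_conj_coef: "f \<in> H2 \<Longrightarrow> conj_coef (conj_coef f) = f"
  by (rule H2_eqI) (auto simp: conj_coef)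

section \<open>Self-adjoint Hankel operators\<close>

locale self_adjoint_hankel =
  fixes u :: L2_circle
  assumes u: "u \<in> H2" and self_adjoint: "self_adjoint_op H2 (Gamma_op u)"
begin

abbreviation \<Gamma> :: "L2_circle \<Rightarrow> L2_circle" where "\<Gamma> \<equiv> Gamma_op u"
abbreviation \<Gamma>' :: "L2_circle \<Rightarrow> L2_circle" where "\<Gamma>' \<equiv> Gamma_tilde u"

lemmas bounded = self_adjoint_opD(1)[OF self_adjoint]
lemmas \<Gamma>_mem = bounded_opD(1)[OF bounded]

definition hankel_image :: "L2_circle \<Rightarrow> L2_circle \<Rightarrow> bool" where
  "hankel_image f h \<longleftrightarrow> h \<in> H2 \<and> (\<forall>j. (\<lambda>k. coef u (j + k) * coef f k) sums coef h j)"

lemma Gamma_eq_THE: "\<Gamma> f = (THE h. hankel_image f h)"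
  by (simp add: Gamma_op_def hankel_image_def fourier_coeff_rep coef_def)

lemma hankel_image_unique: "hankel_image f g \<Longrightarrow> hankel_image f h \<Longrightarrow> g = h"
  unfolding hankel_image_def by (intro H2_eqI) (auto intro: sums_unique2)

lemma Gamma_eqI: "hankel_image f h \<Longrightarrow> \<Gamma> f = h"
  unfolding Gamma_eq_THE by (rule the_equality) (auto intro: hankel_image_unique)

lemma hankel_image_one: "hankel_image (monomial 0) u"
proof -
  have "(\<lambda>k. coef u (j + k) * coef (monomial 0) k) sums coef u j" for j
  proof -
    have "(\<lambda>k. coef u (j + k) * coef (monomial 0) k) = (\<lambda>k. if k = 0 then coef u (j + k) else 0)"
      using coef_monomial[of 0] by auto
    then show ?thesis using sums_single[of 0 "\<lambda>k. coef u (j + k)"] by simp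
  qed
  then show ?thesis using u by (simp add: hankel_image_def)
qed

text \<open>If some vector had no image, \<open>Gamma_op u\<close> would take the junk value of \<open>THE\<close> there; linearity
  then forces the junk value, and with it \<open>u\<close>, to vanish.\<close>

lemma hankel_image_Gamma:
  assumes f: "f \<in> H2"
  shows "hankel_image f (\<Gamma> f)"
proof -
  have "\<exists>h. hankel_image f h"
  proof (rule ccontr)
    assume none: "\<nexists>h. hankel_image f h"
    have junk: "\<Gamma> g = (THE h. False)" if "\<nexists>h. hankel_image g h" for g
      using that by (simp add: Gamma_eq_THE)
    have "\<nexists>h. hankel_image (scaleC 2 f) h"
    proof
      assume "\<exists>h. hankel_image (scaleC 2 f) h"
      then obtain h where h: "hankel_image (scaleC 2 f) h" by blast
      have "(\<lambda>k. coef u (j + k) * coef f k) sums ((1/2) * coef h j)" for j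
        using h sums_mult[of "\<lambda>k. coef u (j + k) * coef (scaleC 2 f) k" "coef h j" "1/2"]
        by (simp add: hankel_image_def mult.left_commute)
      then have "hankel_image f (scaleC (1/2) h)"
        using h by (simp add: hankel_image_def)
      then show False using none by blast
    qed
    then have "\<Gamma> (scaleC 2 f) = \<Gamma> f" using junk none by simp
    then have "scaleC 2 (\<Gamma> f) = \<Gamma> f" using bounded_opD(3)[OF bounded f] by simp
    then have 0: "\<Gamma> f = 0"
      using scaleC_diff_left[of 2 1 "\<Gamma> f"] by simp
    have "\<nexists>h. hankel_image (f + monomial 0) h"
    proof
      assume "\<exists>h. hankel_image (f + monomial 0) h"
      then obtain h where h: "hankel_image (f + monomial 0) h" by blast
      have "(\<lambda>k. coef u (j + k) * coef f k) sums (coef h j - coef u j)" for j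
        using h hankel_image_one
          sums_diff[of "\<lambda>k. coef u (j + k) * coef (f + monomial 0) k" "coef h j"
            "\<lambda>k. coef u (j + k) * coef (monomial 0) k" "coef u j"]
        by (simp add: hankel_image_def distrib_left)
      then have "hankel_image f (h - u)"
        using h u by (simp add: hankel_image_def)
      then show False using none by blast
    qed
    then have "\<Gamma> (f + monomial 0) = \<Gamma> f" using junk none by simp
    then have "u = 0"
      using bounded_opD(2)[OF bounded f monomial_H2[of 0]] Gamma_eqI[OF hankel_image_one] by simp
    then have "hankel_image f 0" unfolding hankel_image_def by simp
    then show False using none by blast
  qed
  then show ?thesis using Gamma_eqI by auto
qed

lemma coef_Gamma: "f \<in> H2 \<Longrightarrow> (\<lambda>k. coef u (j + k) * coef f k) sums coef (\<Gamma> f) j"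
  using hankel_image_Gamma by (simp add: hankel_image_def)

lemma Gamma_one: "\<Gamma> (monomial 0) = u"
  by (rule Gamma_eqI[OF hankel_image_one])

lemma coef_Gamma_monomial: "coef (\<Gamma> (monomial (int m))) j = coef u (j + m)"
proof -
  have "(\<lambda>k. coef u (j + k) * coef (monomial (int m)) k) = (\<lambda>k. if k = m then coef u (j + k) else 0)"
    by (auto simp: coef_monomial)
  then show ?thesis
    using coef_Gamma[OF monomial_H2[of m], of j] sums_single[of m "\<lambda>k. coef u (j + k)"] sums_unique2 by force
qed

text \<open>A Hankel matrix is symmetric, so being Hermitian means being real. Testing on the
  monomials of degree \<open>n\<close> and 0 already reaches every coefficient of
  \<open>u\<close>.\<close>

lemma cnj_coef_u: "cnj (coef u n) = coef u n"
proof -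
  have "coef (\<Gamma> (monomial (int n))) 0 = cnj (coef (\<Gamma> (monomial (int 0))) n)"
    using self_adjoint_opD(2)[OF self_adjoint monomial_H2[of n] monomial_H2[of 0]]
      cinner_commute[of "monomial (int n)" "\<Gamma> (monomial (int 0))"]
    by (simp only: coef_def)
  then show ?thesis
    by (simp only: coef_Gamma_monomial add_0 add_0_right)
qed

lemma conj_coef_Gamma: "f \<in> H2 \<Longrightarrow> conj_coef (\<Gamma> f) = \<Gamma> (conj_coef f)"
proof (rule H2_eqI[OF conj_coef(1) \<Gamma>_mem[OF conj_coef(1)]])
  fix n assume f: "f \<in> H2"
  have "(\<lambda>k. cnj (coef u (n + k) * coef f k)) sums cnj (coef (\<Gamma> f) n)"
    using coef_Gamma[OF f, of n] by (simp only: sums_cnj)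
  then have "(\<lambda>k. coef u (n + k) * coef (conj_coef f) k) sums cnj (coef (\<Gamma> f) n)"
    by (simp add: conj_coef cnj_coef_u)
  then show "coef (conj_coef (\<Gamma> f)) n = coef (\<Gamma> (conj_coef f)) n"
    using coef_Gamma[OF conj_coef(1)] sums_unique2 by (simp add: conj_coef) blast
qed

text \<open>The commutation of \<open>\<Gamma>\<close> with the shift and its adjoint, in
  coefficients: the matrix depends only on the sum of the indices, so shifting the argument amounts
  to dropping the first coefficient of the image.\<close>

lemma coef_Gamma_tilde: "f \<in> H2 \<Longrightarrow> coef (\<Gamma>' f) j = coef (\<Gamma> f) (Suc j)"
proof -
  assume f: "f \<in> H2"
  have "(\<lambda>k. coef u (j + Suc k) * coef (shift f) (Suc k)) sums (coef (\<Gamma> (shift f)) j - coef u (j + 0) * coef (shift f) 0)"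
    using coef_Gamma[OF shift_H2[OF f], of j] by (subst sums_Suc_iff) simp
  then have "(\<lambda>k. coef u (Suc j + k) * coef f k) sums coef (\<Gamma>' f) j"
    by (simp add: coef_shift_Suc coef_shift_0[OF f] Gamma_tilde_def)
  then show ?thesis
    using coef_Gamma[OF f, of "Suc j"] sums_unique2 by blast
qed

lemma bounded_Gamma_tilde: "bounded_op H2 \<Gamma>'"
  using H2.bounded_op_compose[OF bounded bounded_op_shift] by (simp add: Gamma_tilde_def comp_def)

lemmas \<Gamma>'_mem = bounded_opD(1)[OF bounded_Gamma_tilde]

lemma cinner_split:
  assumes "f \<in> H2"
  shows "(\<lambda>n. coef f (Suc n) * cnj (coef g (Suc n))) sums (cinner f g - coef f 0 * cnj (coef g 0))"
  by (subst sums_Suc_iff) (use parseval_left[OF assms] in simp)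

text \<open>Moving \<open>\<Gamma>\<close> across leaves the shift on the left; by Parseval with the
  index moved by one, this is dropping the first coefficient on the right, that is,
  \<open>\<Gamma>'\<close> again.\<close>

lemma self_adjoint_Gamma_tilde: "self_adjoint_op H2 \<Gamma>'"
  unfolding self_adjoint_op_def
proof (intro conjI ballI bounded_Gamma_tilde)
  fix f g assume f: "f \<in> H2" and g: "g \<in> H2"
  have "cinner (\<Gamma>' f) g = cinner (shift f) (\<Gamma> g)"
    using self_adjoint_opD(2)[OF self_adjoint shift_H2[OF f] g] by (simp add: Gamma_tilde_def)
  moreover have "(\<lambda>n. coef f n * cnj (coef (\<Gamma>' g) n)) sums cinner (shift f) (\<Gamma> g)"
    using cinner_split[OF shift_H2[OF f], of "\<Gamma> g"]
    by (simp add: coef_shift_Suc coef_shift_0[OF f] coef_Gamma_tilde[OF g])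
  ultimately show "cinner (\<Gamma>' f) g = cinner f (\<Gamma>' g)"
    using parseval_left[OF f, of "\<Gamma>' g"] sums_unique2 by metis
qed

text \<open>Compared with \<open>\<Gamma>\<close>, only the product of the coefficients of index 0
  is missing, and such a coefficient is an inner product with \<open>u\<close> because
  \<open>u\<close> is the image of the constant function 1.\<close>

lemma cinner_Gamma_tilde:
  assumes f: "f \<in> H2" and g: "g \<in> H2"
  shows "cinner (\<Gamma>' f) (\<Gamma>' g) = cinner (\<Gamma> f) (\<Gamma> g) - cinner f u * cnj (cinner g u)"
proof -
  have 0: "coef (\<Gamma> h) 0 = cinner h u" if "h \<in> H2" for h
    using self_adjoint_opD(2)[OF self_adjoint that monomial_H2[of 0]] by (simp add: coef_def Gamma_one)
  have "(\<lambda>n. coef (\<Gamma>' f) n * cnj (coef (\<Gamma>' g) n)) sums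
      (cinner (\<Gamma> f) (\<Gamma> g) - coef (\<Gamma> f) 0 * cnj (coef (\<Gamma> g) 0))"
    using cinner_split[OF \<Gamma>_mem[OF f], of "\<Gamma> g"] by (simp add: coef_Gamma_tilde f g)
  then show ?thesis
    using parseval_left[OF \<Gamma>'_mem[OF f], of "\<Gamma>' g"] sums_unique2 by (simp add: 0 f g) blast
qed

text \<open>The two squares differ by a rank-one operator. This is the only link between them that
  is used: they agree on vectors orthogonal to \<open>u\<close>.\<close>

lemma Gamma_tilde_square:
  assumes f: "f \<in> H2"
  shows "\<Gamma>' (\<Gamma>' f) = \<Gamma> (\<Gamma> f) - scaleC (cinner f u) u"
proof (rule H2.cinner_eqI)
  show "\<Gamma>' (\<Gamma>' f) \<in> H2" "\<Gamma> (\<Gamma> f) - scaleC (cinner f u) u \<in> H2"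
    using f u by (auto simp: \<Gamma>_mem \<Gamma>'_mem)
  fix g assume g: "g \<in> H2"
  have "cinner (\<Gamma>' (\<Gamma>' f)) g = cinner (\<Gamma> f) (\<Gamma> g) - cinner f u * cnj (cinner g u)"
    using self_adjoint_opD(2)[OF self_adjoint_Gamma_tilde \<Gamma>'_mem[OF f] g] cinner_Gamma_tilde[OF f g] by simp
  also have "\<dots> = cinner (\<Gamma> (\<Gamma> f) - scaleC (cinner f u) u) g"
    using self_adjoint_opD(2)[OF self_adjoint \<Gamma>_mem[OF f] g] cinner_commute[of u g]
    by (simp add: cinner_simps)
  finally show "cinner (\<Gamma>' (\<Gamma>' f)) g = cinner (\<Gamma> (\<Gamma> f) - scaleC (cinner f u) u) g" .
qed

subsection \<open>The anti-linear Hankel operators\<close>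

lemma fourier_coeff_product:
  assumes f: "f \<in> H2"
  shows "fourier_coeff (\<lambda>z. rep_L2_circle u z * cnj (rep_L2_circle f z)) (int k) = coef (\<Gamma> (conj_coef f)) k"
proof -
  have [measurable]: "rep_L2_circle f \<in> borel_measurable borel" "rep_L2_circle u \<in> borel_measurable borel"
    using square_integrable_rep by (auto simp: square_integrable_def)
  have "fourier_coeff (\<lambda>z. rep_L2_circle u z * cnj (rep_L2_circle f z)) (int k) =
      (\<integral>z. rep_L2_circle u z * cnj (rep_L2_circle f z) * cnj (z powi int k) \<partial>circle_measure)"
    by (rule integral_mult_powi[symmetric]) measurable
  also have "\<dots> = (\<integral>z. rep_L2_circle u z * cnj (z ^ k * rep_L2_circle f z) \<partial>circle_measure)"
    by (intro Bochner_Integration.integral_cong) (auto simp: mult.commute mult.left_commute)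
  also have "\<dots> = cinner u ((shift ^^ k) f)"
    using cinner_abs_L2[OF square_integrable_rep[of u]] shift_funpow[of k f] by (simp add: abs_rep_L2)
  finally have *: "fourier_coeff (\<lambda>z. rep_L2_circle u z * cnj (rep_L2_circle f z)) (int k) = cinner u ((shift ^^ k) f)" .
  have "(\<lambda>n. coef u (n + k) * cnj (coef ((shift ^^ k) f) (n + k))) sums
      (cinner u ((shift ^^ k) f) - (\<Sum>n<k. coef u n * cnj (coef ((shift ^^ k) f) n)))"
    by (subst sums_iff_shift) (use parseval_left[OF u] in simp)
  also have "(\<Sum>n<k. coef u n * cnj (coef ((shift ^^ k) f) n)) = 0"
    by (intro sum.neutral) (auto simp: coef_shift_funpow_less[OF f])
  finally have "(\<lambda>n. coef u (k + n) * coef (conj_coef f) n) sums cinner u ((shift ^^ k) f)"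
    by (simp add: coef_shift_funpow conj_coef add.commute)
  then show ?thesis
    using coef_Gamma[OF conj_coef(1)] sums_unique2 * by metis
qed

text \<open>This is \<open>H = \<Gamma> C\<close>. The description in
  \<open>szego_projection\<close> needs an element of \<open>H2\<close> with the prescribed
  coefficients; for a product of two square-integrable functions \<open>\<Gamma>\<close> supplies
  it.\<close>

lemma H_op_eq:
  assumes f: "f \<in> H2"
  shows "H_op u f = \<Gamma> (conj_coef f)"
  unfolding H_op_def szego_projection_def
proof (rule the_equality)
  let ?g = "\<lambda>z. rep_L2_circle u z * cnj (rep_L2_circle f z)"
  show "\<Gamma> (conj_coef f) \<in> H2 \<and>
      (\<forall>k\<ge>0. fourier_coeff (rep_L2_circle (\<Gamma> (conj_coef f))) k = fourier_coeff ?g k)"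
  proof (intro conjI allI impI \<Gamma>_mem conj_coef(1))
    fix k :: int assume "0 \<le> k"
    then obtain n where "k = int n" by (metis nonneg_int_cases)
    then show "fourier_coeff (rep_L2_circle (\<Gamma> (conj_coef f))) k = fourier_coeff ?g k"
      using fourier_coeff_product[OF f, of n] by (simp add: fourier_coeff_rep coef_def)
  qed
  fix h assume h: "h \<in> H2 \<and> (\<forall>k\<ge>0. fourier_coeff (rep_L2_circle h) k = fourier_coeff ?g k)"
  show "h = \<Gamma> (conj_coef f)"
  proof (rule H2_eqI)
    show "coef h n = coef (\<Gamma> (conj_coef f)) n" for n
      using h fourier_coeff_product[OF f, of n] by (simp add: fourier_coeff_rep coef_def)
  qed (use h in \<open>auto intro: \<Gamma>_mem conj_coef(1)\<close>)
qed

lemma H_tilde_eq: "f \<in> H2 \<Longrightarrow> H_tilde u f = \<Gamma>' (conj_coef f)"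
  by (simp add: H_tilde_def Gamma_tilde_def H_op_eq shift_H2 conj_coef_shift)

lemma conj_coef_Gamma_tilde: "f \<in> H2 \<Longrightarrow> conj_coef (\<Gamma>' f) = \<Gamma>' (conj_coef f)"
  by (simp add: Gamma_tilde_def conj_coef_Gamma shift_H2 conj_coef_shift)

lemma H_op_square: "f \<in> H2 \<Longrightarrow> (H_op u \<circ> H_op u) f = \<Gamma> (\<Gamma> f)"
  by (simp add: H_op_eq \<Gamma>_mem conj_coef(1) conj_coef_Gamma conj_coef_conj_coef)

lemma H_tilde_square: "f \<in> H2 \<Longrightarrow> (H_tilde u \<circ> H_tilde u) f = \<Gamma>' (\<Gamma>' f)"
  by (simp add: H_tilde_eq \<Gamma>'_mem conj_coef(1) conj_coef_Gamma_tilde conj_coef_conj_coef)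

lemma ran_H_eq: "ran_H u = closure (\<Gamma> ` H2)"
proof -
  have "H_op u ` H2 = \<Gamma> ` H2"
  proof
    show "H_op u ` H2 \<subseteq> \<Gamma> ` H2"
      by (rule image_subsetI) (simp add: H_op_eq conj_coef(1))
    show "\<Gamma> ` H2 \<subseteq> H_op u ` H2"
    proof
      fix h assume "h \<in> \<Gamma> ` H2"
      then obtain f where f: "f \<in> H2" "h = \<Gamma> f" by auto
      then have "h = H_op u (conj_coef f)"
        using H_op_eq[OF conj_coef(1)[of f]] by (simp add: conj_coef_conj_coef)
      then show "h \<in> H_op u ` H2" using conj_coef(1) by blast
    qed
  qed
  then show ?thesis by (simp add: ran_H_def)
qed

end

section \<open>Cyclicity of the symbol\<close>

lemma cyclic_vector_cong:
  assumes eq: "\<And>x. x \<in> V \<Longrightarrow> A x = A' x" and mem: "\<And>x. x \<in> V \<Longrightarrow> A' x \<in> V"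
  shows "cyclic_vector V A v \<longleftrightarrow> cyclic_vector V A' v"
proof -
  have "(A ^^ n) v = (A' ^^ n) v \<and> (A' ^^ n) v \<in> V" if "v \<in> V" for n
    by (induction n) (use that eq mem in auto)
  then show ?thesis
    unfolding cyclic_vector_def by (cases "v \<in> V") auto
qed

section \<open>Orthogonality criteria for cyclicity and invariant complements\<close>

context hilbert_subspace
begin

lemma hilbert_subspace_closed_span:
  assumes w: "\<And>n. w n \<in> V"
  shows "hilbert_subspace (closure {\<Sum>n<N. scaleC (c n) (w n) | (N::nat) (c::nat \<Rightarrow> complex). True})"
    (is "hilbert_subspace (closure ?S)")
proof (rule hilbert_subspace_closure[OF hilbert_subspace_axioms])
  show "?S \<subseteq> V" using w by auto
  show "0 \<in> ?S"
    by (intro CollectI exI[of _ "0::nat"] exI[of _ "\<lambda>_. 0"]) simp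
  show "scaleC a x \<in> ?S" if x: "x \<in> ?S" for a x
  proof -
    obtain N c where "x = (\<Sum>n<N. scaleC (c n) (w n))" using x by blast
    then have "scaleC a x = (\<Sum>n<N. scaleC (a * c n) (w n))"
      by (simp add: scaleC_sum_right scaleC_scaleC)
    then show ?thesis
      by (intro CollectI exI[of _ N] exI[of _ "\<lambda>n. a * c n"]) simp
  qed
  show "x + y \<in> ?S" if xy: "x \<in> ?S" "y \<in> ?S" for x y
  proof -
    obtain N c where x: "x = (\<Sum>n<N. scaleC (c n) (w n))" using xy by blast
    obtain M d where y: "y = (\<Sum>n<M. scaleC (d n) (w n))" using xy by blast
    have pad: "(\<Sum>n<K. scaleC (a n) (w n)) = (\<Sum>n<max N M. scaleC (if n < K then a n else 0) (w n))"
      if "K \<le> max N M" for K and a :: "nat \<Rightarrow> complex"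
      using that by (intro sum.mono_neutral_cong_left) auto
    have "x + y = (\<Sum>n<max N M. scaleC ((if n < N then c n else 0) + (if n < M then d n else 0)) (w n))"
      unfolding x y using pad[of N c] pad[of M d] by (simp add: scaleC_add_left sum.distrib)
    then show ?thesis
      by (intro CollectI exI[of _ "max N M"]
          exI[of _ "\<lambda>n. (if n < N then c n else 0) + (if n < M then d n else 0)"]) simp
  qed
qed

text \<open>Projecting \<open>x\<close> onto the closed span of the orbit leaves a remainder
  orthogonal to the orbit, hence 0.\<close>

lemma cyclic_vectorI:
  assumes v: "v \<in> V" and A: "\<And>x. x \<in> V \<Longrightarrow> A x \<in> V"
    and orth: "\<And>y. y \<in> V \<Longrightarrow> (\<And>n. cinner y ((A ^^ n) v) = 0) \<Longrightarrow> y = 0"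
  shows "cyclic_vector V A v"
proof -
  let ?S = "{\<Sum>n<N. scaleC (c n) ((A ^^ n) v) | (N::nat) (c::nat \<Rightarrow> complex). True}"
  have Av: "(A ^^ n) v \<in> V" for n
    by (induction n) (auto simp: v A)
  interpret M: hilbert_subspace "closure ?S"
    by (rule hilbert_subspace_closed_span[OF Av])
  have "?S \<subseteq> V" using Av by auto
  then have sub: "closure ?S \<subseteq> V"
    using closed closure_minimal by blast
  have "x \<in> closure ?S" if x: "x \<in> V" for x
  proof -
    have "x - M.proj x = 0"
    proof (rule orth)
      show "x - M.proj x \<in> V"
        by (rule diff_mem[OF x subsetD[OF sub M.proj_mem]])
      fix n
      have "(A ^^ n) v \<in> ?S"
        by (intro CollectI exI[of _ "Suc n"] exI[of _ "\<lambda>m. if m = n then 1 else 0"]) simp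
      then have "(A ^^ n) v \<in> closure ?S"
        by (rule subsetD[OF closure_subset])
      then show "cinner (x - M.proj x) ((A ^^ n) v) = 0"
        by (rule M.cinner_diff_proj)
    qed
    then have eq: "x = M.proj x" by simp
    show ?thesis by (subst eq) (rule M.proj_mem)
  qed
  then have "closure ?S = V"
    by (intro subset_antisym[OF sub] subsetI)
  then show ?thesis
    unfolding cyclic_vector_def using v by simp
qed

lemma self_adjoint_op_subset:
  assumes T: "self_adjoint_op V T" and W: "W \<subseteq> V" "\<And>x. x \<in> W \<Longrightarrow> T x \<in> W"
  shows "self_adjoint_op W T"
  unfolding self_adjoint_op_def
proof (intro conjI ballI)
  note bT = self_adjoint_opD(1)[OF T]
  have WV: "x \<in> V" if "x \<in> W" for x using that W by blast
  obtain K where "\<And>x. x \<in> V \<Longrightarrow> norm (T x) \<le> K * norm x"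
    using bounded_op_bound[OF bT] by blast
  then show "bounded_op W T"
    by (intro bounded_opI[where K = K]) (use W(2) WV bounded_opD[OF bT] in simp_all)
  show "cinner (T x) y = cinner x (T y)" if "x \<in> W" "y \<in> W" for x y
    by (rule self_adjoint_opD(2)[OF T WV[OF that(1)] WV[OF that(2)]])
qed

lemma orthogonal_powers_subspace:
  assumes A: "self_adjoint_op V A" and v: "v \<in> V"
  shows "hilbert_subspace {y\<in>V. \<forall>n. cinner y ((A ^^ n) v) = 0}" (is "hilbert_subspace ?N")
    and "\<And>y. y \<in> V \<Longrightarrow> (\<forall>n. cinner y ((A ^^ n) v) = 0) \<Longrightarrow> (\<forall>n. cinner (A y) ((A ^^ n) v) = 0)"
proof -
  note bA = self_adjoint_opD(1)[OF A]
  have Av: "(A ^^ n) v \<in> V" for n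
    by (rule bounded_opD(1)[OF bounded_op_funpow[OF bA] v])
  show "hilbert_subspace ?N"
  proof (rule hilbert_subspace_closed_subset[OF hilbert_subspace_axioms])
    show "closed ?N"
      unfolding closed_sequential_limits
    proof (intro allI impI, elim conjE)
      fix X x assume X: "\<forall>k. X k \<in> ?N" "X \<longlonglongrightarrow> x"
      then have "x \<in> V" using lim_mem[of X] by auto
      moreover have "cinner x ((A ^^ n) v) = 0" for n
      proof -
        have "(\<lambda>k. cinner (X k) ((A ^^ n) v)) \<longlonglongrightarrow> cinner x ((A ^^ n) v)"
          by (intro tendsto_intros X)
        then show ?thesis using X(1) by (simp add: LIMSEQ_const_iff)
      qed
      ultimately show "x \<in> ?N" by simp
    qed
  qed (auto simp: cinner_simps)
  fix y assume y: "y \<in> V" "\<forall>n. cinner y ((A ^^ n) v) = 0"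
  show "\<forall>n. cinner (A y) ((A ^^ n) v) = 0"
  proof
    fix n
    have "cinner (A y) ((A ^^ n) v) = cinner y ((A ^^ Suc n) v)"
      using self_adjoint_opD(2)[OF A y(1) Av] by simp
    then show "cinner (A y) ((A ^^ n) v) = 0" using y(2) by metis
  qed
qed

end

section \<open>The closed range and its subspaces orthogonal to the symbol\<close>

context self_adjoint_hankel
begin

abbreviation V :: "L2_circle set" where "V \<equiv> ran_H u"

lemma V_subset: "V \<subseteq> H2" and hilbert_subspace_V: "hilbert_subspace V"
  using H2.closure_range_subset[OF self_adjoint] by (simp_all add: ran_H_eq)

sublocale V: hilbert_subspace V
  by (rule hilbert_subspace_V)

lemma Gamma_V: "f \<in> H2 \<Longrightarrow> \<Gamma> f \<in> V"
  unfolding ran_H_eq by (rule subsetD[OF closure_subset imageI])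

lemma Gamma_tilde_V: "f \<in> H2 \<Longrightarrow> \<Gamma>' f \<in> V"
  by (simp add: Gamma_tilde_def Gamma_V shift_H2)

lemma V_H2: "f \<in> V \<Longrightarrow> f \<in> H2"
  using V_subset by blast

lemma u_V: "u \<in> V"
  using Gamma_V[OF monomial_H2[of 0]] by (simp add: Gamma_one)

lemma self_adjoint_V: "self_adjoint_op V \<Gamma>" "self_adjoint_op V \<Gamma>'"
  by (rule H2.self_adjoint_op_subset[OF self_adjoint V_subset], rule Gamma_V[OF V_H2], assumption)
    (rule H2.self_adjoint_op_subset[OF self_adjoint_Gamma_tilde V_subset], rule Gamma_tilde_V[OF V_H2], assumption)

lemma self_adjoint_V_square: "self_adjoint_op V (\<Gamma> \<circ> \<Gamma>)" "self_adjoint_op V (\<Gamma>' \<circ> \<Gamma>')"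
  using positive_opD(1)[OF V.positive_op_square[OF self_adjoint_V(1)]]
    positive_opD(1)[OF V.positive_op_square[OF self_adjoint_V(2)]]
  by (simp_all add: comp_def)

text \<open>A vector of the kernel is orthogonal to the range, and \<open>f\<close> is a limit of
  vectors of the range.\<close>

lemma kernel_Gamma_V:
  assumes f: "f \<in> V" and 0: "\<Gamma> f = 0"
  shows "f = 0"
proof -
  obtain X where X: "\<And>n. X n \<in> \<Gamma> ` H2" "X \<longlonglongrightarrow> f"
    using f unfolding ran_H_eq closure_sequential by blast
  have "cinner f (X n) = 0" for n
  proof -
    obtain g where g: "g \<in> H2" "X n = \<Gamma> g" using X(1)[of n] by auto
    then show ?thesis
      using self_adjoint_opD(2)[OF self_adjoint V_H2[OF f] g(1)] 0 by simp
  qed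
  moreover have "(\<lambda>n. cinner f (X n)) \<longlonglongrightarrow> cinner f f"
    by (intro tendsto_intros X)
  ultimately have "cinner f f = 0" by (simp add: LIMSEQ_const_iff)
  then show ?thesis by simp
qed

text \<open>On a reducing subspace orthogonal to \<open>u\<close> the squares of \<open>\<Gamma>\<close> and \<open>\<Gamma>'\<close> agree. Since their
  commutants are commutative, the subspace also reduces \<open>\<Gamma>\<close> and \<open>\<Gamma>'\<close>; there \<open>\<Gamma> = shift \<circ> \<Gamma>'\<close>, so
  the subspace is contained in its own shift and all its coefficients vanish.\<close>

lemma reducing_orthogonal_trivial:
  assumes v: "cyclic_vector V (\<Gamma> \<circ> \<Gamma>) v" and v': "cyclic_vector V (\<Gamma>' \<circ> \<Gamma>') v'"
    and N: "hilbert_subspace N" "N \<subseteq> V" and orth: "\<And>x. x \<in> N \<Longrightarrow> cinner x u = 0"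
    and inv: "\<And>x. x \<in> N \<Longrightarrow> \<Gamma> (\<Gamma> x) \<in> N" and x: "x \<in> N"
  shows "x = 0"
proof -
  interpret N: hilbert_subspace N by fact
  have NV: "y \<in> V" if "y \<in> N" for y using that N by blast
  have NH: "y \<in> H2" if "y \<in> N" for y using NV[OF that] V_H2 by blast
  \<comment> \<open>Orthogonality to \<open>u\<close> removes the rank-one term of
    \<open>Gamma_tilde_square\<close>.\<close>
  have inv': "\<Gamma>' (\<Gamma>' y) \<in> N" if "y \<in> N" for y
    using Gamma_tilde_square[OF NH[OF that]] orth[OF that] inv[OF that] by simp
  have P: "self_adjoint_op V N.proj"
    using V.projection_opD(1)[OF V.projection_proj[OF N]] .
  \<comment> \<open>For a self-adjoint operator an invariant closed subspace is reducing.\<close>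
  have commute: "N.proj (T y) = T (N.proj y)"
    if T: "self_adjoint_op V T" and TN: "\<And>z. z \<in> N \<Longrightarrow> T z \<in> N" and y: "y \<in> V" for T y
  proof (rule N.proj_eqI)
    show "T (N.proj y) \<in> N" by (rule TN[OF N.proj_mem])
    fix z assume z: "z \<in> N"
    have "cinner (T (N.proj y)) z = cinner (N.proj y) (T z)"
      by (rule self_adjoint_opD(2)[OF T NV[OF N.proj_mem] NV[OF z]])
    also have "\<dots> = cinner y (T z)" by (rule N.cinner_proj_left[OF TN[OF z]])
    also have "\<dots> = cinner (T y) z" by (rule self_adjoint_opD(2)[OF T y NV[OF z], symmetric])
    finally show "cinner (T (N.proj y)) z = cinner (T y) z" .
  qed
  \<comment> \<open>Both the projection and \<open>\<Gamma>\<close> commute with the square of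
    \<open>\<Gamma>\<close>, which has a cyclic vector, so they commute with each other. This is how
    invariance under the square becomes invariance under \<open>\<Gamma>\<close> itself.\<close>
  have "N.proj (\<Gamma> y) = \<Gamma> (N.proj y)" if "y \<in> V" for y
    by (rule V.commutant_commutative[OF self_adjoint_V_square(1) v P _ self_adjoint_V(1) _ that])
      (use commute[OF self_adjoint_V_square(1)] inv in auto)
  then have GN: "\<Gamma> y \<in> N" if "y \<in> N" for y
    using that NV N.proj_ident N.proj_mem by metis
  have "N.proj (\<Gamma>' y) = \<Gamma>' (N.proj y)" if "y \<in> V" for y
    by (rule V.commutant_commutative[OF self_adjoint_V_square(2) v' P _ self_adjoint_V(2) _ that])
      (use commute[OF self_adjoint_V_square(2)] inv' in auto)
  then have GN': "\<Gamma>' y \<in> N" if "y \<in> N" for y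
    using that NV N.proj_ident N.proj_mem by metis
  \<comment> \<open>\<open>\<Gamma>'\<close> drops the first coefficient of the image and the shift
    restores a 0 there; nothing is lost, because that coefficient is the inner product with
    \<open>u\<close>.\<close>
  have shift_Gamma: "\<Gamma> y = shift (\<Gamma>' y)" if y: "y \<in> N" for y
  proof (rule H2_eqI)
    show "\<Gamma> y \<in> H2" "shift (\<Gamma>' y) \<in> H2"
      using NH[OF y] by (auto simp: \<Gamma>_mem \<Gamma>'_mem shift_H2)
    have 0: "coef (\<Gamma> y) 0 = 0"
      using self_adjoint_opD(2)[OF self_adjoint NH[OF y] monomial_H2[of 0]] orth[OF y]
      by (simp add: coef_def Gamma_one)
    show "coef (\<Gamma> y) n = coef (shift (\<Gamma>' y)) n" for n
      by (cases n) (simp_all add: 0 coef_shift_0 coef_shift_Suc \<Gamma>'_mem NH[OF y] coef_Gamma_tilde)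
  qed
  have sN: "self_adjoint_op N \<Gamma>"
    by (rule V.self_adjoint_op_subset[OF self_adjoint_V(1) N(2) GN])
  interpret L: hilbert_subspace "closure (\<Gamma> ` N)"
    by (rule N.closure_range_subset(3)[OF sN])
  \<comment> \<open>\<open>\<Gamma>\<close> is injective on \<open>V\<close>, hence on
    \<open>N\<close>, and self-adjoint there, so its range on \<open>N\<close> is dense in
    \<open>N\<close>.\<close>
  have dense: "z \<in> closure (\<Gamma> ` N)" if z: "z \<in> N" for z
  proof -
    define y where "y = z - L.proj z"
    have y: "y \<in> N"
      unfolding y_def by (rule N.diff_mem[OF z subsetD[OF N.closure_range_subset(1)[OF sN] L.proj_mem]])
    have "\<Gamma> y = 0"
      by (rule N.orthogonal_range_kernel[OF sN y]) (simp add: y_def L.cinner_diff_proj)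
    then have "y = 0" by (rule kernel_Gamma_V[OF NV[OF y]])
    then have "z = L.proj z" by (simp add: y_def)
    then show ?thesis using L.proj_mem by metis
  qed
  \<comment> \<open>On the dense range this is \<open>shift_Gamma\<close>. The shift is isometric,
    so preimages of a convergent sequence converge, and they do so within \<open>N\<close>.\<close>
  have in_shift: "\<exists>y\<in>N. z = shift y" if z: "z \<in> N" for z
  proof -
    obtain X where X: "\<And>n. X n \<in> \<Gamma> ` N" "X \<longlonglongrightarrow> z"
      using dense[OF z] unfolding closure_sequential by blast
    have "\<forall>n. \<exists>y\<in>N. X n = shift y"
      using X(1) shift_Gamma GN' by fastforce
    then obtain Y where Y: "\<And>n. Y n \<in> N" "\<And>n. X n = shift (Y n)" by metis
    have "norm (Y m - Y n) = norm (X m - X n)" for m n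
    proof -
      have "shift (Y m - Y n) = X m - X n"
        by (simp add: diff_eq_scaleC shift_add shift_scaleC Y)
      then show ?thesis by (metis norm_shift)
    qed
    then have "Cauchy Y"
      using LIMSEQ_imp_Cauchy[OF X(2)] unfolding Cauchy_iff by simp
    then obtain y where y: "y \<in> N" "Y \<longlonglongrightarrow> y"
      using N.Cauchy_lim[of Y] Y(1) by blast
    have "(\<lambda>n. shift (Y n)) \<longlonglongrightarrow> shift y"
      by (rule H2.bounded_op_tendsto[OF bounded_op_shift NH[OF Y(1)] NH[OF y(1)] y(2)])
    then have "X \<longlonglongrightarrow> shift y"
      by (simp flip: Y(2))
    then show ?thesis
      using X(2) y(1) LIMSEQ_unique by blast
  qed
  \<comment> \<open>Every element of \<open>N\<close> is the shift of another one, so its first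
    coefficient is 0 and the others are coefficients of lower index of an element of
    \<open>N\<close>.\<close>
  have "coef z n = 0" if "z \<in> N" for z n
    using that
  proof (induction n arbitrary: z)
    case 0
    then obtain y where "y \<in> N" "z = shift y" using in_shift by blast
    then show ?case by (simp add: coef_shift_0 NH)
  next
    case (Suc n)
    then obtain y where "y \<in> N" "z = shift y" using in_shift by blast
    then show ?case using Suc.IH by (simp add: coef_shift_Suc)
  qed
  then show "x = 0"
    using x by (intro H2_eqI) (auto simp: NH)
qed

lemma u_cyclic:
  assumes v: "cyclic_vector V (\<Gamma> \<circ> \<Gamma>) v" and v': "cyclic_vector V (\<Gamma>' \<circ> \<Gamma>') v'"
  shows "cyclic_vector V (\<Gamma> \<circ> \<Gamma>) u" "cyclic_vector V (\<Gamma>' \<circ> \<Gamma>') u"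
proof -
  note A = self_adjoint_V_square
  show "cyclic_vector V (\<Gamma> \<circ> \<Gamma>) u"
  proof (rule V.cyclic_vectorI[OF u_V bounded_opD(1)[OF self_adjoint_opD(1)[OF A(1)]]])
    fix y assume y: "y \<in> V" "\<And>n. cinner y (((\<Gamma> \<circ> \<Gamma>) ^^ n) u) = 0"
    let ?N = "{y\<in>V. \<forall>n. cinner y (((\<Gamma> \<circ> \<Gamma>) ^^ n) u) = 0}"
    show "y = 0"
    proof (rule reducing_orthogonal_trivial[OF v v' V.orthogonal_powers_subspace(1)[OF A(1) u_V]])
      fix x assume x: "x \<in> ?N"
      then have xV: "x \<in> V" and xo: "\<forall>n. cinner x (((\<Gamma> \<circ> \<Gamma>) ^^ n) u) = 0" by auto
      show "cinner x u = 0" using xo[rule_format, of 0] by simp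
      show "\<Gamma> (\<Gamma> x) \<in> ?N"
        using V.orthogonal_powers_subspace(2)[OF A(1) u_V xV xo] Gamma_V V_H2 xV by auto
    qed (use y in auto)
  qed
  show "cyclic_vector V (\<Gamma>' \<circ> \<Gamma>') u"
  proof (rule V.cyclic_vectorI[OF u_V bounded_opD(1)[OF self_adjoint_opD(1)[OF A(2)]]])
    fix y assume y: "y \<in> V" "\<And>n. cinner y (((\<Gamma>' \<circ> \<Gamma>') ^^ n) u) = 0"
    let ?N = "{y\<in>V. \<forall>n. cinner y (((\<Gamma>' \<circ> \<Gamma>') ^^ n) u) = 0}"
    show "y = 0"
    proof (rule reducing_orthogonal_trivial[OF v v' V.orthogonal_powers_subspace(1)[OF A(2) u_V]])
      fix x assume x: "x \<in> ?N"
      then have xV: "x \<in> V" and xo: "\<forall>n. cinner x (((\<Gamma>' \<circ> \<Gamma>') ^^ n) u) = 0" by auto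
      show xu: "cinner x u = 0" using xo[rule_format, of 0] by simp
      \<comment> \<open>Here the subspace is built from \<open>\<Gamma>'\<close>, while the
        triviality lemma wants invariance under the square of \<open>\<Gamma>\<close>; orthogonality
        to \<open>u\<close> makes the squares interchangeable.\<close>
      have "\<Gamma>' (\<Gamma>' x) = \<Gamma> (\<Gamma> x)"
        using Gamma_tilde_square[OF V_H2[OF xV]] xu by simp
      then show "\<Gamma> (\<Gamma> x) \<in> ?N"
        using V.orthogonal_powers_subspace(2)[OF A(2) u_V xV xo] Gamma_V V_H2 xV by auto
    qed (use y in auto)
  qed
qed

section \<open>The theorem\<close>

lemma conj_coef_u: "conj_coef u = u"
  by (rule H2_eqI) (auto simp: conj_coef u cnj_coef_u)

text \<open>One argument for both pairs: \<open>Q\<close> is the anti-linear operator and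
  \<open>T\<close> its linear counterpart. \<open>\<psi>\<close> is the phase exactly as it stands
  in the relation for \<open>Q\<close>, so it will be the conjugate of \<open>\<Psi>\<close> in one
  case and \<open>\<Psi>'\<close> in the other.\<close>

lemma polar_decomposition_phase:
  assumes T: "self_adjoint_op H2 T" "T ` H2 \<subseteq> V"
    and conj: "\<And>f. f \<in> H2 \<Longrightarrow> conj_coef (T f) = T (conj_coef f)"
    and Q: "\<And>f. f \<in> H2 \<Longrightarrow> Q f = T (conj_coef f)"
    and cyclic: "cyclic_vector V (T \<circ> T) u"
    and \<psi>: "\<psi> \<in> borel_measurable borel"
    and unimod: "AE t in spectral_measure H2 (sqrt_op H2 (Q \<circ> Q)) u. 0 < t \<longrightarrow> norm (\<psi> t) = 1"
    and phase: "\<And>f. f \<in> borel_measurable borel \<Longrightarrow>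
      integrable (spectral_measure H2 (sqrt_op H2 (Q \<circ> Q)) u) (\<lambda>t. (norm (f t))\<^sup>2) \<Longrightarrow>
      Q (borel_calculus V (sqrt_op V (Q \<circ> Q)) f u) =
        sqrt_op V (Q \<circ> Q) (borel_calculus V (sqrt_op V (Q \<circ> Q)) \<psi>
          (borel_calculus V (sqrt_op V (Q \<circ> Q)) (\<lambda>t. cnj (f t)) u))"
  shows "polar_decomposition H2 T (borel_calculus H2 (abs_op H2 T) (zero_at_kernel T \<psi>))"
    and "polar_decomposition H2 T (borel_calculus H2 (abs_op H2 T) (zero_at_kernel T (\<lambda>t. cnj (\<psi> t))))"
proof -
  note bT = self_adjoint_opD(1)[OF T(1)]
  have TV: "T f \<in> V" if "f \<in> H2" for f using T(2) that by blast
  have QQ: "(Q \<circ> Q) f = T (T f)" if "f \<in> H2" for f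
    using that bounded_opD(1)[OF bT] by (simp add: Q conj_coef(1) conj conj_coef_conj_coef)
  have sqrt_H2: "sqrt_op H2 (Q \<circ> Q) = abs_op H2 T"
    unfolding H2.abs_op_eq_sqrt_op[OF T(1)] by (rule H2.sqrt_op_cong[OF QQ])
  have sV: "self_adjoint_op V T"
    by (rule H2.self_adjoint_op_subset[OF T(1) V_subset TV[OF V_H2]])
  define B where "B = sqrt_op V (Q \<circ> Q)"
  have "B = sqrt_op V (\<lambda>f. T (T f))"
    unfolding B_def by (rule V.sqrt_op_cong[OF QQ[OF V_H2]])
  then have B: "positive_op V B" "\<And>f. f \<in> V \<Longrightarrow> B (B f) = T (T f)"
    using V.sqrt_op_spec[OF V.positive_op_square[OF sV]] by auto
  interpret B: self_adjoint_operator V B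
    by unfold_locales (rule positive_opD(1)[OF B(1)])
  interpret A: self_adjoint_operator H2 "abs_op H2 T"
    by unfold_locales (rule positive_opD(1)[OF H2.abs_op_self_adjoint(1)[OF T(1)]])
  \<comment> \<open>\<open>B\<close> is a root of the square of \<open>T\<close>, so even powers of
    \<open>B\<close> on \<open>u\<close> can be written without any calculus.\<close>
  have power: "((T \<circ> T) ^^ n) u \<in> V \<and> (B ^^ (2 * n)) u = ((T \<circ> T) ^^ n) u" for n
  proof (induction n)
    case (Suc n)
    then show ?case
      using B(2) TV V_H2 by simp
  qed (simp add: u_V)
  have conj_power: "conj_coef (((T \<circ> T) ^^ n) u) = ((T \<circ> T) ^^ n) u" for n
  proof (induction n)
    case (Suc n)
    define y where "y = ((T \<circ> T) ^^ n) u"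
    have "y \<in> H2" "conj_coef y = y"
      unfolding y_def using power[of n] V_H2 Suc by blast+
    then have "conj_coef (T (T y)) = T (T y)"
      using conj bounded_opD(1)[OF bT] by simp
    then show ?case by (simp add: y_def comp_def)
  qed (simp add: conj_coef_u)
  have phase_power: "T (((T \<circ> T) ^^ n) u) = B (borel_calculus V B \<psi> (((T \<circ> T) ^^ n) u))" for n
  proof -
    \<comment> \<open>The test function for the relation: a real power, so the conjugation of
      \<open>f\<close> disappears; even, so that it produces the orbit of \<open>u\<close> under
      \<open>T \<circ> T\<close>; and truncated, so that it is bounded. The orbit is fixed by
      \<open>conj_coef\<close>, hence \<open>Q\<close> acts on it as \<open>T\<close>.\<close>
    define f where "f t = B.spectral_id t ^ (2 * n)" for t
    have f: "bounded_borel f"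
      unfolding f_def[abs_def] by (rule B.bounded_borel_power[OF B.bounded_borel_spectral_id])
    have cnj_f: "(\<lambda>t. cnj (f t)) = f"
      by (auto simp: f_def B.spectral_id_def)
    have fu: "borel_calculus V B f u = ((T \<circ> T) ^^ n) u"
      using B.borel_calculus_bounded[OF f u_V] B.calc_spectral_id_power[OF u_V, of "2 * n"] power[of n]
      by (simp add: f_def[abs_def])
    obtain M where M: "\<And>t. norm (f t) \<le> M" using f by (auto simp: bounded_borel_def)
    have [measurable]: "f \<in> borel_measurable borel" using f by (simp add: bounded_borel_def)
    interpret finite_measure "A.\<mu> u" by (rule A.finite_measure_\<mu>[OF u])
    have "integrable (A.\<mu> u) (\<lambda>t. (norm (f t))\<^sup>2)"
      by (rule integrable_const_bound[where B = "M\<^sup>2"]) (auto simp: M power_mono)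
    then have "Q (((T \<circ> T) ^^ n) u) = B (borel_calculus V B \<psi> (((T \<circ> T) ^^ n) u))"
      using phase[of f] by (simp add: sqrt_H2 cnj_f fu flip: B_def)
    moreover have "((T \<circ> T) ^^ n) u \<in> H2" using power[of n] V_H2 by blast
    ultimately show ?thesis
      using Q conj_power by simp
  qed
  have zk: "zero_at_kernel T \<psi> \<in> borel_measurable borel"
    unfolding zero_at_kernel_def[abs_def] using \<psi> by measurable
  have zero: "zero_at_kernel T \<psi> 0 = 0 \<or> (\<forall>x\<in>H2. T x = 0 \<longrightarrow> x = 0)"
    by (auto simp: zero_at_kernel_def)
  note result = H2.polar_decomposition_cyclic[OF T(1) hilbert_subspace_V V_subset T(2) B cyclic \<psi>
      unimod[unfolded sqrt_H2] phase_power zk _ zero]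
  show "polar_decomposition H2 T (borel_calculus H2 (abs_op H2 T) (zero_at_kernel T \<psi>))"
    by (rule result(1)) (simp_all add: zero_at_kernel_def)
  have "(\<lambda>t. cnj (zero_at_kernel T \<psi> t)) = zero_at_kernel T (\<lambda>t. cnj (\<psi> t))"
    by (rule ext) (auto simp: zero_at_kernel_def)
  moreover have "polar_decomposition H2 T (borel_calculus H2 (abs_op H2 T) (\<lambda>t. cnj (zero_at_kernel T \<psi> t)))"
    by (rule result(2)) (simp_all add: zero_at_kernel_def)
  ultimately show "polar_decomposition H2 T (borel_calculus H2 (abs_op H2 T) (zero_at_kernel T (\<lambda>t. cnj (\<psi> t))))"
    by simp
qed

end

theorem theorem1p7:
  fixes u :: L2_circle and \<Psi> \<Psi>' :: "real \<Rightarrow> complex"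
  assumes "u \<in> BMOA_simp"
    and "self_adjoint_op H2 (Gamma_op u)"
    and "is_Psi u \<Psi>"
    and "is_Psi_tilde u \<Psi>'"
  shows "polar_decomposition H2 (Gamma_op u)
           (borel_calculus H2 (abs_op H2 (Gamma_op u)) (zero_at_kernel (Gamma_op u) \<Psi>)) \<and>
         polar_decomposition H2 (Gamma_tilde u)
           (borel_calculus H2 (abs_op H2 (Gamma_tilde u)) (zero_at_kernel (Gamma_tilde u) \<Psi>'))"
proof -
  interpret self_adjoint_hankel u
    using assms(1,2) by unfold_locales (auto simp: BMOA_simp_def BMOA_def)
  have "simple_spectrum V (H_op u \<circ> H_op u)" "simple_spectrum V (H_tilde u \<circ> H_tilde u)"
    using assms(1) by (auto simp: BMOA_simp_def)
  moreover have "cyclic_vector V (H_op u \<circ> H_op u) v \<longleftrightarrow> cyclic_vector V (\<Gamma> \<circ> \<Gamma>) v" for v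
    by (rule cyclic_vector_cong)
      (simp_all add: H_op_square[OF V_H2, unfolded o_apply] Gamma_V \<Gamma>_mem V_H2)
  moreover have "cyclic_vector V (H_tilde u \<circ> H_tilde u) v \<longleftrightarrow> cyclic_vector V (\<Gamma>' \<circ> \<Gamma>') v" for v
    by (rule cyclic_vector_cong)
      (simp_all add: H_tilde_square[OF V_H2, unfolded o_apply] Gamma_tilde_V \<Gamma>'_mem V_H2)
  ultimately obtain v v' where "cyclic_vector V (\<Gamma> \<circ> \<Gamma>) v" "cyclic_vector V (\<Gamma>' \<circ> \<Gamma>') v'"
    unfolding simple_spectrum_def by blast
  note cyclic = u_cyclic[OF this]
  have Psi [measurable]: "\<Psi> \<in> borel_measurable borel" "AE t in rho u. norm (\<Psi> t) = 1"
    "\<And>f. f \<in> borel_measurable borel \<Longrightarrow> integrable (rho u) (\<lambda>t. (norm (f t))\<^sup>2) \<Longrightarrow>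
      H_op u (borel_calculus V (abs_H V u) f u) =
        abs_H V u (borel_calculus V (abs_H V u) (\<lambda>t. cnj (\<Psi> t)) (borel_calculus V (abs_H V u) (\<lambda>t. cnj (f t)) u))"
    using assms(3) by (auto simp: is_Psi_def Let_def)
  have Psi': "\<Psi>' \<in> borel_measurable borel"
    "AE t in restrict_space (rho_tilde u) {0<..}. norm (\<Psi>' t) = 1"
    "\<And>f. f \<in> borel_measurable borel \<Longrightarrow> integrable (rho_tilde u) (\<lambda>t. (norm (f t))\<^sup>2) \<Longrightarrow>
      H_tilde u (borel_calculus V (abs_H_tilde V u) f u) =
        abs_H_tilde V u (borel_calculus V (abs_H_tilde V u) \<Psi>' (borel_calculus V (abs_H_tilde V u) (\<lambda>t. cnj (f t)) u))"
    using assms(4) by (auto simp: is_Psi_tilde_def Let_def)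
  have sets_rho: "sets (rho_tilde u) = sets borel" "space (rho_tilde u) = UNIV"
    using sets.sigma_sets_eq[of "borel :: real measure"]
    by (simp_all add: rho_tilde_def spectral_measure_def scalar_measure_def)
  \<comment> \<open>The relation defining \<open>\<Psi>\<close> contains its conjugate, so the
    latter is fed in as phase, and the adjoint form of the conclusion conjugates it back. The
    relation for \<open>\<Psi>'\<close> has no conjugation, whence the other form below.\<close>
  have "polar_decomposition H2 \<Gamma> (borel_calculus H2 (abs_op H2 \<Gamma>) (zero_at_kernel \<Gamma> (\<lambda>t. cnj (cnj (\<Psi> t)))))"
  proof (rule polar_decomposition_phase(2)[OF self_adjoint image_subsetI[OF Gamma_V] conj_coef_Gamma H_op_eq cyclic(1)])
    show "(\<lambda>t. cnj (\<Psi> t)) \<in> borel_measurable borel" by measurable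
    show "AE t in spectral_measure H2 (sqrt_op H2 (H_op u \<circ> H_op u)) u. 0 < t \<longrightarrow> norm (cnj (\<Psi> t)) = 1"
      using Psi(2) unfolding rho_def abs_H_def by (rule eventually_mono) simp
  qed (assumption | rule Psi(3)[unfolded rho_def abs_H_def])+
  moreover have "polar_decomposition H2 \<Gamma>' (borel_calculus H2 (abs_op H2 \<Gamma>') (zero_at_kernel \<Gamma>' \<Psi>'))"
  proof (rule polar_decomposition_phase(1)[OF self_adjoint_Gamma_tilde image_subsetI[OF Gamma_tilde_V]
        conj_coef_Gamma_tilde H_tilde_eq cyclic(2) Psi'(1)])
    show "AE t in spectral_measure H2 (sqrt_op H2 (H_tilde u \<circ> H_tilde u)) u. 0 < t \<longrightarrow> norm (\<Psi>' t) = 1"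
    proof -
      have "AE t in rho_tilde u. 0 < t \<longrightarrow> norm (\<Psi>' t) = 1"
        using Psi'(2) sets_rho by (subst (asm) AE_restrict_space_iff) auto
      then show ?thesis unfolding rho_tilde_def abs_H_tilde_def .
    qed
  qed (assumption | rule Psi'(3)[unfolded rho_tilde_def abs_H_tilde_def])+
  ultimately show ?thesis by simp
qed

end
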